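(* Let $T>0$, let $A:\mathbb{R}\to\mathbb{H}^{n\times n}$ be continuous and $T$-periodic, and let $M(t)=P(t)e^{tB}$ be a Floquet normal form of a fundamental matrix $M(t)$ of the system $\dot{\boldsymbol{x}}=A(t)\boldsymbol{x}$. Then the following assertions hold. (1) The system is stable if and only if the standard eigenvalues of $B$ all have non-positive real parts and the algebraic multiplicity equals the geometric multiplicity for each standard eigenvalue of $B$ with zero real part; or equivalently, if and only if the characteristic multipliers of the system all have modulus at most $1$ and the algebraic multiplicity equals the geometric multiplicity for each characteristic multiplier of modulus one. (2) The system is asymptotically stable if and only if the standard eigenvalues of $B$ all have negative real parts; or equivalently, if and only if the characteristic multipliers of the system all have modulus less than $1$.
   Context: $\mathbb{H}$ is the real quaternion algebra with units $\mathbf{i},\mathbf{j},\mathbf{k}$, and $\mathbb{C}=\{a+b\mathbf{i}\}\subset\mathbb{H}$. For a quaternion matrix $X$, $e^X=\sum_{m\ge0}X^m/m!$. Eigenvalues. A right eigenvalue of $X\in\mathbb{H}^{n\times n}$ is $\lambda\in\mathbb{H}$ with $X\boldsymbol{\eta}=\boldsymbol{\eta}\lambda$ for some nonzero $\boldsymbol{\eta}\in\mathbb{H}^{n}$. Every $X\in\mathbb{H}^{n\times n}$ has a Jordan canonical form in $\mathbb{C}^{n\times n}$: there is an invertible $S\in\mathbb{H}^{n\times n}$ with $S^{-1}XS=J$, where $J\in\mathbb{C}^{n\times n}$ is a Jordan matrix all of whose diagonal entries have nonnegative imaginary part. The standard eigenvalues of $X$ are its right eigenvalues that are complex numbers with nonnegative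 imaginary part; counted with multiplicity there are exactly $n$, and they are the diagonal entries of $J$. The algebraic multiplicity of a standard eigenvalue $\lambda$ is the number of its occurrences on the diagonal of $J$; its geometric multiplicity is the complex dimension of $\{\boldsymbol{x}\in\mathbb{C}^n:(J-\lambda I)\boldsymbol{x}=0\}$. Floquet notions. A fundamental matrix of $\dot{\boldsymbol{x}}=A(t)\boldsymbol{x}$ is an invertible $\mathbb{H}^{n\times n}$-valued solution $M(t)$ of $\dot M=A(t)M$. A Floquet normal form of $M(t)$ is a representation $M(t)=P(t)e^{tB}$ for all $t$, where $P(t)$ is a $T$-periodic quaternion-matrix-valued function and $B\in\mathbb{H}^{n\times n}$ satisfies $e^{TB}=M^{-1}(0)M(T)$. The matrix $M^{-1}(0)M(T)$ is called a monodromy matrix of the system; any two monodromy matrices (from different fundamental matrices) are similar. The characteristic multipliers are the standard eigenvalues of any monodromy matrix, and their multiplicities are those as standard eigenvalues of a monodromy matrix. Stability. On $\mathbb{H}^n$ use $\|\boldsymbol{\eta}\|=\sum_k|\eta_k|$, and fix an initial time $t_0$. A solution $\boldsymbol{\phi}(t,t_0,\boldsymbol{x}_0)$ (with value $\boldsymbol{x}_0$ at $t_0$) is stable if for every $\epsilon>0$ there is $\delta>0$ such that $\|\boldsymbol{x}-\boldsymbol{x}_0\|<\delta$ implies $\|\boldsymbol{\phi}(t,t_0,\boldsymbol{x})-\boldsymbol{\phi}(t,t_0,\boldsymbol{x}_0)\|<\epsilon$ for all $t\ge t_0$; it is asymptotically stable if there is $\delta>0$ such that $\lim_{t\to\infty}\|\boldsymbol{\phi}(t,t_0,\boldsymbol{x})-\boldsymbol{\phi}(t,t_0,\boldsymbol{x}_0)\|=0$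 whenever $\|\boldsymbol{x}-\boldsymbol{x}_0\|<\delta$. A linear homogeneous system is called stable (asymptotically stable) if its zero solution is (equivalently, all its solutions are). *)

theory Defs
  imports "Jordan_Normal_Form.Jordan_Normal_Form" "HOL-Analysis.Analysis"
begin

text \<open>
  Matrices are \<open>'a ^ 'n ^ 'n\<close> from HOL-Analysis throughout; only \<^const>\<open>jordan_matrix\<close> is taken
  from the AFP entry, whose clashing infix notation is therefore switched off.
\<close>

no_notation vec_index (infixl \<open>$\<close> 100)
no_notation scalar_prod (infix \<open>\<bullet>\<close> 70)


section \<open>Quaternions\<close>

text \<open>\<open>Quat a b c d\<close> is the quaternion \<open>a + b \<i> + c \<j> + d \<k>\<close>.\<close>

datatype quat = Quat (quat_re: real) (quat_i: real) (quat_j: real) (quat_k: real)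

lemma quat_eq_iff:
  "p = q \<longleftrightarrow> quat_re p = quat_re q \<and> quat_i p = quat_i q \<and> quat_j p = quat_j q \<and> quat_k p = quat_k q"
  by (cases p; cases q) simp

instantiation quat :: ring_1
begin

definition zero_quat :: quat where "0 = Quat 0 0 0 0"

definition one_quat :: quat where "1 = Quat 1 0 0 0"

definition plus_quat :: "quat \<Rightarrow> quat \<Rightarrow> quat" where
  "p + q = Quat (quat_re p + quat_re q) (quat_i p + quat_i q) (quat_j p + quat_j q) (quat_k p + quat_k q)"

definition uminus_quat :: "quat \<Rightarrow> quat" where
  "- p = Quat (- quat_re p) (- quat_i p) (- quat_j p) (- quat_k p)"

definition minus_quat :: "quat \<Rightarrow> quat \<Rightarrow> quat" where
  "p - q = Quat (quat_re p - quat_re q) (quat_i p - quat_i q) (quat_j p - quat_j q) (quat_k p - quat_k q)"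

definition times_quat :: "quat \<Rightarrow> quat \<Rightarrow> quat" where
  "p * q = Quat
     (quat_re p * quat_re q - quat_i p * quat_i q - quat_j p * quat_j q - quat_k p * quat_k q)
     (quat_re p * quat_i q + quat_i p * quat_re q + quat_j p * quat_k q - quat_k p * quat_j q)
     (quat_re p * quat_j q - quat_i p * quat_k q + quat_j p * quat_re q + quat_k p * quat_i q)
     (quat_re p * quat_k q + quat_i p * quat_j q - quat_j p * quat_i q + quat_k p * quat_re q)"

instance
  by standard
    (simp_all add: zero_quat_def one_quat_def plus_quat_def uminus_quat_def minus_quat_def
      times_quat_def quat_eq_iff algebra_simps)

end

lemma quat_zero_sel [simp]:
  "quat_re 0 = 0" "quat_i 0 = 0" "quat_j 0 = 0" "quat_k 0 = 0"
  by (simp_all add: zero_quat_def)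

lemma quat_one_sel [simp]:
  "quat_re 1 = 1" "quat_i 1 = 0" "quat_j 1 = 0" "quat_k 1 = 0"
  by (simp_all add: one_quat_def)

lemma quat_plus_sel [simp]:
  "quat_re (p + q) = quat_re p + quat_re q" "quat_i (p + q) = quat_i p + quat_i q"
  "quat_j (p + q) = quat_j p + quat_j q" "quat_k (p + q) = quat_k p + quat_k q"
  by (simp_all add: plus_quat_def)

lemma quat_uminus_sel [simp]:
  "quat_re (- p) = - quat_re p" "quat_i (- p) = - quat_i p"
  "quat_j (- p) = - quat_j p" "quat_k (- p) = - quat_k p"
  by (simp_all add: uminus_quat_def)

lemma quat_minus_sel [simp]:
  "quat_re (p - q) = quat_re p - quat_re q" "quat_i (p - q) = quat_i p - quat_i q"
  "quat_j (p - q) = quat_j p - quat_j q" "quat_k (p - q) = quat_k p - quat_k q"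
  by (simp_all add: minus_quat_def)

lemma quat_times_sel [simp]:
  "quat_re (p * q) =
     quat_re p * quat_re q - quat_i p * quat_i q - quat_j p * quat_j q - quat_k p * quat_k q"
  "quat_i (p * q) =
     quat_re p * quat_i q + quat_i p * quat_re q + quat_j p * quat_k q - quat_k p * quat_j q"
  "quat_j (p * q) =
     quat_re p * quat_j q - quat_i p * quat_k q + quat_j p * quat_re q + quat_k p * quat_i q"
  "quat_k (p * q) =
     quat_re p * quat_k q + quat_i p * quat_j q - quat_j p * quat_i q + quat_k p * quat_re q"
  by (simp_all add: times_quat_def)

lemma quat_units:
  "Quat 0 1 0 0 * Quat 0 1 0 0 = - 1"
  "Quat 0 0 1 0 * Quat 0 0 1 0 = - 1"
  "Quat 0 0 0 1 * Quat 0 0 0 1 = - 1"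
  "Quat 0 1 0 0 * Quat 0 0 1 0 * Quat 0 0 0 1 = - 1"
  by (simp_all add: quat_eq_iff)

instantiation quat :: real_algebra_1
begin

definition scaleR_quat :: "real \<Rightarrow> quat \<Rightarrow> quat" where
  "scaleR r p = Quat (r * quat_re p) (r * quat_i p) (r * quat_j p) (r * quat_k p)"

instance
  by standard (simp_all add: scaleR_quat_def quat_eq_iff algebra_simps)

end

lemma quat_scaleR_sel [simp]:
  "quat_re (r *\<^sub>R p) = r * quat_re p" "quat_i (r *\<^sub>R p) = r * quat_i p"
  "quat_j (r *\<^sub>R p) = r * quat_j p" "quat_k (r *\<^sub>R p) = r * quat_k p"
  by (simp_all add: scaleR_quat_def)

instantiation quat :: real_inner
begin

definition inner_quat :: "quat \<Rightarrow> quat \<Rightarrow> real" where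
  "inner p q = quat_re p * quat_re q + quat_i p * quat_i q + quat_j p * quat_j q + quat_k p * quat_k q"

definition norm_quat :: "quat \<Rightarrow> real" where
  "norm p = sqrt ((quat_re p)\<^sup>2 + (quat_i p)\<^sup>2 + (quat_j p)\<^sup>2 + (quat_k p)\<^sup>2)"

definition sgn_quat :: "quat \<Rightarrow> quat" where
  "sgn p = p /\<^sub>R norm (p::quat)"

definition dist_quat :: "quat \<Rightarrow> quat \<Rightarrow> real" where
  "dist p q = norm (p - q :: quat)"

definition uniformity_quat_def:
  "(uniformity :: (quat \<times> quat) filter) = (INF e\<in>{0 <..}. principal {(p, q). dist p q < e})"

definition open_quat_def:
  "open (U :: quat set) \<longleftrightarrow> (\<forall>p\<in>U. eventually (\<lambda>(p', q). p' = p \<longrightarrow> q \<in> U) uniformity)"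

instance
proof
  fix p q r :: quat and a :: real
  show "inner p q = inner q p"
    by (simp add: inner_quat_def algebra_simps)
  show "inner (p + q) r = inner p r + inner q r"
    by (simp add: inner_quat_def algebra_simps)
  show "inner (a *\<^sub>R p) q = a * inner p q"
    by (simp add: inner_quat_def algebra_simps)
  show "0 \<le> inner p p"
    by (simp add: inner_quat_def)
  show "inner p p = 0 \<longleftrightarrow> p = 0"
    by (simp add: inner_quat_def quat_eq_iff add_nonneg_eq_0_iff)
  show "norm p = sqrt (inner p p)"
    by (simp add: inner_quat_def norm_quat_def power2_eq_square)
qed (simp_all add: sgn_quat_def dist_quat_def uniformity_quat_def open_quat_def)

end

instantiation quat :: real_normed_div_algebra
begin

definition inverse_quat :: "quat \<Rightarrow> quat" where
  "inverse p = Quat (quat_re p) (- quat_i p) (- quat_j p) (- quat_k p) /\<^sub>R (norm p)\<^sup>2"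

definition divide_quat :: "quat \<Rightarrow> quat \<Rightarrow> quat" where
  "p div q = p * inverse (q::quat)"

instance
proof
  fix p q :: quat
  have n: "(norm x)\<^sup>2 = (quat_re x)\<^sup>2 + (quat_i x)\<^sup>2 + (quat_j x)\<^sup>2 + (quat_k x)\<^sup>2" for x :: quat
    by (simp add: norm_quat_def)
  show "norm (p * q) = norm p * norm q"
    unfolding norm_quat_def real_sqrt_mult [symmetric]
    by (simp add: power2_eq_square algebra_simps)
  assume "p \<noteq> 0"
  then have nz: "(norm p)\<^sup>2 \<noteq> 0" by simp
  let ?c = "Quat (quat_re p) (- quat_i p) (- quat_j p) (- quat_k p)"
  have "?c * p = (norm p)\<^sup>2 *\<^sub>R 1" "p * ?c = (norm p)\<^sup>2 *\<^sub>R 1"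
    unfolding n by (simp_all add: quat_eq_iff power2_eq_square)
  with nz show "inverse p * p = 1" "p * inverse p = 1"
    by (simp_all add: inverse_quat_def)
qed (simp_all add: divide_quat_def inverse_quat_def quat_eq_iff)

end

instantiation quat :: euclidean_space
begin

definition Basis_quat :: "quat set" where
  "Basis = {1, Quat 0 1 0 0, Quat 0 0 1 0, Quat 0 0 0 1}"

instance
proof
  show "(Basis :: quat set) \<noteq> {}" "finite (Basis :: quat set)"
    by (simp_all add: Basis_quat_def)
next
  fix p q :: quat
  assume "p \<in> Basis" "q \<in> Basis"
  then show "inner p q = (if p = q then 1 else 0)"
    unfolding Basis_quat_def by (elim insertE emptyE; simp add: inner_quat_def quat_eq_iff)
next
  fix p :: quat
  show "(\<forall>q\<in>Basis. inner p q = 0) \<longleftrightarrow> p = 0"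
    unfolding Basis_quat_def by (auto simp only: ball_simps inner_quat_def quat_eq_iff
      quat.sel quat_one_sel quat_zero_sel mult_1_right mult_zero_right add_0_right add_0_left)
qed

end

text \<open>The inclusion of \<open>\<complex> = {a + b \<i>}\<close> in the quaternions.\<close>

definition quat_of_complex :: "complex \<Rightarrow> quat" where
  "quat_of_complex z = Quat (Re z) (Im z) 0 0"


section \<open>Quaternion vectors and matrices\<close>

definition norm_sum :: "quat ^ 'n \<Rightarrow> real" where
  "norm_sum \<eta> = (\<Sum>k\<in>UNIV. norm (\<eta> $ k))"

text \<open>
  The instance of \<open>*\<close> on \<open>'a ^ 'n ^ 'n\<close> is componentwise, so the library's \<open>X ^ m\<close> is not the matrix
  power.
\<close>

primrec matrix_power :: "'a::semiring_1 ^ 'n ^ 'n \<Rightarrow> nat \<Rightarrow> 'a ^ 'n ^ 'n" where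
  "matrix_power X 0 = mat 1"
| "matrix_power X (Suc m) = X ** matrix_power X m"

definition matrix_exp :: "quat ^ 'n ^ 'n \<Rightarrow> quat ^ 'n ^ 'n" where
  "matrix_exp X = (\<Sum>m. matrix_power X m /\<^sub>R fact m)"


section \<open>Right eigenvalues and the Jordan form\<close>

definition right_eigenvalue :: "quat ^ 'n ^ 'n \<Rightarrow> quat \<Rightarrow> bool" where
  "right_eigenvalue X l \<longleftrightarrow> (\<exists>\<eta>. \<eta> \<noteq> 0 \<and> X *v \<eta> = (\<chi> i. \<eta> $ i * l))"

definition standard_eigenvalues :: "quat ^ 'n ^ 'n \<Rightarrow> complex set" where
  "standard_eigenvalues X = {z. Im z \<ge> 0 \<and> right_eigenvalue X (quat_of_complex z)}"

text \<open>
  A finite index type carries no order, so being block diagonal with Jordan blocks is understood with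
  respect to some enumeration \<open>e\<close> of the indices.
\<close>

definition is_jordan_matrix :: "'a::{zero,one} ^ 'n ^ 'n \<Rightarrow> bool" where
  "is_jordan_matrix J \<longleftrightarrow>
     (\<exists>(e :: nat \<Rightarrow> 'n) blocks.
        bij_betw e {..<CARD('n)} UNIV \<and>
        0 \<notin> fst ` set blocks \<and> sum_list (map fst blocks) = CARD('n) \<and>
        (\<forall>i<CARD('n). \<forall>j<CARD('n). J $ e i $ e j = jordan_matrix blocks $$ (i, j)))"

definition is_jordan_form :: "quat ^ 'n ^ 'n \<Rightarrow> complex ^ 'n ^ 'n \<Rightarrow> bool" where
  "is_jordan_form X J \<longleftrightarrow>
     is_jordan_matrix J \<and> (\<forall>i. Im (J $ i $ i) \<ge> 0) \<and>
     (\<exists>S. invertible S \<and> matrix_inv S ** X ** S = (\<chi> i j. quat_of_complex (J $ i $ j)))"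

text \<open>
  The Jordan form exists and is unique up to the order of the blocks, so the choice below does not
  affect the multiplicities.
\<close>

definition jordan_form :: "quat ^ 'n ^ 'n \<Rightarrow> complex ^ 'n ^ 'n" where
  "jordan_form X = (SOME J. is_jordan_form X J)"

definition algebraic_multiplicity :: "quat ^ 'n ^ 'n \<Rightarrow> complex \<Rightarrow> nat" where
  "algebraic_multiplicity X l = card {i. jordan_form X $ i $ i = l}"

definition geometric_multiplicity :: "quat ^ 'n ^ 'n \<Rightarrow> complex \<Rightarrow> nat" where
  "geometric_multiplicity X l = vec.dim {x :: complex ^ 'n. (jordan_form X - mat l) *v x = 0}"


section \<open>Floquet theory\<close>

definition fundamental_matrix :: "(real \<Rightarrow> quat ^ 'n ^ 'n) \<Rightarrow> (real \<Rightarrow> quat ^ 'n ^ 'n) \<Rightarrow> bool" where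
  "fundamental_matrix A M \<longleftrightarrow>
     (\<forall>t. invertible (M t) \<and> (M has_vector_derivative A t ** M t) (at t))"

definition floquet_normal_form ::
  "real \<Rightarrow> (real \<Rightarrow> quat ^ 'n ^ 'n) \<Rightarrow> (real \<Rightarrow> quat ^ 'n ^ 'n) \<Rightarrow> quat ^ 'n ^ 'n \<Rightarrow> bool" where
  "floquet_normal_form T M P B \<longleftrightarrow>
     (\<forall>t. P (t + T) = P t) \<and>
     matrix_exp (T *\<^sub>R B) = matrix_inv (M 0) ** M T \<and>
     (\<forall>t. M t = P t ** matrix_exp (t *\<^sub>R B))"

definition monodromy_matrix :: "(real \<Rightarrow> quat ^ 'n ^ 'n) \<Rightarrow> real \<Rightarrow> quat ^ 'n ^ 'n \<Rightarrow> bool" where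
  "monodromy_matrix A T C \<longleftrightarrow> (\<exists>M. fundamental_matrix A M \<and> C = matrix_inv (M 0) ** M T)"

definition characteristic_multipliers :: "(real \<Rightarrow> quat ^ 'n ^ 'n) \<Rightarrow> real \<Rightarrow> complex set" where
  "characteristic_multipliers A T = {\<mu>. \<exists>C. monodromy_matrix A T C \<and> \<mu> \<in> standard_eigenvalues C}"

text \<open>
  All monodromy matrices of a system are similar, so their standard eigenvalues and multiplicities
  agree; the multiplicities of a characteristic multiplier are these common values.
\<close>

definition multiplier_algebraic_multiplicity ::
  "(real \<Rightarrow> quat ^ 'n ^ 'n) \<Rightarrow> real \<Rightarrow> complex \<Rightarrow> nat" where
  "multiplier_algebraic_multiplicity A T \<mu> =
     (THE m. \<forall>C. monodromy_matrix A T C \<longrightarrow> algebraic_multiplicity C \<mu> = m)"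

definition multiplier_geometric_multiplicity ::
  "(real \<Rightarrow> quat ^ 'n ^ 'n) \<Rightarrow> real \<Rightarrow> complex \<Rightarrow> nat" where
  "multiplier_geometric_multiplicity A T \<mu> =
     (THE m. \<forall>C. monodromy_matrix A T C \<longrightarrow> geometric_multiplicity C \<mu> = m)"


section \<open>Stability\<close>

definition is_solution :: "(real \<Rightarrow> quat ^ 'n ^ 'n) \<Rightarrow> (real \<Rightarrow> quat ^ 'n) \<Rightarrow> bool" where
  "is_solution A \<phi> \<longleftrightarrow> (\<forall>t. (\<phi> has_vector_derivative A t *v \<phi> t) (at t))"

text \<open>
  A solution is determined by its value at \<open>t0\<close>, so quantifying over the solutions \<open>\<psi>\<close> amounts to
  quantifying over their initial values \<open>\<psi> t0\<close>.
\<close>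

definition stable_solution ::
  "(real \<Rightarrow> quat ^ 'n ^ 'n) \<Rightarrow> real \<Rightarrow> (real \<Rightarrow> quat ^ 'n) \<Rightarrow> bool" where
  "stable_solution A t0 \<phi> \<longleftrightarrow>
     (\<forall>\<epsilon>>0. \<exists>\<delta>>0. \<forall>\<psi>. is_solution A \<psi> \<and> norm_sum (\<psi> t0 - \<phi> t0) < \<delta> \<longrightarrow>
        (\<forall>t\<ge>t0. norm_sum (\<psi> t - \<phi> t) < \<epsilon>))"

definition asymptotically_stable_solution ::
  "(real \<Rightarrow> quat ^ 'n ^ 'n) \<Rightarrow> real \<Rightarrow> (real \<Rightarrow> quat ^ 'n) \<Rightarrow> bool" where
  "asymptotically_stable_solution A t0 \<phi> \<longleftrightarrow>
     (\<exists>\<delta>>0. \<forall>\<psi>. is_solution A \<psi> \<and> norm_sum (\<psi> t0 - \<phi> t0) < \<delta> \<longrightarrow>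
        ((\<lambda>t. norm_sum (\<psi> t - \<phi> t)) \<longlongrightarrow> 0) at_top)"

definition stable_system :: "(real \<Rightarrow> quat ^ 'n ^ 'n) \<Rightarrow> real \<Rightarrow> bool" where
  "stable_system A t0 \<longleftrightarrow> stable_solution A t0 (\<lambda>_. 0)"

definition asymptotically_stable_system :: "(real \<Rightarrow> quat ^ 'n ^ 'n) \<Rightarrow> real \<Rightarrow> bool" where
  "asymptotically_stable_system A t0 \<longleftrightarrow> asymptotically_stable_solution A t0 (\<lambda>_. 0)"

end

theory Submission
  imports Defs
begin

text \<open>
  Write \<open>C = M(0)\<^sup>-\<^sup>1 M(T) = e\<^sup>T\<^sup>B\<close>. Every solution has the form \<open>M(t) c\<close>, and it can be observed in
  two ways: at the multiples of the period it is an orbit of the monodromy matrix,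
  \<open>M(k T) c = M(0) C\<^sup>k c\<close>, and at all times it is \<open>P(t) e\<^sup>t\<^sup>B c\<close> with a bounded factor \<open>P\<close>. The
  theorem therefore follows from one cycle of implications: if the system is stable, then the orbits
  \<open>C\<^sup>k c\<close> are bounded; then the multipliers satisfy the condition on \<open>C\<close>; then the eigenvalues of \<open>B\<close>
  satisfy theirs; then \<open>e\<^sup>t\<^sup>B c\<close> stays bounded; then the system is stable. Asymptotic stability runs
  through the same cycle with "tends to zero" in place of "is bounded". Going from \<open>C\<close> to \<open>B\<close> is the
  easy direction, because an eigenvector of \<open>B\<close> for \<open>\<lambda>\<close> is an eigenvector of \<open>C\<close> for \<open>e\<^sup>T\<^sup>\<lambda>\<close>, and a chain
  of two generalized eigenvectors stays such a chain; this is why the cycle runs in this sense.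

  Quaternion scalars act on vectors from the right, so the role of \<open>X - \<lambda> I\<close> is played by the map
  \<open>v \<mapsto> X v - v \<lambda>\<close> (\<open>shifted X \<lambda>\<close> below), which is complex linear but in general not quaternion linear.
  Three facts about these maps carry the proof.

  \<^item> The vectors that are annihilated by a power of one of them span the whole space
    (\<open>root_span_UNIV\<close>). On such a vector \<open>e\<^sup>t\<^sup>X\<close> is a finite sum of terms \<open>w t\<^sup>k e\<^sup>t\<^sup>\<lambda>\<close>, which settles when
    \<open>e\<^sup>t\<^sup>B\<close> is bounded or tends to zero.

  \<^item> Algebraic and geometric multiplicity of \<open>\<lambda>\<close> agree if and only if no vector is annihilated by the
    square of \<open>shifted X \<lambda>\<close> but not by the map itself
    (\<open>algebraic_eq_geometric_iff_semisimple\<close>). In this form the multiplicity condition can be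
    transported from \<open>C\<close> to \<open>B\<close>, and its failure visibly produces an orbit of linear growth.

  \<^item> The multiplicities are defined by a Jordan form, so the second fact presupposes that one exists
    (\<open>jordan_form_exists\<close>). For real \<open>\<lambda>\<close> the map \<open>shifted X \<lambda>\<close> is quaternion linear, and one takes a
    quaternion basis of Jordan chains of its generalized eigenspace. For non-real \<open>\<lambda>\<close> the generalized
    eigenspaces of \<open>\<lambda>\<close> and of its conjugate are exchanged by right multiplication by \<open>\<j>\<close>, and a complex
    basis of Jordan chains for \<open>\<lambda>\<close> is a quaternion basis of their sum. Both cases are instances of one
    theorem on nilpotent maps over a division ring between the reals and the quaternions
    (\<open>nilpotent_chains\<close>).

  Similar matrices have the same set of Jordan forms, hence the same chosen one; this is why all
  monodromy matrices have the same multiplicities.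
\<close>

section \<open>Quaternion vectors as a right vector space\<close>

definition rscale :: "quat ^ 'n \<Rightarrow> quat \<Rightarrow> quat ^ 'n" (infixl \<open>\<triangleleft>\<close> 70) where
  "v \<triangleleft> q = (\<chi> i. v $ i * q)"

lemma rscale_nth [simp]: "(v \<triangleleft> q) $ i = v $ i * q"
  by (simp add: rscale_def)

lemma rscale_simps [simp]:
  "v \<triangleleft> 0 = 0" "0 \<triangleleft> q = 0" "v \<triangleleft> 1 = v" "v \<triangleleft> (- q) = - (v \<triangleleft> q)" "(- v) \<triangleleft> q = - (v \<triangleleft> q)"
  by (simp_all add: vec_eq_iff)

lemma rscale_add_left: "(v + w) \<triangleleft> q = v \<triangleleft> q + w \<triangleleft> q"
  and rscale_add_right: "v \<triangleleft> (p + q) = v \<triangleleft> p + v \<triangleleft> q"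
  and rscale_diff_left: "(v - w) \<triangleleft> q = v \<triangleleft> q - w \<triangleleft> q"
  and rscale_diff_right: "v \<triangleleft> (p - q) = v \<triangleleft> p - v \<triangleleft> q"
  and rscale_rscale: "(v \<triangleleft> p) \<triangleleft> q = v \<triangleleft> (p * q)"
  by (simp_all add: vec_eq_iff algebra_simps)

lemma rscale_scaleR_left: "(r *\<^sub>R v) \<triangleleft> q = r *\<^sub>R (v \<triangleleft> q)"
  and rscale_scaleR_right: "v \<triangleleft> (r *\<^sub>R q) = r *\<^sub>R (v \<triangleleft> q)"
  by (simp_all add: vec_eq_iff)

lemma rscale_of_real: "v \<triangleleft> of_real r = r *\<^sub>R v"
  by (simp add: of_real_def rscale_scaleR_right)

lemma rscale_sum_left: "(\<Sum>x\<in>F. f x) \<triangleleft> q = (\<Sum>x\<in>F. f x \<triangleleft> q)"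
  by (induction F rule: infinite_finite_induct) (simp_all add: rscale_add_left)

lemma rscale_sum_right: "v \<triangleleft> (\<Sum>x\<in>F. f x) = (\<Sum>x\<in>F. v \<triangleleft> f x)"
  by (induction F rule: infinite_finite_induct) (simp_all add: rscale_add_right)

lemma rscale_cancel: "v \<triangleleft> q = 0 \<longleftrightarrow> v = 0 \<or> q = 0"
  by (auto simp: vec_eq_iff)

lemma norm_rscale: "norm (v \<triangleleft> q) = norm v * norm q"
  by (simp add: norm_vec_def norm_mult L2_set_left_distrib)

lemma matrix_vector_rscale: "X *v (v \<triangleleft> q) = (X *v v) \<triangleleft> q"
  for X :: "quat ^ 'n ^ 'm"
  by (simp add: vec_eq_iff matrix_vector_mult_def sum_distrib_right mult.assoc)

lemma matrix_vector_sum: "X *v (\<Sum>x\<in>F. f x) = (\<Sum>x\<in>F. X *v f x)"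
  for X :: "quat ^ 'n ^ 'm"
  by (induction F rule: infinite_finite_induct) (simp_all add: matrix_vector_right_distrib)

lemma matrix_vector_columns: "X *v y = (\<Sum>i\<in>UNIV. column i X \<triangleleft> (y $ i))"
  for X :: "quat ^ 'n ^ 'm"
  by (simp add: vec_eq_iff matrix_vector_mult_def column_def)

lemma column_matrix_mult: "column i (X ** Y) = X *v column i Y"
  for X :: "quat ^ 'n ^ 'm"
  by (simp add: vec_eq_iff column_def matrix_matrix_mult_def matrix_vector_mult_def)

lemma matrix_eq_columns: "X = Y \<longleftrightarrow> (\<forall>i. column i X = column i Y)"
  by (auto simp: vec_eq_iff column_def)

lemma column_eq_mult_axis: "column i X = X *v axis i 1" for X :: "quat ^ 'n ^ 'm"
  by (simp add: vec_eq_iff column_def matrix_vector_mult_def axis_def if_distrib cong: if_cong)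

lemma matrix_vector_scaleR: "X *v (r *\<^sub>R v) = r *\<^sub>R (X *v v)" for X :: "quat ^ 'n ^ 'm"
  by (simp add: vec_eq_iff matrix_vector_mult_def scaleR_sum_right)

lemma linear_matrix_vector: "linear (\<lambda>v. X *v v)" for X :: "quat ^ 'n ^ 'm"
  by (rule linearI) (simp_all add: matrix_vector_right_distrib matrix_vector_scaleR)

lemma scaleR_matrix_vector: "(r *\<^sub>R X) *v v = r *\<^sub>R (X *v v)" for X :: "quat ^ 'n ^ 'm"
  by (simp add: vec_eq_iff matrix_vector_mult_def scaleR_sum_right)

lemma bounded_bilinear_matrix_vector:
  "bounded_bilinear (\<lambda>(X :: quat ^ 'n ^ 'm) v. X *v v)"
  unfolding bilinear_conv_bounded_bilinear [symmetric] bilinear_def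
  by (auto intro!: linearI simp: matrix_vector_right_distrib matrix_vector_scaleR
      matrix_vector_mult_add_rdistrib scaleR_matrix_vector)

lemma bounded_bilinear_matrix_matrix:
  "bounded_bilinear (\<lambda>(X :: quat ^ 'n ^ 'm) (Y :: quat ^ 'k ^ 'n). X ** Y)"
  unfolding bilinear_conv_bounded_bilinear [symmetric] bilinear_def
  by (auto intro!: linearI simp: vec_eq_iff matrix_matrix_mult_def algebra_simps sum.distrib
      scaleR_sum_right)

lemma bounded_bilinear_rscale: "bounded_bilinear (\<lambda>(v :: quat ^ 'n) q. v \<triangleleft> q)"
  unfolding bilinear_conv_bounded_bilinear [symmetric] bilinear_def
  by (auto intro!: linearI simp: rscale_add_left rscale_add_right rscale_scaleR_left
      rscale_scaleR_right)

lemmas has_vector_derivative_matrix_vector =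
  bounded_bilinear.has_vector_derivative [OF bounded_bilinear_matrix_vector]
lemmas has_vector_derivative_rscale =
  bounded_bilinear.has_vector_derivative [OF bounded_bilinear_rscale]

lemma quat_of_complex_simps [simp]:
  "quat_of_complex 0 = 0" "quat_of_complex 1 = 1"
  "quat_of_complex (- z) = - quat_of_complex z"
  by (simp_all add: quat_eq_iff quat_of_complex_def)

lemma quat_of_complex_sel [simp]:
  "quat_re (quat_of_complex z) = Re z" "quat_i (quat_of_complex z) = Im z"
  "quat_j (quat_of_complex z) = 0" "quat_k (quat_of_complex z) = 0"
  by (simp_all add: quat_of_complex_def)

lemma quat_of_complex_add: "quat_of_complex (z + w) = quat_of_complex z + quat_of_complex w"
  and quat_of_complex_diff: "quat_of_complex (z - w) = quat_of_complex z - quat_of_complex w"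
  and quat_of_complex_mult: "quat_of_complex (z * w) = quat_of_complex z * quat_of_complex w"
  and quat_of_complex_scaleR: "quat_of_complex (r *\<^sub>R z) = r *\<^sub>R quat_of_complex z"
  and quat_of_complex_of_real: "quat_of_complex (of_real r) = of_real r"
  by (simp_all add: quat_eq_iff of_real_def)

lemma quat_of_complex_eq_0 [simp]: "quat_of_complex z = 0 \<longleftrightarrow> z = 0"
  by (auto simp: quat_eq_iff complex_eq_iff)

lemma norm_quat_of_complex [simp]: "norm (quat_of_complex z) = cmod z"
  by (simp add: norm_quat_def cmod_def)

lemma bounded_linear_quat_of_complex: "bounded_linear quat_of_complex"
  by (rule bounded_linear_intro [where K = 1])
    (simp_all add: quat_of_complex_add quat_of_complex_scaleR)

lemma invertible_matrix_inv:
  fixes X :: "'a::semiring_1 ^ 'n ^ 'm"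
  assumes "invertible X"
  shows "X ** matrix_inv X = mat 1" "matrix_inv X ** X = mat 1"
proof -
  have "X ** matrix_inv X = mat 1 \<and> matrix_inv X ** X = mat 1"
    using assms unfolding invertible_def matrix_inv_def by (rule someI_ex)
  then show "X ** matrix_inv X = mat 1" "matrix_inv X ** X = mat 1"
    by auto
qed

lemma norm_le_norm_sum: "norm v \<le> norm_sum v"
  by (simp add: norm_vec_def norm_sum_def L2_set_le_sum)

lemma norm_sum_le_norm: "norm_sum v \<le> real CARD('n) * norm v" for v :: "quat ^ 'n"
proof -
  have "norm_sum v \<le> (\<Sum>k\<in>(UNIV :: 'n set). norm v)"
    unfolding norm_sum_def by (intro sum_mono) (rule Finite_Cartesian_Product.norm_nth_le)
  then show ?thesis by simp
qed

section \<open>Linear differential equations and the matrix exponential\<close>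

text \<open>
  On a compact interval \<open>\<parallel>A(s) x\<parallel> \<le> K \<parallel>x\<parallel>\<close>, so the square of the norm of a solution grows, and decays,
  at most at the rate \<open>2 K\<close>; hence it stays zero in both directions once it is zero.
\<close>

lemma linear_ode_zero:
  fixes A :: "real \<Rightarrow> quat ^ 'n ^ 'n"
  assumes A: "continuous_on UNIV A" and \<phi>: "is_solution A \<phi>" and 0: "\<phi> t0 = 0"
  shows "\<phi> t = 0"
proof -
  define I where "I = {min t t0..max t t0}"
  have "compact (A ` I)"
    unfolding I_def by (intro compact_continuous_image continuous_on_subset [OF A]) auto
  then obtain a where a: "\<And>s. s \<in> I \<Longrightarrow> norm (A s) \<le> a"
    using compact_imp_bounded bounded_iff by (metis image_eqI)
  obtain K where K: "K > 0" "\<And>(X :: quat ^ 'n ^ 'n) v. norm (X *v v) \<le> norm X * norm v * K"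
    using bounded_bilinear.pos_bounded [OF bounded_bilinear_matrix_vector] by metis
  define L where "L = 2 * (a * K)"
  define f where "f s = inner (\<phi> s) (\<phi> s)" for s
  define g where "g s = 2 * inner (\<phi> s) (A s *v \<phi> s)" for s
  have df: "(f has_real_derivative g s) (at s)" for s
  proof -
    have "(\<phi> has_derivative (\<lambda>h. h *\<^sub>R (A s *v \<phi> s))) (at s)"
      using \<phi> by (simp add: is_solution_def has_vector_derivative_def)
    from has_derivative_inner [OF this this] show ?thesis
      unfolding f_def g_def has_field_derivative_def
      by (rule has_derivative_eq_rhs) (auto simp: fun_eq_iff inner_commute algebra_simps)
  qed
  have g: "\<bar>g s\<bar> \<le> L * f s" if "s \<in> I" for s
  proof -
    have "\<bar>g s\<bar> \<le> 2 * (norm (\<phi> s) * norm (A s *v \<phi> s))"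
      unfolding g_def using Cauchy_Schwarz_ineq2 [of "\<phi> s" "A s *v \<phi> s"] by simp
    also have "norm (A s *v \<phi> s) \<le> norm (A s) * norm (\<phi> s) * K"
      by (rule K)
    also have "\<dots> \<le> a * norm (\<phi> s) * K"
      using a [OF that] K(1) by (intro mult_right_mono) auto
    finally have "\<bar>g s\<bar> \<le> 2 * (norm (\<phi> s) * (a * norm (\<phi> s) * K))"
      by (simp add: mult_left_mono)
    then show ?thesis
      by (simp add: L_def f_def power2_norm_eq_inner [symmetric] power2_eq_square mult_ac)
  qed
  have "f t \<le> 0"
  proof (cases "t0 \<le> t")
    case True
    have "f t * exp (- L * t) \<le> f t0 * exp (- L * t0)"
    proof (rule DERIV_nonpos_imp_nonincreasing [OF True])
      fix s assume s: "t0 \<le> s" "s \<le> t"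
      have "((\<lambda>s. f s * exp (- L * s)) has_real_derivative (g s - L * f s) * exp (- L * s)) (at s)"
        by (auto intro!: derivative_eq_intros df simp: algebra_simps)
      moreover have "(g s - L * f s) * exp (- L * s) \<le> 0"
        using g [of s] s True by (intro mult_nonpos_nonneg) (auto simp: I_def)
      ultimately show "\<exists>y. ((\<lambda>s. f s * exp (- L * s)) has_real_derivative y) (at s) \<and> y \<le> 0"
        by blast
    qed
    then show ?thesis
      using 0 by (simp add: f_def mult_le_0_iff)
  next
    case False
    then have "t \<le> t0" by simp
    have "f t * exp (L * t) \<le> f t0 * exp (L * t0)"
    proof (rule DERIV_nonneg_imp_nondecreasing [OF \<open>t \<le> t0\<close>])
      fix s assume s: "t \<le> s" "s \<le> t0"
      have "((\<lambda>s. f s * exp (L * s)) has_real_derivative (g s + L * f s) * exp (L * s)) (at s)"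
        by (auto intro!: derivative_eq_intros df simp: algebra_simps)
      moreover have "(g s + L * f s) * exp (L * s) \<ge> 0"
        using g [of s] s False by (intro mult_nonneg_nonneg) (auto simp: I_def)
      ultimately show "\<exists>y. ((\<lambda>s. f s * exp (L * s)) has_real_derivative y) (at s) \<and> 0 \<le> y"
        by blast
    qed
    then show ?thesis
      using 0 by (simp add: f_def mult_le_0_iff)
  qed
  then have "inner (\<phi> t) (\<phi> t) = 0"
    by (intro antisym) (simp_all add: f_def)
  then show ?thesis
    by simp
qed

lemma linear_ode_unique:
  fixes A :: "real \<Rightarrow> quat ^ 'n ^ 'n"
  assumes "continuous_on UNIV A" "is_solution A \<phi>" "is_solution A \<psi>" "\<phi> t0 = \<psi> t0"
  shows "\<phi> t = \<psi> t"
proof -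
  have "is_solution A (\<lambda>s. \<phi> s - \<psi> s)"
    using assms(2,3) unfolding is_solution_def matrix_vector_mult_diff_distrib
    by (blast intro: has_vector_derivative_diff)
  from linear_ode_zero [OF assms(1) this, of t0 t] assms(4) show ?thesis
    by simp
qed

lemma is_solution_shift:
  assumes "is_solution A \<phi>"
  shows "is_solution (\<lambda>t. A (t + s)) (\<lambda>t. \<phi> (t + s))"
  unfolding is_solution_def
proof
  fix t
  have "(\<phi> has_vector_derivative A (t + s) *v \<phi> (t + s)) (at (t + s))"
    using assms by (simp add: is_solution_def)
  then show "((\<lambda>t. \<phi> (t + s)) has_vector_derivative A (t + s) *v \<phi> (t + s)) (at t)"
    using vector_diff_chain_at [of "\<lambda>t. t + s" 1 t \<phi> "A (t + s) *v \<phi> (t + s)"]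
    by (simp add: o_def has_vector_derivative_add_const)
qed

lemma summable_matrix_exp: "summable (\<lambda>m. matrix_power X m /\<^sub>R fact m)"
  for X :: "quat ^ 'n ^ 'n"
proof -
  obtain K where K: "K > 0"
    "\<And>(X :: quat ^ 'n ^ 'n) (Y :: quat ^ 'n ^ 'n). norm (X ** Y) \<le> norm X * norm Y * K"
    using bounded_bilinear.pos_bounded [OF bounded_bilinear_matrix_matrix] by metis
  let ?I = "mat 1 :: quat ^ 'n ^ 'n"
  have b: "norm (matrix_power X m) \<le> norm ?I * (norm X * K) ^ m" for m
  proof (induction m)
    case (Suc m)
    have "norm (matrix_power X (Suc m)) \<le> norm (matrix_power X m) * (norm X * K)"
      using K(2) [of X "matrix_power X m"] by (simp add: mult_ac)
    also have "\<dots> \<le> (norm ?I * (norm X * K) ^ m) * (norm X * K)"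
      using Suc K(1) by (intro mult_right_mono) auto
    finally show ?case by (simp add: mult_ac)
  qed simp
  show ?thesis
  proof (rule summable_comparison_test')
    show "summable (\<lambda>m. norm ?I * (inverse (fact m) * (norm X * K) ^ m))"
      by (intro summable_mult summable_exp)
    show "norm (matrix_power X m /\<^sub>R fact m) \<le> norm ?I * (inverse (fact m) * (norm X * K) ^ m)"
      for m
      using b [of m] by (simp add: divide_simps mult_ac)
  qed
qed

lemma matrix_power_scaleR: "matrix_power (r *\<^sub>R X) m = r ^ m *\<^sub>R matrix_power X m"
  for X :: "quat ^ 'n ^ 'n"
proof (induction m)
  case (Suc m)
  interpret bounded_bilinear "\<lambda>(X :: quat ^ 'n ^ 'n) (Y :: quat ^ 'n ^ 'n). X ** Y"
    by (rule bounded_bilinear_matrix_matrix)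
  show ?case by (simp add: Suc scaleR_left scaleR_right)
qed simp

lemma matrix_exp_0 [simp]: "matrix_exp (0 :: quat ^ 'n ^ 'n) = mat 1"
proof -
  have "matrix_power (0 :: quat ^ 'n ^ 'n) m /\<^sub>R fact m = (if m = 0 then mat 1 else 0)" for m
    by (cases m) (auto simp: matrix_matrix_mult_def vec_eq_iff)
  then show ?thesis
    unfolding matrix_exp_def by (simp add: sums_unique [OF sums_single [of 0 "\<lambda>_. mat 1"], symmetric])
qed

text \<open>
  Every real coordinate of \<open>e\<^sup>t\<^sup>X\<close> is an everywhere convergent real power series, which is
  differentiated term by term.
\<close>

lemma has_vector_derivative_matrix_exp:
  fixes X :: "quat ^ 'n ^ 'n"
  shows "((\<lambda>t. matrix_exp (t *\<^sub>R X)) has_vector_derivative X ** matrix_exp (t *\<^sub>R X)) (at t)"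
proof -
  have s: "(\<lambda>m. (t ^ m / fact m) *\<^sub>R matrix_power X m) sums matrix_exp (t *\<^sub>R X)" for t
    using summable_sums [OF summable_matrix_exp, of "t *\<^sub>R X"]
    by (simp add: matrix_exp_def matrix_power_scaleR field_simps)
  have b: "((\<lambda>t. inner (matrix_exp (t *\<^sub>R X)) b)
      has_real_derivative inner (X ** matrix_exp (t *\<^sub>R X)) b) (at t)" for b t
  proof -
    define c where "c m = inner (matrix_power X m) b / fact m" for m
    have c: "(\<lambda>m. c m * t ^ m) sums inner (matrix_exp (t *\<^sub>R X)) b" for t
      using bounded_linear.sums [OF bounded_linear_inner_left [of b] s [of t]] by (simp add: c_def mult_ac)
    have "((\<lambda>t. \<Sum>m. c m * t ^ m) has_real_derivative (\<Sum>m. diffs c m * t ^ m)) (at t)"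
      by (rule termdiffs_strong_converges_everywhere) (use c sums_summable in blast)
    moreover have "(\<lambda>t. \<Sum>m. c m * t ^ m) = (\<lambda>t. inner (matrix_exp (t *\<^sub>R X)) b)"
      using c by (auto simp: sums_iff)
    moreover have "(\<lambda>m. diffs c m * t ^ m) sums inner (X ** matrix_exp (t *\<^sub>R X)) b"
    proof -
      interpret bounded_bilinear "\<lambda>(X :: quat ^ 'n ^ 'n) (Y :: quat ^ 'n ^ 'n). X ** Y"
        by (rule bounded_bilinear_matrix_matrix)
      have "(\<lambda>m. inner (X ** ((t ^ m / fact m) *\<^sub>R matrix_power X m)) b)
          sums inner (X ** matrix_exp (t *\<^sub>R X)) b"
        by (intro bounded_linear.sums [OF bounded_linear_inner_left]
            bounded_linear.sums [OF bounded_linear_right] s)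
      moreover have "diffs c m * t ^ m
          = inner (X ** ((t ^ m / fact m) *\<^sub>R matrix_power X m)) b" for m
        unfolding c_def diffs_def scaleR_right by (simp add: field_simps del: of_nat_Suc)
      ultimately show ?thesis by simp
    qed
    ultimately show ?thesis by (simp add: sums_iff)
  qed
  show ?thesis
    unfolding has_vector_derivative_def
  proof (subst has_derivative_componentwise_within, intro ballI)
    fix i :: "quat ^ 'n ^ 'n" assume "i \<in> Basis"
    show "((\<lambda>t. inner (matrix_exp (t *\<^sub>R X)) i) has_derivative
        (\<lambda>h. inner (h *\<^sub>R (X ** matrix_exp (t *\<^sub>R X))) i)) (at t)"
      using b [of i t] unfolding has_field_derivative_def
      by (rule has_derivative_eq_rhs) (auto simp: fun_eq_iff)
  qed
qed

lemma is_solution_matrix_exp: "is_solution (\<lambda>_. X) (\<lambda>t. matrix_exp (t *\<^sub>R X) *v v)"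
  unfolding is_solution_def
  using has_vector_derivative_matrix_vector
    [OF has_vector_derivative_matrix_exp [of X] has_vector_derivative_const [of v]]
  by (simp add: matrix_vector_mul_assoc)

text \<open>
  The functional equation of the exponential and its values on generalized eigenvectors are both
  obtained by exhibiting a solution.
\<close>

lemma matrix_exp_unique:
  assumes "is_solution (\<lambda>_. X) \<phi>"
  shows "matrix_exp (t *\<^sub>R X) *v \<phi> 0 = \<phi> t"
  using linear_ode_unique [OF _ is_solution_matrix_exp [of X "\<phi> 0"] assms, of 0 t] by simp

lemma matrix_exp_add: "matrix_exp ((s + t) *\<^sub>R X) = matrix_exp (s *\<^sub>R X) ** matrix_exp (t *\<^sub>R X)"
  for X :: "quat ^ 'n ^ 'n"
proof -
  have "matrix_exp (s *\<^sub>R X) *v (matrix_exp ((0 + t) *\<^sub>R X) *v v)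
      = matrix_exp ((s + t) *\<^sub>R X) *v v" for v
    by (rule matrix_exp_unique) (rule is_solution_shift [OF is_solution_matrix_exp])
  then show ?thesis
    by (simp add: matrix_eq matrix_vector_mul_assoc)
qed

section \<open>Generalized eigenvectors\<close>

text \<open>
  The analogue of \<open>X - l I\<close> for scalars acting from the right. It commutes with right multiplication by
  complex numbers; with all quaternions it commutes only if \<open>l\<close> is real.
\<close>

definition shifted :: "quat ^ 'n ^ 'n \<Rightarrow> complex \<Rightarrow> quat ^ 'n \<Rightarrow> quat ^ 'n" where
  "shifted X l v = X *v v - v \<triangleleft> quat_of_complex l"

definition generalized_eigenspace :: "quat ^ 'n ^ 'n \<Rightarrow> complex \<Rightarrow> (quat ^ 'n) set" where
  "generalized_eigenspace X l = {v. \<exists>m. (shifted X l ^^ m) v = 0}"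

lemma shifted_eq_0: "shifted X l v = 0 \<longleftrightarrow> X *v v = v \<triangleleft> quat_of_complex l"
  by (simp add: shifted_def)

lemma right_eigenvalue_shifted:
  "right_eigenvalue X (quat_of_complex l) \<longleftrightarrow> (\<exists>v. v \<noteq> 0 \<and> shifted X l v = 0)"
  by (simp add: right_eigenvalue_def shifted_eq_0 rscale_def)

lemma linear_shifted: "linear (shifted X l)"
  by (rule linearI) (simp_all add: shifted_def matrix_vector_right_distrib matrix_vector_scaleR
      rscale_add_left rscale_scaleR_left algebra_simps)

lemma linear_shifted_pow: "linear (shifted X l ^^ m)"
proof (induction m)
  case (Suc m)
  then show ?case
    using linear_compose [OF _ linear_shifted, of "shifted X l ^^ m" X l] by (simp add: o_def)
qed (simp add: linear_ident)

lemma shifted_rscale: "shifted X l (v \<triangleleft> quat_of_complex z) = shifted X l v \<triangleleft> quat_of_complex z"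
  by (simp add: shifted_def matrix_vector_rscale rscale_diff_left rscale_rscale
      quat_of_complex_mult [symmetric] mult.commute)

lemma shifted_pow_rscale:
  "(shifted X l ^^ m) (v \<triangleleft> quat_of_complex z) = (shifted X l ^^ m) v \<triangleleft> quat_of_complex z"
  by (induction m) (simp_all add: shifted_rscale)

lemma shifted_change: "shifted X l v = shifted X k v + v \<triangleleft> quat_of_complex (k - l)"
  by (simp add: shifted_def quat_of_complex_diff rscale_diff_right)

lemma shifted_commute: "shifted X l (shifted X k v) = shifted X k (shifted X l v)"
proof -
  interpret linear "shifted X k" by (rule linear_shifted)
  show ?thesis
    by (simp add: shifted_change [of X l _ k] add shifted_rscale)
qed

lemma shifted_pow_commute: "(shifted X k ^^ m) (shifted X l v) = shifted X l ((shifted X k ^^ m) v)"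
  by (induction m) (simp_all add: shifted_commute)

lemma generalized_eigenspaceI: "(shifted X l ^^ m) v = 0 \<Longrightarrow> v \<in> generalized_eigenspace X l"
  by (auto simp: generalized_eigenspace_def)

lemma shifted_pow_0_mono:
  assumes "(shifted X l ^^ m) v = 0" "m \<le> p"
  shows "(shifted X l ^^ p) v = 0"
proof -
  have "(shifted X l ^^ p) v = (shifted X l ^^ (p - m)) ((shifted X l ^^ m) v)"
    using assms(2) by (metis comp_apply funpow_add le_add_diff_inverse2)
  then show ?thesis
    by (simp add: assms(1) linear_0 [OF linear_shifted_pow])
qed

lemma subspace_generalized_eigenspace: "subspace (generalized_eigenspace X l)"
proof (rule subspaceI)
  show "0 \<in> generalized_eigenspace X l"
    by (rule generalized_eigenspaceI [where m = 0]) simp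
next
  fix v w assume "v \<in> generalized_eigenspace X l" "w \<in> generalized_eigenspace X l"
  then obtain m p where "(shifted X l ^^ m) v = 0" "(shifted X l ^^ p) w = 0"
    by (auto simp: generalized_eigenspace_def)
  then have "(shifted X l ^^ max m p) v = 0" "(shifted X l ^^ max m p) w = 0"
    by (auto intro: shifted_pow_0_mono)
  then show "v + w \<in> generalized_eigenspace X l"
    by (intro generalized_eigenspaceI [where m = "max m p"])
      (simp add: linear_add [OF linear_shifted_pow])
next
  fix c v assume "v \<in> generalized_eigenspace X l"
  then show "c *\<^sub>R v \<in> generalized_eigenspace X l"
    by (auto simp: generalized_eigenspace_def linear_scale [OF linear_shifted_pow])
qed

lemma generalized_eigenspace_rscale:
  assumes "v \<in> generalized_eigenspace X l"
  shows "v \<triangleleft> quat_of_complex z \<in> generalized_eigenspace X l"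
proof -
  obtain m where "(shifted X l ^^ m) v = 0"
    using assms by (auto simp: generalized_eigenspace_def)
  then show ?thesis
    by (intro generalized_eigenspaceI [where m = m]) (simp add: shifted_pow_rscale)
qed

lemma generalized_eigenspace_shifted:
  assumes "v \<in> generalized_eigenspace X l"
  shows "shifted X k v \<in> generalized_eigenspace X l"
proof -
  obtain m where "(shifted X l ^^ m) v = 0"
    using assms by (auto simp: generalized_eigenspace_def)
  then show ?thesis
    by (intro generalized_eigenspaceI [where m = m])
      (simp add: shifted_pow_commute linear_0 [OF linear_shifted])
qed

lemma generalized_eigenvector_eigenvector:
  assumes "(shifted X l ^^ m) v = 0" "v \<noteq> 0"
  shows "\<exists>w. w \<noteq> 0 \<and> shifted X l w = 0"
  using assms
proof (induction m arbitrary: v)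
  case (Suc m)
  then show ?case
    by (cases "shifted X l v = 0") (auto simp: funpow_Suc_right simp del: funpow.simps)
qed simp

text \<open>
  On a vector \<open>v\<close> with \<open>X v = v k\<close> the map \<open>shifted X l\<close> is multiplication by the nonzero number
  \<open>k - l\<close>, so no power of it annihilates \<open>v\<close> unless \<open>v = 0\<close>.
\<close>

lemma generalized_eigenspaces_disjoint:
  assumes "v \<in> generalized_eigenspace X l" "shifted X k v = 0" "k \<noteq> l"
  shows "v = 0"
proof -
  obtain m where m: "(shifted X l ^^ m) v = 0"
    using assms(1) by (auto simp: generalized_eigenspace_def)
  have "(shifted X l ^^ m) v = v \<triangleleft> quat_of_complex ((k - l) ^ m)" for m
    by (induction m) (simp_all add: shifted_rscale shifted_change [of X l v k] assms(2)
        rscale_rscale quat_of_complex_mult)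
  with m show ?thesis
    using assms(3) by (simp add: rscale_cancel)
qed

lemma generalized_eigenspaces_disjoint_pow:
  assumes "v \<in> generalized_eigenspace X l" "(shifted X k ^^ p) v = 0" "k \<noteq> l"
  shows "v = 0"
  using assms(1,2)
proof (induction p arbitrary: v)
  case (Suc p)
  then have "shifted X k v = 0"
    using Suc.IH [of "shifted X k v"] generalized_eigenspace_shifted [of v X l k]
    by (simp add: funpow_Suc_right del: funpow.simps)
  with Suc.prems(1) assms(3) show ?case
    by (metis generalized_eigenspaces_disjoint)
qed simp

text \<open>
  A power of \<open>shifted X k\<close> that annihilates the \<open>k\<close>-th summand is injective on the other generalized
  eigenspaces, which removes one summand at a time.
\<close>

lemma generalized_eigenspaces_independent:
  assumes "finite F" "\<And>l. l \<in> F \<Longrightarrow> f l \<in> generalized_eigenspace X l" "(\<Sum>l\<in>F. f l) = 0" "l \<in> F"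
  shows "f l = 0"
  using assms
proof (induction F arbitrary: f l rule: finite_induct)
  case (insert k F)
  obtain p where p: "(shifted X k ^^ p) (f k) = 0"
    using insert.prems(1) [of k] by (auto simp: generalized_eigenspace_def)
  interpret linear "shifted X k ^^ p" by (rule linear_shifted_pow)
  have "0 = (shifted X k ^^ p) (\<Sum>l\<in>insert k F. f l)"
    by (simp only: insert.prems(2) zero)
  also have "\<dots> = (\<Sum>l\<in>F. (shifted X k ^^ p) (f l))"
    using insert.hyps by (simp add: sum add p)
  finally have s: "(\<Sum>l\<in>F. (shifted X k ^^ p) (f l)) = 0" ..
  have F: "f l = 0" if "l \<in> F" for l
  proof (rule generalized_eigenspaces_disjoint_pow)
    show "f l \<in> generalized_eigenspace X l"
      using insert.prems(1) that by simp
    show "k \<noteq> l"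
      using insert.hyps(2) that by auto
    have g: "(shifted X k ^^ p) v \<in> generalized_eigenspace X l"
      if "v \<in> generalized_eigenspace X l" for v l
      using that by (induction p) (auto intro: generalized_eigenspace_shifted)
    show "(shifted X k ^^ p) (f l) = 0"
      by (rule insert.IH [OF _ s that]) (use insert.prems(1) g in auto)
  qed
  then have "f k = 0"
    using insert.prems(2) insert.hyps by simp
  with F insert.prems(3) show ?case by auto
qed simp

text \<open>
  On the generalized eigenspace of \<open>k\<close> the map \<open>shifted X l\<close> is the invertible scalar \<open>k - l\<close> plus a
  nilpotent map, hence surjective.
\<close>

lemma shifted_solve:
  assumes "(shifted X k ^^ p) u = 0" "k \<noteq> l"
  shows "\<exists>w\<in>generalized_eigenspace X k. shifted X l w = u"
  using assms(1)
proof (induction p arbitrary: u)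
  case 0
  then show ?case
    by (auto intro!: bexI [of _ 0] simp: linear_0 [OF linear_shifted]
        subspace_0 [OF subspace_generalized_eigenspace])
next
  case (Suc p)
  then obtain w where w: "w \<in> generalized_eigenspace X k" "shifted X l w = shifted X k u"
    by (metis funpow_Suc_right comp_apply)
  let ?q = "quat_of_complex (inverse (k - l))"
  have "shifted X l ((u - w) \<triangleleft> ?q) = (shifted X l u - shifted X k u) \<triangleleft> ?q"
    by (simp add: shifted_rscale linear_diff [OF linear_shifted] w(2))
  also have "\<dots> = u"
    using assms(2)
    by (simp add: shifted_change [of X l u k] rscale_rscale quat_of_complex_mult [symmetric])
  finally have "shifted X l ((u - w) \<triangleleft> ?q) = u" .
  moreover have "(u - w) \<triangleleft> ?q \<in> generalized_eigenspace X k"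
    by (intro generalized_eigenspace_rscale subspace_diff subspace_generalized_eigenspace w(1)
        generalized_eigenspaceI [OF Suc.prems])
  ultimately show ?case by blast
qed

definition root_span :: "quat ^ 'n ^ 'n \<Rightarrow> (quat ^ 'n) set" where
  "root_span X = span (\<Union>l. generalized_eigenspace X l)"

lemma subspace_root_span: "subspace (root_span X)"
  by (simp add: root_span_def)

lemma generalized_eigenspace_root_span: "v \<in> generalized_eigenspace X l \<Longrightarrow> v \<in> root_span X"
  by (auto simp: root_span_def intro: span_base)

text \<open>
  All generalized eigenspaces except that of \<open>l\<close> lie in the image of \<open>shifted X l\<close>.
\<close>

lemma root_span_split:
  assumes "u \<in> root_span X"
  shows "\<exists>g\<in>root_span X. \<exists>h\<in>generalized_eigenspace X l. u = shifted X l g + h"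
  using assms unfolding root_span_def
proof (induction rule: span_induct)
  case (step u)
  then obtain k p where "u \<in> generalized_eigenspace X k" "(shifted X k ^^ p) u = 0"
    by (auto simp: generalized_eigenspace_def)
  show ?case
  proof (cases "k = l")
    case True
    then show ?thesis
      using \<open>u \<in> generalized_eigenspace X k\<close>
      by (intro bexI [of _ 0] bexI [of _ u]) (simp_all add: linear_0 [OF linear_shifted] span_0)
  next
    case False
    from shifted_solve [OF \<open>(shifted X k ^^ p) u = 0\<close> this] obtain w
      where "w \<in> generalized_eigenspace X k" "shifted X l w = u" by blast
    then show ?thesis
      by (intro bexI [of _ w] bexI [of _ 0])
        (auto intro: span_base subspace_0 [OF subspace_generalized_eigenspace])
  qed
next
  case base
  let ?G = "span (\<Union>l. generalized_eigenspace X l)"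
  let ?P = "\<lambda>u. \<exists>g\<in>?G. \<exists>h\<in>generalized_eigenspace X l. u = shifted X l g + h"
  show ?case
  proof (rule subspaceI)
    show "0 \<in> Collect ?P"
      by (auto intro!: bexI [of _ 0] simp: linear_0 [OF linear_shifted] subspace_0
          subspace_root_span [unfolded root_span_def] subspace_generalized_eigenspace)
  next
    fix x y
    assume "x \<in> Collect ?P" "y \<in> Collect ?P"
    then obtain g h g' h' where "g \<in> ?G" "h \<in> generalized_eigenspace X l" "x = shifted X l g + h"
      "g' \<in> ?G" "h' \<in> generalized_eigenspace X l" "y = shifted X l g' + h'"
      by blast
    then have "g + g' \<in> ?G" "h + h' \<in> generalized_eigenspace X l"
      "x + y = shifted X l (g + g') + (h + h')"
      by (simp_all add: linear_add [OF linear_shifted] span_add subspace_add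
          subspace_generalized_eigenspace)
    then show "x + y \<in> Collect ?P"
      by blast
  next
    fix c x
    assume "x \<in> Collect ?P"
    then obtain g h where "g \<in> ?G" "h \<in> generalized_eigenspace X l" "x = shifted X l g + h"
      by blast
    then have "c *\<^sub>R g \<in> ?G" "c *\<^sub>R h \<in> generalized_eigenspace X l"
      "c *\<^sub>R x = shifted X l (c *\<^sub>R g) + c *\<^sub>R h"
      by (simp_all add: linear_scale [OF linear_shifted] span_scale subspace_scale
          subspace_generalized_eigenspace scaleR_add_right)
    then show "c *\<^sub>R x \<in> Collect ?P"
      by blast
  qed
qed

text \<open>
  If \<open>shifted X l v = shifted X l g + h\<close> with \<open>h\<close> in the generalized eigenspace of \<open>l\<close>, then \<open>v - g\<close> lies
  there as well.
\<close>

lemma root_span_shifted_cancel: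
  assumes "shifted X l v \<in> root_span X"
  shows "v \<in> root_span X"
proof -
  obtain g h where gh: "g \<in> root_span X" "h \<in> generalized_eigenspace X l"
    "shifted X l v = shifted X l g + h"
    using root_span_split [OF assms] by blast
  then have h: "shifted X l (v - g) = h"
    by (simp add: linear_diff [OF linear_shifted])
  obtain m where "(shifted X l ^^ m) h = 0"
    using gh(2) by (auto simp: generalized_eigenspace_def)
  then have "(shifted X l ^^ Suc m) (v - g) = 0"
    by (simp add: funpow_Suc_right h del: funpow.simps)
  then have "v - g \<in> root_span X"
    by (intro generalized_eigenspace_root_span generalized_eigenspaceI)
  then show ?thesis
    using subspace_add [OF subspace_root_span gh(1)] by force
qed

text \<open>
  Horner's scheme for the action of a complex polynomial when \<open>X\<close> acts from the left and the
  coefficients from the right.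
\<close>

definition poly_act :: "quat ^ 'n ^ 'n \<Rightarrow> complex poly \<Rightarrow> quat ^ 'n \<Rightarrow> quat ^ 'n" where
  "poly_act X p v = fold_coeffs (\<lambda>a w. v \<triangleleft> quat_of_complex a + X *v w) p 0"

lemma poly_act_0 [simp]: "poly_act X 0 v = 0"
  by (simp add: poly_act_def)

lemma poly_act_pCons [simp]:
  "poly_act X (pCons a p) v = v \<triangleleft> quat_of_complex a + X *v poly_act X p v"
  by (cases "a = 0 \<and> p = 0") (auto simp: poly_act_def)

lemma poly_act_add: "poly_act X (p + q) v = poly_act X p v + poly_act X q v"
  by (induction p q rule: poly_induct2)
    (simp_all add: quat_of_complex_add rscale_add_right matrix_vector_right_distrib algebra_simps)

lemma poly_act_smult: "poly_act X (Polynomial.smult a p) v = poly_act X p v \<triangleleft> quat_of_complex a"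
  by (induction p) (simp_all add: rscale_add_left rscale_rscale matrix_vector_rscale
      quat_of_complex_mult [symmetric] mult.commute)

lemma poly_act_linear_factor: "poly_act X ([:- l, 1:] * p) v = shifted X l (poly_act X p v)"
proof -
  have "[:- l, 1:] * p = pCons 0 p + Polynomial.smult (- l) p"
    by simp
  then show ?thesis
    by (simp only: poly_act_add poly_act_smult) (simp add: shifted_def)
qed

lemma poly_act_monom:
  "poly_act X (monom (of_real a) i) v = a *\<^sub>R ((\<lambda>v. X *v v) ^^ i) v"
  by (induction i) (simp_all add: monom_0 monom_Suc quat_of_complex_of_real rscale_of_real
      matrix_vector_scaleR)

lemma poly_act_sum: "poly_act X (\<Sum>i\<in>F. f i) v = (\<Sum>i\<in>F. poly_act X (f i) v)"
  by (induction F rule: infinite_finite_induct) (simp_all add: poly_act_add)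

text \<open>
  The infinitely many iterates of \<open>X\<close> on \<open>v\<close> lie in a finite-dimensional real space, and a linear
  dependence between them is a polynomial.
\<close>

lemma poly_act_annihilates:
  fixes X :: "quat ^ 'n ^ 'n"
  shows "\<exists>p. p \<noteq> 0 \<and> poly_act X p v = 0"
proof -
  define f where "f i = ((\<lambda>v. X *v v) ^^ i) v" for i
  show ?thesis
  proof (cases "inj f")
    case False
    then obtain i k where "i \<noteq> k" "f i = f k"
      by (auto simp: inj_def)
    let ?p = "monom (of_real 1) i + monom (of_real (- 1)) k :: complex poly"
    have "coeff ?p i \<noteq> 0"
      using \<open>i \<noteq> k\<close> by simp
    then have "?p \<noteq> 0"
      by (metis coeff_0)
    moreover have "poly_act X ?p v = 0"
      using \<open>f i = f k\<close> unfolding poly_act_add poly_act_monom by (simp add: f_def)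
    ultimately show ?thesis by blast
  next
    case True
    then have "infinite (range f)"
      by (simp add: finite_image_iff)
    then have "dependent (range f)"
      using independent_bound by blast
    then obtain t u w where t: "finite t" "t \<subseteq> range f" "(\<Sum>w\<in>t. u w *\<^sub>R w) = 0"
      "w \<in> t" "u w \<noteq> 0"
      by (auto simp: dependent_explicit)
    define s where "s = f -` t"
    have ts: "t = f ` s"
      using t(2) by (auto simp: s_def)
    have s: "finite s"
      unfolding s_def by (rule finite_vimageI [OF t(1) True])
    let ?p = "\<Sum>i\<in>s. monom (of_real (u (f i))) i :: complex poly"
    have "poly_act X ?p v = (\<Sum>i\<in>s. u (f i) *\<^sub>R f i)"
      by (simp add: poly_act_sum poly_act_monom f_def)
    also have "\<dots> = (\<Sum>w\<in>t. u w *\<^sub>R w)"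
      unfolding ts by (rule sum.reindex_cong [OF inj_on_subset [OF True], symmetric]) auto
    finally have "poly_act X ?p v = 0"
      by (simp add: t(3))
    moreover obtain i where i: "i \<in> s" "w = f i"
      using t(4) ts by blast
    have "coeff ?p i = of_real (u w)"
      using s i by (simp add: coeff_sum sum.delta)
    then have "?p \<noteq> 0"
      using t(5) by (metis coeff_0 of_real_eq_0_iff)
    ultimately show ?thesis by blast
  qed
qed

text \<open>
  Over the complex numbers the polynomial splits, and its linear factors act as \<open>shifted X l\<close>, which
  can be cancelled one by one.
\<close>

lemma poly_act_root_span:
  assumes "p \<noteq> 0" "poly_act X p v \<in> root_span X"
  shows "v \<in> root_span X"
  using assms
proof (induction "degree p" arbitrary: p)
  case 0
  then obtain a where a: "p = [:a:]" "a \<noteq> 0"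
    by (metis degree_eq_zeroE pCons_0_0)
  have "g \<triangleleft> quat_of_complex z \<in> root_span X" if "g \<in> root_span X" for g z
    using that unfolding root_span_def
  proof (induction rule: span_induct)
    case (step g)
    then show ?case by (auto intro!: span_base generalized_eigenspace_rscale)
  next
    case base
    show ?case
      by (rule subspaceI) (auto simp: rscale_add_left rscale_scaleR_left span_add span_scale span_0)
  qed
  from this [OF "0.prems"(2), of "inverse a"] show ?case
    using a by (simp add: rscale_rscale quat_of_complex_mult [symmetric])
next
  case (Suc n)
  then obtain l where "poly p l = 0"
    using fundamental_theorem_of_algebra [of p]
    by (metis constant_degree nat.distinct(1))
  then obtain q where q: "p = [:- l, 1:] * q"
    by (auto simp: poly_eq_0_iff_dvd)
  with Suc.prems(1) have "q \<noteq> 0" by auto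
  with q Suc.hyps(2) have "degree q = n"
    by (simp add: degree_mult_eq del: mult_pCons_left)
  moreover have "poly_act X q v \<in> root_span X"
    using Suc.prems(2) unfolding q poly_act_linear_factor by (rule root_span_shifted_cancel)
  ultimately show ?case
    using Suc.hyps(1) \<open>q \<noteq> 0\<close> by blast
qed

theorem root_span_UNIV: "root_span X = UNIV"
proof -
  have "v \<in> root_span X" for v
    using poly_act_annihilates [of X v] poly_act_root_span
    by (metis subspace_0 subspace_root_span)
  then show ?thesis by blast
qed

text \<open>
  Eigenvectors to different complex numbers are linearly independent over the reals.
\<close>

lemma finite_eigenvalues: "finite {l. \<exists>v. v \<noteq> 0 \<and> shifted X l v = 0}" (is "finite ?E")
  for X :: "quat ^ 'n ^ 'n"
proof -
  define f where "f l = (SOME v. v \<noteq> 0 \<and> shifted X l v = 0)" for l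
  have "f l \<noteq> 0 \<and> shifted X l (f l) = 0" if "l \<in> ?E" for l
    unfolding f_def by (rule someI_ex) (use that in blast)
  then have f: "\<And>l. l \<in> ?E \<Longrightarrow> f l \<noteq> 0" "\<And>l. l \<in> ?E \<Longrightarrow> shifted X l (f l) = 0"
    by blast+
  have g: "c *\<^sub>R f l \<in> generalized_eigenspace X l" if "l \<in> ?E" for c l
    using f(2) [OF that]
    by (intro subspace_scale subspace_generalized_eigenspace generalized_eigenspaceI [where m = 1]) simp
  have inj: "inj_on f ?E"
  proof (rule inj_onI, rule ccontr)
    fix k l assume kl: "k \<in> ?E" "l \<in> ?E" "f k = f l" "k \<noteq> l"
    have "f l \<in> generalized_eigenspace X k"
      using g [OF kl(1), of 1] kl(3) by simp
    from generalized_eigenspaces_disjoint [OF this f(2) [OF kl(2)]] have "f l = 0"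
      using kl(4) by simp
    then show False
      using f(1) kl(2) by blast
  qed
  have "independent (f ` ?E)"
    unfolding dependent_explicit
  proof (clarify)
    fix t u w assume t: "finite t" "t \<subseteq> f ` ?E" "(\<Sum>w\<in>t. u w *\<^sub>R w) = 0" "w \<in> t" "u w \<noteq> 0"
    obtain s where s: "s \<subseteq> ?E" "t = f ` s"
      using t(2) by (rule subset_imageE)
    then have "inj_on f s"
      using inj inj_on_subset by blast
    then have "finite s"
      using t(1) s(2) by (simp add: finite_image_iff)
    obtain l where l: "l \<in> s" "w = f l"
      using t(4) s(2) by blast
    have "(\<Sum>l\<in>s. u (f l) *\<^sub>R f l) = 0"
      using t(3) \<open>inj_on f s\<close> unfolding s(2) by (simp add: sum.reindex)
    from generalized_eigenspaces_independent [OF \<open>finite s\<close> _ this l(1)]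
    have "u (f l) *\<^sub>R f l = 0"
      using g s(1) by blast
    then show False
      using l s(1) t(5) f(1) [of l] by auto
  qed
  then have "finite (f ` ?E)"
    using independent_bound by blast
  then show ?thesis
    using inj finite_imageD by blast
qed

lemma generalized_eigenvector_decomposition:
  fixes X :: "quat ^ 'n ^ 'n"
  shows "\<exists>f. (\<forall>l. f l \<in> generalized_eigenspace X l) \<and>
    v = (\<Sum>l \<in> {l. \<exists>v. v \<noteq> 0 \<and> shifted X l v = 0}. f l)"
    (is "\<exists>f. _ \<and> v = (\<Sum>l\<in>?E. f l)")
proof -
  have "v \<in> span (\<Union>l. generalized_eigenspace X l)"
    using root_span_UNIV by (auto simp: root_span_def)
  then show ?thesis
  proof (induction rule: span_induct)
    case (step v)
    then obtain l where l: "v \<in> generalized_eigenspace X l" by blast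
    let ?f = "\<lambda>k. if k = l then v else 0"
    have "l \<in> ?E \<or> v = 0"
      using l generalized_eigenvector_eigenvector by (auto simp: generalized_eigenspace_def)
    then have "v = (\<Sum>l\<in>?E. ?f l)"
      using finite_eigenvalues [of X] by (auto simp: sum.delta')
    then show ?case
      using l by (intro exI [of _ ?f]) (auto simp: subspace_0 subspace_generalized_eigenspace)
  next
    case base
    show ?case
    proof (rule subspaceI; clarify)
      show "\<exists>f. (\<forall>l. f l \<in> generalized_eigenspace X l) \<and> 0 = (\<Sum>l\<in>?E. f l)"
        by (intro exI [of _ "\<lambda>_. 0"]) (simp add: subspace_0 subspace_generalized_eigenspace)
    next
      fix f g
      assume "\<forall>l. f l \<in> generalized_eigenspace X l" "\<forall>l. g l \<in> generalized_eigenspace X l"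
      then show "\<exists>h. (\<forall>l. h l \<in> generalized_eigenspace X l) \<and>
          (\<Sum>l\<in>?E. f l) + (\<Sum>l\<in>?E. g l) = (\<Sum>l\<in>?E. h l)"
        by (intro exI [of _ "\<lambda>l. f l + g l"])
          (simp add: subspace_add subspace_generalized_eigenspace sum.distrib)
    next
      fix c f
      assume "\<forall>l. f l \<in> generalized_eigenspace X l"
      then show "\<exists>h. (\<forall>l. h l \<in> generalized_eigenspace X l) \<and>
          c *\<^sub>R (\<Sum>l\<in>?E. f l) = (\<Sum>l\<in>?E. h l)"
        by (intro exI [of _ "\<lambda>l. c *\<^sub>R f l"])
          (simp add: subspace_scale subspace_generalized_eigenspace scaleR_sum_right)
    qed
  qed
qed

text \<open>
  Since \<open>\<j> z = cnj z \<j>\<close> for complex \<open>z\<close>, right multiplication by \<open>\<j>\<close> exchanges the eigenvectors of \<open>l\<close>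
  and of \<open>cnj l\<close>.
\<close>

abbreviation quat_jj :: quat where "quat_jj \<equiv> Quat 0 0 1 0"

lemma shifted_cnj: "shifted X (cnj l) (v \<triangleleft> quat_jj) = shifted X l v \<triangleleft> quat_jj"
proof -
  have "quat_jj * quat_of_complex (cnj l) = quat_of_complex l * quat_jj"
    by (simp add: quat_eq_iff)
  then show ?thesis
    by (simp add: shifted_def matrix_vector_rscale rscale_diff_left rscale_rscale)
qed

lemma shifted_pow_cnj:
  "(shifted X (cnj l) ^^ m) (v \<triangleleft> quat_jj) = (shifted X l ^^ m) v \<triangleleft> quat_jj"
  by (induction m) (simp_all add: shifted_cnj)

lemma rscale_jj [simp]: "v \<triangleleft> quat_jj = 0 \<longleftrightarrow> v = 0"
  by (simp add: rscale_cancel quat_eq_iff)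

text \<open>
  The right-hand side solves \<open>x' = X x\<close> with initial value \<open>u\<close>: differentiating the \<open>k\<close>-th
  coefficient yields the \<open>(k - 1)\<close>-st plus \<open>l\<close> times the \<open>k\<close>-th, while \<open>X\<close> maps the \<open>k\<close>-th vector to the
  \<open>(k + 1)\<close>-st plus itself times \<open>l\<close>. The one term left over contains \<open>(shifted X l)\<^sup>m u = 0\<close>.
\<close>

lemma matrix_exp_generalized_eigenvector:
  assumes "(shifted X l ^^ m) u = 0"
  shows "matrix_exp (t *\<^sub>R X) *v u = (\<Sum>k<m. (shifted X l ^^ k) u \<triangleleft>
    quat_of_complex (of_real (t ^ k / fact k) * exp (of_real t * l)))"
proof -
  define c :: "nat \<Rightarrow> real \<Rightarrow> complex"
    where "c k t = of_real (t ^ k / fact k) * exp (of_real t * l)" for k t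
  define w where "w k = (shifted X l ^^ k) u" for k
  define \<phi> where "\<phi> t = (\<Sum>k<m. w k \<triangleleft> quat_of_complex (c k t))" for t
  have e: "((\<lambda>t. exp (of_real t * l)) has_vector_derivative l * exp (of_real t * l)) (at t)" for t
  proof -
    have "((\<lambda>t. of_real t * l) has_vector_derivative l) (at t)"
      using bounded_linear.has_vector_derivative
        [OF bounded_linear_compose [OF bounded_linear_mult_left bounded_linear_of_real]
          has_vector_derivative_id] by simp
    from field_vector_diff_chain_at [OF this DERIV_exp] show ?thesis
      by (simp add: o_def)
  qed
  have dc0: "((c 0) has_vector_derivative l * c 0 t) (at t)" for t
    unfolding c_def by (simp add: e)
  have dc: "((c (Suc k)) has_vector_derivative (c k t + l * c (Suc k) t)) (at t)" for k t
  proof -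
    have "((\<lambda>t. t ^ Suc k / fact (Suc k)) has_real_derivative t ^ k / fact k) (at t)"
      by (auto intro!: derivative_eq_intros simp: field_simps simp del: of_nat_Suc power_Suc)
    then have "((\<lambda>t. complex_of_real (t ^ Suc k / fact (Suc k))) has_vector_derivative
        of_real (t ^ k / fact k)) (at t)"
      by (intro has_vector_derivative_of_real)
        (simp add: has_real_derivative_iff_has_vector_derivative)
    from has_vector_derivative_mult [OF this e] show ?thesis
      unfolding c_def by (simp add: algebra_simps)
  qed
  have wS: "X *v w k = w (Suc k) + w k \<triangleleft> quat_of_complex l" for k
    by (simp add: w_def shifted_def)
  \<comment> \<open>for every length \<open>p\<close> of the partial sum there is one uncancelled term, which vanishes for \<open>p = m\<close>\<close>
  have "((\<lambda>t. \<Sum>k<p. w k \<triangleleft> quat_of_complex (c k t)) has_vector_derivative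
      X *v (\<Sum>k<p. w k \<triangleleft> quat_of_complex (c k t))
        - (if p = 0 then 0 else w p \<triangleleft> quat_of_complex (c (p - 1) t))) (at t)" for p t
  proof (induction p)
    case 0
    show ?case by (simp add: has_vector_derivative_const)
  next
    case (Suc p)
    let ?c' = "if p = 0 then l * c p t else c (p - 1) t + l * c p t"
    have "(c p has_vector_derivative ?c') (at t)"
      using dc0 [of t] dc [of "p - 1" t] by auto
    from bounded_linear.has_vector_derivative [OF bounded_linear_quat_of_complex this]
    have "((\<lambda>t. w p \<triangleleft> quat_of_complex (c p t)) has_vector_derivative
        w p \<triangleleft> quat_of_complex ?c') (at t)"
      using has_vector_derivative_rscale [OF has_vector_derivative_const [of "w p"]] by fastforce
    note D = has_vector_derivative_add [OF Suc.IH this]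
    have "X *v (\<Sum>k<p. w k \<triangleleft> quat_of_complex (c k t))
          - (if p = 0 then 0 else w p \<triangleleft> quat_of_complex (c (p - 1) t))
          + w p \<triangleleft> quat_of_complex ?c'
        = X *v (\<Sum>k<Suc p. w k \<triangleleft> quat_of_complex (c k t))
          - w (Suc p) \<triangleleft> quat_of_complex (c p t)"
      by (simp add: matrix_vector_right_distrib matrix_vector_rscale wS rscale_add_left
          rscale_add_right rscale_rscale quat_of_complex_mult quat_of_complex_add)
    with D show ?case by simp
  qed
  note d = this [of m]
  have "w m = 0"
    using assms by (simp add: w_def)
  then have "is_solution (\<lambda>_. X) \<phi>"
    unfolding is_solution_def \<phi>_def using d by (cases "m = 0") simp_all
  moreover have "\<phi> 0 = u"
  proof (cases m)
    case 0
    then show ?thesis using assms by (simp add: \<phi>_def)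
  next
    case (Suc p)
    have "c k 0 = (if k = 0 then 1 else 0)" for k
      by (simp add: c_def)
    then show ?thesis
      unfolding \<phi>_def Suc by (simp add: sum.lessThan_Suc_shift w_def del: sum.lessThan_Suc)
  qed
  ultimately show ?thesis
    using matrix_exp_unique [of X \<phi> t] by (simp add: \<phi>_def w_def c_def)
qed

section \<open>Jordan chains of nilpotent maps over a division ring\<close>

text \<open>
  The scalars are the quaternions or the complex numbers, depending on whether the eigenvalue is
  real. Having both as subsets of the quaternions allows the linear algebra to be done only once.
\<close>

locale scalar_division_ring =
  fixes D :: "quat set"
  assumes real_in: "of_real r \<in> D"
    and add_in: "a \<in> D \<Longrightarrow> b \<in> D \<Longrightarrow> a + b \<in> D"
    and mult_in: "a \<in> D \<Longrightarrow> b \<in> D \<Longrightarrow> a * b \<in> D"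
    and inverse_in: "a \<in> D \<Longrightarrow> inverse a \<in> D"
begin

lemma zero_in: "0 \<in> D" and one_in: "1 \<in> D"
  using real_in [of 0] real_in [of 1] by simp_all

lemma uminus_in: "a \<in> D \<Longrightarrow> - a \<in> D"
  using mult_in [OF real_in [of "- 1"]] by simp

definition indep :: "(quat ^ 'n) set \<Rightarrow> bool" where
  "indep B \<longleftrightarrow> finite B \<and>
    (\<forall>c. (\<forall>b\<in>B. c b \<in> D) \<and> (\<Sum>b\<in>B. b \<triangleleft> c b) = 0 \<longrightarrow> (\<forall>b\<in>B. c b = 0))"

lemma indepD:
  "indep B \<Longrightarrow> \<forall>b\<in>B. c b \<in> D \<Longrightarrow> (\<Sum>b\<in>B. b \<triangleleft> c b) = 0 \<Longrightarrow> b \<in> B \<Longrightarrow> c b = 0"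
  by (auto simp: indep_def)

definition lin_span :: "(quat ^ 'n) set \<Rightarrow> (quat ^ 'n) set" where
  "lin_span B = {v. \<exists>c. (\<forall>b. c b \<in> D) \<and> v = (\<Sum>b\<in>B. b \<triangleleft> c b)}"

definition lin_subspace :: "(quat ^ 'n) set \<Rightarrow> bool" where
  "lin_subspace W \<longleftrightarrow> 0 \<in> W \<and> (\<forall>v\<in>W. \<forall>w\<in>W. v + w \<in> W) \<and> (\<forall>v\<in>W. \<forall>d\<in>D. v \<triangleleft> d \<in> W)"

lemma lin_subspaceD:
  assumes "lin_subspace W"
  shows "0 \<in> W" "v \<in> W \<Longrightarrow> w \<in> W \<Longrightarrow> v + w \<in> W" "v \<in> W \<Longrightarrow> d \<in> D \<Longrightarrow> v \<triangleleft> d \<in> W"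
  using assms by (auto simp: lin_subspace_def)

lemma lin_subspace_sum:
  assumes "lin_subspace W" "\<And>b. b \<in> F \<Longrightarrow> f b \<in> W"
  shows "sum f F \<in> W"
  using assms(2)
  by (induction F rule: infinite_finite_induct) (auto intro: lin_subspaceD [OF assms(1)])

lemma lin_subspace_diff:
  assumes "lin_subspace W" "v \<in> W" "w \<in> W"
  shows "v - w \<in> W"
proof -
  have "w \<triangleleft> (- 1) \<in> W"
    using assms by (intro lin_subspaceD(3) uminus_in one_in)
  then show ?thesis
    using lin_subspaceD(2) [OF assms(1,2)] by fastforce
qed

lemma lin_spanI: "\<forall>b. c b \<in> D \<Longrightarrow> v = (\<Sum>b\<in>B. b \<triangleleft> c b) \<Longrightarrow> v \<in> lin_span B"
  by (auto simp: lin_span_def)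

lemma lin_span_base:
  assumes "finite B" "x \<in> B"
  shows "x \<in> lin_span B"
proof (rule lin_spanI)
  show "\<forall>b. (if b = x then 1 else 0) \<in> D"
    using zero_in one_in by simp
  have "b \<triangleleft> (if b = x then 1 else 0) = (if b = x then x else 0)" for b
    by simp
  then show "x = (\<Sum>b\<in>B. b \<triangleleft> (if b = x then 1 else 0))"
    using assms by (simp only:) simp
qed

lemma indep_insert:
  assumes B: "indep B" and x: "x \<notin> lin_span B"
  shows "indep (insert x B)"
proof -
  have fin: "finite B"
    using B by (simp add: indep_def)
  have "x \<notin> B"
    using lin_span_base [OF fin] x by blast
  have "c b = 0"
    if c: "\<forall>b\<in>insert x B. c b \<in> D" "(\<Sum>b\<in>insert x B. b \<triangleleft> c b) = 0" "b \<in> insert x B" for c b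
  proof -
    have s: "x \<triangleleft> c x + (\<Sum>b\<in>B. b \<triangleleft> c b) = 0"
      using c(2) fin \<open>x \<notin> B\<close> by simp
    have "c x = 0"
    proof (rule ccontr)
      assume nz: "c x \<noteq> 0"
      have "x = (x \<triangleleft> c x) \<triangleleft> inverse (c x)"
        using nz by (simp add: rscale_rscale)
      also have "x \<triangleleft> c x = - (\<Sum>b\<in>B. b \<triangleleft> c b)"
        using s by (simp add: eq_neg_iff_add_eq_0)
      also have "\<dots> \<triangleleft> inverse (c x) = (\<Sum>b\<in>B. b \<triangleleft> (if b \<in> B then - (c b * inverse (c x)) else 0))"
        by (simp add: rscale_sum_left rscale_rscale sum_negf)
      finally have "x = (\<Sum>b\<in>B. b \<triangleleft> (if b \<in> B then - (c b * inverse (c x)) else 0))" .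
      moreover have "\<forall>b. (if b \<in> B then - (c b * inverse (c x)) else 0) \<in> D"
        using c(1) by (auto intro!: uminus_in mult_in inverse_in zero_in)
      ultimately have "x \<in> lin_span B"
        by (rule lin_spanI [rotated])
      with x show False by blast
    qed
    moreover have "\<forall>b\<in>B. c b = 0"
      using B c(1) s \<open>c x = 0\<close> by (auto simp: indep_def)
    ultimately show ?thesis
      using c(3) by auto
  qed
  then show ?thesis
    unfolding indep_def using fin by blast
qed

lemma indep_card_le:
  fixes B :: "(quat ^ 'n) set"
  assumes "indep B"
  shows "card B \<le> DIM(quat ^ 'n)"
proof -
  have "independent B"
  proof
    assume "dependent B"
    then obtain u w where u: "w \<in> B" "u w \<noteq> 0" "(\<Sum>b\<in>B. u b *\<^sub>R b) = 0"
      using assms by (auto simp: dependent_finite indep_def)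
    then have "(\<Sum>b\<in>B. b \<triangleleft> of_real (u b)) = 0"
      by (simp add: rscale_of_real)
    then have "of_real (u w) = (0 :: quat)"
      using assms u(1) real_in unfolding indep_def by metis
    with u(2) show False by simp
  qed
  then show ?thesis
    using independent_bound by blast
qed

text \<open>
  Independence over \<open>D\<close> implies independence over the reals, which bounds the size of an independent
  set; a largest one between \<open>B0\<close> and \<open>W\<close> generates \<open>W\<close>.
\<close>

lemma indep_extend:
  fixes W :: "(quat ^ 'n) set"
  assumes "indep B0" "B0 \<subseteq> W"
  shows "\<exists>B. B0 \<subseteq> B \<and> B \<subseteq> W \<and> indep B \<and> W \<subseteq> lin_span B"
proof -
  let ?P = "\<lambda>B. B0 \<subseteq> B \<and> B \<subseteq> W \<and> indep B"
  have "\<exists>B. ?P B \<and> (\<forall>C. ?P C \<longrightarrow> card C \<le> card B)"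
    by (rule ex_has_greatest_nat [of ?P B0 card "Suc DIM(quat ^ 'n)"])
      (use assms indep_card_le in \<open>auto simp only: less_Suc_eq_le\<close>)
  then obtain B where B: "?P B" "\<And>C. ?P C \<Longrightarrow> card C \<le> card B"
    by blast
  have "w \<in> lin_span B" if "w \<in> W" for w
  proof (rule ccontr)
    assume w: "w \<notin> lin_span B"
    have "indep (insert w B)"
      using B(1) w by (blast intro: indep_insert)
    then have "card (insert w B) \<le> card B"
      using B(1) that by (intro B(2)) auto
    moreover have "finite B"
      using B(1) by (simp add: indep_def)
    ultimately have "w \<in> B"
      by (simp add: card_insert_if split: if_splits)
    then show False
      using w lin_span_base [OF \<open>finite B\<close>] by blast
  qed
  with B(1) show ?thesis by blast
qed

text \<open>
  Let \<open>K p\<close> be the set of vectors in the kernel of \<open>N\<close> that have a \<open>p\<close>-fold preimage in \<open>W\<close>. These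
  spaces decrease to zero, and extending bases from the smallest to the largest produces a basis \<open>B\<close> of
  the kernel that contains a basis of each \<open>K p\<close>. A basis vector \<open>b\<close> that lies in \<open>K (p - 1)\<close> but not in
  \<open>K p\<close> is the bottom of a chain of length \<open>p\<close>. Applying powers of \<open>N\<close> to a linear relation between
  chain vectors turns it into a relation between bottoms, so the chains are independent. They
  generate \<open>W\<close>: if \<open>N\<^sup>q\<^sup>+\<^sup>1 w = 0\<close>, then \<open>N\<^sup>q w\<close> is a combination of bottoms in \<open>K q\<close>, and subtracting the
  same combination of the vectors \<open>q\<close> steps up in these chains leaves a vector annihilated by \<open>N\<^sup>q\<close>.
\<close>

theorem nilpotent_chains:
  fixes N :: "quat ^ 'n \<Rightarrow> quat ^ 'n"
  assumes W: "lin_subspace W" and N: "linear N" and NW: "\<And>v. v \<in> W \<Longrightarrow> N v \<in> W"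
    and ND: "\<And>v d. d \<in> D \<Longrightarrow> N (v \<triangleleft> d) = N v \<triangleleft> d"
    and nil: "\<And>v. v \<in> W \<Longrightarrow> (N ^^ m) v = 0"
  shows "\<exists>(B :: (quat ^ 'n) set) k u. finite B \<and>
    (\<forall>b\<in>B. 0 < k b \<and> N (u b 0) = 0 \<and> (\<forall>j. Suc j < k b \<longrightarrow> N (u b (Suc j)) = u b j)) \<and>
    (\<forall>b\<in>B. \<forall>j<k b. u b j \<in> W) \<and>
    (\<forall>c. (\<forall>b j. c b j \<in> D) \<and> (\<Sum>b\<in>B. \<Sum>j<k b. u b j \<triangleleft> c b j) = 0 \<longrightarrow>
      (\<forall>b\<in>B. \<forall>j<k b. c b j = 0)) \<and>
    (\<forall>w\<in>W. \<exists>c. w = (\<Sum>b\<in>B. \<Sum>j<k b. u b j \<triangleleft> c b j))"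
proof -
  define K where "K p = {v \<in> W. N v = 0 \<and> v \<in> (N ^^ p) ` W}" for p
  have Npow_linear: "linear (N ^^ p)" for p
  proof (induction p)
    case (Suc p)
    then show ?case
      using linear_compose [OF Suc N] by (simp add: o_def)
  qed (simp add: linear_ident)
  have NpowD: "(N ^^ p) (v \<triangleleft> d) = (N ^^ p) v \<triangleleft> d" if "d \<in> D" for p v d
    by (induction p) (simp_all add: ND that)
  have NpowW: "(N ^^ p) v \<in> W" if "v \<in> W" for p v
    using that by (induction p) (auto intro: NW)
  have K_mono: "K q \<subseteq> K p" if "p \<le> q" for p q
  proof
    fix v assume "v \<in> K q"
    then obtain w where w: "v \<in> W" "N v = 0" "w \<in> W" "v = (N ^^ q) w"
      by (auto simp: K_def)
    have "v = (N ^^ p) ((N ^^ (q - p)) w)"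
      using that w(4) by (metis comp_apply funpow_add le_add_diff_inverse)
    then show "v \<in> K p"
      using w NpowW [OF w(3)] by (auto simp: K_def)
  qed
  have K_m: "K q \<subseteq> {0}" if "m \<le> q" for q
    using K_mono [OF that] nil by (auto simp: K_def)
  have "\<exists>B. indep B \<and> B \<subseteq> K p \<and> (\<forall>q\<ge>p. K q \<subseteq> lin_span (B \<inter> K q))" if "p \<le> m" for p
    using that
  proof (induction p rule: inc_induct)
    case base
    have "0 \<in> lin_span {}"
      using zero_in by (auto simp: lin_span_def)
    then show ?case
      using K_m by (intro exI [of _ "{}"]) (auto simp: indep_def)
  next
    case (step p)
    then obtain B where B: "indep B" "B \<subseteq> K (Suc p)" "\<forall>q\<ge>Suc p. K q \<subseteq> lin_span (B \<inter> K q)"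
      by blast
    have "B \<subseteq> K p"
      using B(2) K_mono [of p "Suc p"] by auto
    from indep_extend [OF B(1) this]
    obtain C where C: "B \<subseteq> C" "C \<subseteq> K p" "indep C" "K p \<subseteq> lin_span C"
      by (elim exE conjE)
    have "K q \<subseteq> lin_span (C \<inter> K q)" if "p \<le> q" for q
    proof (cases "q = p")
      case True
      then show ?thesis
        using C by (simp add: Int_absorb2)
    next
      case False
      have "lin_span (B \<inter> K q) \<subseteq> lin_span (C \<inter> K q)"
      proof
        fix v assume "v \<in> lin_span (B \<inter> K q)"
        then obtain c where c: "\<forall>b. c b \<in> D" "v = (\<Sum>b\<in>B \<inter> K q. b \<triangleleft> c b)"
          by (auto simp: lin_span_def)
        have "(\<Sum>b\<in>B \<inter> K q. b \<triangleleft> c b) = (\<Sum>b\<in>C \<inter> K q. b \<triangleleft> (if b \<in> B then c b else 0))"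
        proof (rule sum.mono_neutral_cong_left)
          show "finite (C \<inter> K q)"
            using C(3) by (simp add: indep_def)
        qed (use C(1) in auto)
        then show "v \<in> lin_span (C \<inter> K q)"
          using c zero_in unfolding lin_span_def
          by (intro CollectI exI [of _ "\<lambda>b. if b \<in> B then c b else 0"]) simp
      qed
      moreover have "K q \<subseteq> lin_span (B \<inter> K q)"
        using B(3) False that by simp
      ultimately show ?thesis by simp
    qed
    with C(2,3) show ?case
      by (intro exI [of _ C]) simp
  qed
  from this [OF le0] obtain B where B: "indep B" "B \<subseteq> K 0" "\<And>q. K q \<subseteq> lin_span (B \<inter> K q)"
    by (elim exE conjE) simp_all
  have fin: "finite B"
    using B(1) by (simp add: indep_def)
  have nz: "0 \<notin> B"
  proof
    assume "0 \<in> B"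
    let ?c = "\<lambda>b :: quat ^ 'n. if b = 0 then 1 else 0 :: quat"
    have "b \<triangleleft> ?c b = 0" for b :: "quat ^ 'n"
      by simp
    then have "(\<Sum>b\<in>B. b \<triangleleft> ?c b) = 0"
      by (simp only: sum.neutral_const)
    moreover have "\<forall>b\<in>B. ?c b \<in> D"
      using one_in zero_in by simp
    ultimately have "?c 0 = 0"
      using \<open>0 \<in> B\<close> indepD [OF B(1), of ?c 0] by blast
    then show False by simp
  qed
  define k where "k b = (LEAST q. b \<notin> K q)" for b
  have k: "b \<in> K q \<longleftrightarrow> q < k b" if "b \<in> B" for b q
  proof
    have "b \<notin> K m"
      using K_m [of m] nz that by auto
    then have l: "b \<notin> K (k b)"
      unfolding k_def by (rule LeastI)
    show "q < k b" if "b \<in> K q"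
      using l that K_mono [of "k b" q] by (meson in_mono leI)
    show "b \<in> K q" if "q < k b"
      using that not_less_Least unfolding k_def by blast
  qed
  have k0: "0 < k b" if "b \<in> B" for b
    using k [OF that, of 0] B(2) that by auto
  have "\<exists>w\<in>W. (N ^^ (k b - 1)) w = b" if "b \<in> B" for b
  proof -
    have "b \<in> K (k b - 1)"
      using k [OF that, of "k b - 1"] k0 [OF that] by simp
    then show ?thesis
      unfolding K_def by (metis (mono_tags, lifting) imageE mem_Collect_eq)
  qed
  then obtain top where top: "\<And>b. b \<in> B \<Longrightarrow> top b \<in> W"
    "\<And>b. b \<in> B \<Longrightarrow> (N ^^ (k b - 1)) (top b) = b"
    by metis
  define u where "u b j = (N ^^ (k b - 1 - j)) (top b)" for b j
  have uW: "u b j \<in> W" if "b \<in> B" for b j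
    unfolding u_def using top(1) [OF that] by (rule NpowW)
  have u0: "u b 0 = b" if "b \<in> B" for b
    using top(2) [OF that] by (simp add: u_def)
  have N0: "N b = 0" if "b \<in> B" for b
    using B(2) that by (auto simp: K_def)
  have uSuc: "N (u b (Suc j)) = u b j" if "Suc j < k b" for b j
  proof -
    have "k b - 1 - j = Suc (k b - 1 - Suc j)"
      using that by simp
    then show ?thesis
      by (simp add: u_def)
  qed
  have Npow_u: "(N ^^ p) (u b j) = (if p \<le> j then u b (j - p) else 0)"
    if "b \<in> B" "j < k b" for b j p
  proof (induction p)
    case (Suc p)
    show ?case
    proof (cases "p < j")
      case True
      then have "u b (j - p) = u b (Suc (j - Suc p))"
        by (metis Suc_diff_Suc)
      then show ?thesis
        using Suc True that(2) uSuc [of "j - Suc p" b] by simp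
    next
      case False
      then show ?thesis
        using Suc N0 [OF that(1)] u0 [OF that(1)] linear_0 [OF N] by auto
    qed
  qed simp
  \<comment> \<open>coefficients vanish from the tops downwards: once those above level \<open>p\<close> are gone, \<open>N\<^sup>p\<close> maps the
    relation to one between the bottoms, with the coefficients of level \<open>p\<close>\<close>
  have indep: "\<forall>b\<in>B. \<forall>j<k b. c b j = 0"
    if cD: "\<And>b j. c b j \<in> D" and c0: "(\<Sum>b\<in>B. \<Sum>j<k b. u b j \<triangleleft> c b j) = 0" for c
  proof -
    have km: "k b \<le> m" if "b \<in> B" for b
    proof (rule ccontr)
      assume "\<not> k b \<le> m"
      then have "b \<in> K m"
        using k [OF that, of m] by simp
      then show False
        using K_m [OF order_refl] nz that by auto
    qed
    have "\<forall>b\<in>B. \<forall>j<k b. p \<le> j \<longrightarrow> c b j = 0" if "p \<le> m" for p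
      using that
    proof (induction p rule: inc_induct)
      case base
      then show ?case using km by force
    next
      case (step p)
      have inner: "(N ^^ p) (\<Sum>j<k b. u b j \<triangleleft> c b j) = b \<triangleleft> (if p < k b then c b p else 0)"
        if "b \<in> B" for b
      proof -
        have "(N ^^ p) (\<Sum>j<k b. u b j \<triangleleft> c b j) = (\<Sum>j<k b. (N ^^ p) (u b j) \<triangleleft> c b j)"
          by (simp add: linear_sum [OF Npow_linear] NpowD cD)
        also have "\<dots> = (\<Sum>j<k b. if j = p then b \<triangleleft> c b p else 0)"
          using step.IH that by (intro sum.cong) (auto simp: Npow_u u0)
        finally show ?thesis by simp
      qed
      have "(N ^^ p) (\<Sum>b\<in>B. \<Sum>j<k b. u b j \<triangleleft> c b j) = 0"
        by (simp add: c0 linear_0 [OF Npow_linear])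
      then have "(\<Sum>b\<in>B. b \<triangleleft> (if p < k b then c b p else 0)) = 0"
        using inner by (simp add: linear_sum [OF Npow_linear])
      from indepD [OF B(1) _ this] have p: "c b p = 0" if "b \<in> B" "p < k b" for b
        using that cD zero_in by force
      show ?case
      proof (intro ballI allI impI)
        fix b j assume "b \<in> B" "j < k b" "p \<le> j"
        then show "c b j = 0"
          using p step.IH by (cases "j = p") auto
      qed
    qed
    from this [of 0] show ?thesis by simp
  qed
  have span: "\<exists>c. w = (\<Sum>b\<in>B. \<Sum>j<k b. u b j \<triangleleft> c b j)"
    if "w \<in> W" "(N ^^ q) w = 0" for w q
    using that
  proof (induction q arbitrary: w)
    case 0
    then show ?case by (intro exI [of _ "\<lambda>_ _. 0"]) simp
  next
    case (Suc q)
    then have "(N ^^ q) w \<in> K q"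
      by (auto simp: K_def NpowW)
    then have "(N ^^ q) w \<in> lin_span (B \<inter> K q)"
      using B(3) [of q] by (rule subsetD [rotated])
    then obtain d where d: "\<And>b. d b \<in> D" "(N ^^ q) w = (\<Sum>b\<in>B \<inter> K q. b \<triangleleft> d b)"
      unfolding lin_span_def by blast
    define z where "z = (\<Sum>b\<in>B \<inter> K q. u b q \<triangleleft> d b)"
    have "z \<in> W"
      unfolding z_def by (intro lin_subspace_sum W lin_subspaceD(3) [OF W] uW d(1)) auto
    moreover have "(N ^^ q) z = (N ^^ q) w"
      unfolding z_def d(2) by (simp add: linear_sum [OF Npow_linear] NpowD d(1))
        (rule sum.cong, auto simp: Npow_u k u0)
    ultimately have "\<exists>c. w - z = (\<Sum>b\<in>B. \<Sum>j<k b. u b j \<triangleleft> c b j)"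
      using Suc.prems(1) by (intro Suc.IH)
        (auto intro: lin_subspace_diff [OF W] simp: linear_diff [OF Npow_linear])
    then obtain c where c: "w - z = (\<Sum>b\<in>B. \<Sum>j<k b. u b j \<triangleleft> c b j)" ..
    have "z = (\<Sum>b\<in>B. if q < k b then u b q \<triangleleft> d b else 0)"
      unfolding z_def using fin by (intro sum.mono_neutral_cong_left) (auto simp: k)
    also have "\<dots> = (\<Sum>b\<in>B. \<Sum>j<k b. u b j \<triangleleft> (if j = q then d b else 0))"
      by (intro sum.cong refl) (simp add: if_distrib cong: if_cong)
    finally have "w = (\<Sum>b\<in>B. \<Sum>j<k b. u b j \<triangleleft> (c b j + (if j = q then d b else 0)))"
      using c by (simp add: rscale_add_right sum.distrib algebra_simps)
    then show ?case
      by (intro exI [of _ "\<lambda>b j. c b j + (if j = q then d b else 0)"])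
  qed
  show ?thesis
    using fin k0 N0 u0 uSuc uW indep span [OF _ nil]
    by (intro exI [of _ B] exI [of _ k] exI [of _ u]) auto
qed

end

section \<open>A quaternion basis of Jordan chains\<close>

lemma scalar_division_ring_complex: "scalar_division_ring (range quat_of_complex)"
proof
  show "of_real r \<in> range quat_of_complex" for r
    by (rule range_eqI [of _ _ "of_real r"]) (simp add: quat_of_complex_of_real)
  fix a assume "a \<in> range quat_of_complex"
  then obtain z where z: "a = quat_of_complex z" by blast
  show "inverse a \<in> range quat_of_complex"
  proof (cases "z = 0")
    case False
    then have "quat_of_complex (inverse z) * a = 1"
      by (simp add: z quat_of_complex_mult [symmetric])
    then have "inverse a = quat_of_complex (inverse z)"
      by (metis inverse_unique inverse_inverse_eq)
    then show ?thesis by simp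
  qed (use z in \<open>auto intro: range_eqI [of _ _ 0]\<close>)
  fix b assume "b \<in> range quat_of_complex"
  then obtain w where w: "b = quat_of_complex w" by blast
  show "a + b \<in> range quat_of_complex"
    by (rule range_eqI [of _ _ "z + w"]) (simp add: z w quat_of_complex_add)
  show "a * b \<in> range quat_of_complex"
    by (rule range_eqI [of _ _ "z * w"]) (simp add: z w quat_of_complex_mult)
qed

lemma scalar_division_ring_quat: "scalar_division_ring UNIV"
  by standard auto

lemma generalized_eigenspace_uniform:
  "\<exists>m. \<forall>v\<in>generalized_eigenspace X l. (shifted X l ^^ m) v = 0"
proof -
  let ?W = "generalized_eigenspace X l"
  obtain B where B: "B \<subseteq> ?W" "independent B" "?W \<subseteq> span B"
    by (rule basis_exists [of ?W])
  then have "finite B"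
    using independent_bound by blast
  from B(1) have "\<forall>b\<in>B. \<exists>m. (shifted X l ^^ m) b = 0"
    by (auto simp: generalized_eigenspace_def)
  then obtain f where f: "\<And>b. b \<in> B \<Longrightarrow> (shifted X l ^^ f b) b = 0"
    by metis
  define m where "m = (\<Sum>b\<in>B. f b)"
  have "(shifted X l ^^ m) b = 0" if "b \<in> B" for b
  proof (rule shifted_pow_0_mono [OF f [OF that]])
    show "f b \<le> m"
      unfolding m_def using that \<open>finite B\<close> by (intro member_le_sum) auto
  qed
  then have "(shifted X l ^^ m) v = 0" if "v \<in> span B" for v
    using linear_eq_0_on_span [OF linear_shifted_pow _ that] by blast
  with B(3) show ?thesis by blast
qed

text \<open>
  The scalars over which \<open>shifted X l\<close> is linear: the quaternions that commute with \<open>l\<close>.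
\<close>

definition chain_scalars :: "complex \<Rightarrow> quat set" where
  "chain_scalars l = (if Im l = 0 then UNIV else range quat_of_complex)"

lemma chain_scalars_commute:
  "d \<in> chain_scalars l \<Longrightarrow> d * quat_of_complex l = quat_of_complex l * d"
  by (auto simp: chain_scalars_def quat_eq_iff split: if_splits)

definition chain_basis :: "quat ^ 'n ^ 'n \<Rightarrow> complex \<Rightarrow> (quat ^ 'n) set \<Rightarrow> (quat ^ 'n \<Rightarrow> nat) \<Rightarrow>
    (quat ^ 'n \<Rightarrow> nat \<Rightarrow> quat ^ 'n) \<Rightarrow> bool" where
  "chain_basis X l B k u \<longleftrightarrow> finite B \<and>
    (\<forall>b\<in>B. 0 < k b \<and> shifted X l (u b 0) = 0 \<and>
      (\<forall>j. Suc j < k b \<longrightarrow> shifted X l (u b (Suc j)) = u b j)) \<and>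
    (\<forall>b\<in>B. \<forall>j<k b. u b j \<in> generalized_eigenspace X l) \<and>
    (\<forall>c. (\<forall>b j. c b j \<in> chain_scalars l) \<and> (\<Sum>b\<in>B. \<Sum>j<k b. u b j \<triangleleft> c b j) = 0 \<longrightarrow>
      (\<forall>b\<in>B. \<forall>j<k b. c b j = 0)) \<and>
    (\<forall>w\<in>generalized_eigenspace X l. \<exists>c. w = (\<Sum>b\<in>B. \<Sum>j<k b. u b j \<triangleleft> c b j))"

lemma generalized_eigenspace_chains: "\<exists>B k u. chain_basis X l B k u"
proof -
  let ?W = "generalized_eigenspace X l"
  interpret scalar_division_ring "chain_scalars l"
    by (simp add: chain_scalars_def scalar_division_ring_quat scalar_division_ring_complex)
  have comm: "shifted X l (v \<triangleleft> d) = shifted X l v \<triangleleft> d" if "d \<in> chain_scalars l" for v d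
    using chain_scalars_commute [OF that]
    by (simp add: shifted_def matrix_vector_rscale rscale_diff_left rscale_rscale)
  have comm_pow: "(shifted X l ^^ p) (v \<triangleleft> d) = (shifted X l ^^ p) v \<triangleleft> d"
    if "d \<in> chain_scalars l" for v d p
    by (induction p) (simp_all add: comm [OF that])
  have W: "lin_subspace ?W"
    unfolding lin_subspace_def
  proof (intro conjI ballI)
    fix v d assume "v \<in> ?W" "d \<in> chain_scalars l"
    then obtain p where "(shifted X l ^^ p) v = 0"
      by (auto simp: generalized_eigenspace_def)
    then show "v \<triangleleft> d \<in> ?W"
      using comm_pow [OF \<open>d \<in> chain_scalars l\<close>, of p v]
      by (intro generalized_eigenspaceI [where m = p]) simp
  qed (simp_all add: subspace_0 subspace_add subspace_generalized_eigenspace)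
  obtain m where "\<And>v. v \<in> ?W \<Longrightarrow> (shifted X l ^^ m) v = 0"
    using generalized_eigenspace_uniform by blast
  from nilpotent_chains [OF W linear_shifted generalized_eigenspace_shifted comm this]
  show ?thesis
    unfolding chain_basis_def .
qed

lemma quat_split: "q = quat_of_complex (Complex (quat_re q) (quat_i q))
    + quat_of_complex (Complex (quat_j q) (quat_k q)) * quat_jj"
  by (simp add: quat_eq_iff)

text \<open>
  Every quaternion is \<open>\<alpha> + \<beta> \<j>\<close> with complex \<open>\<alpha>\<close> and \<open>\<beta>\<close>. For non-real \<open>l\<close> a quaternion combination of the
  chains of \<open>l\<close> is thus \<open>x + w \<j>\<close>, where \<open>x\<close> and \<open>w\<close> have the coefficients \<open>\<alpha>\<close> and \<open>\<beta>\<close> and lie in the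
  generalized eigenspace of \<open>l\<close>, and \<open>w \<j>\<close> lies in that of \<open>cnj l\<close>. A relation between all chains
  therefore splits into one relation within each generalized eigenspace, complex for non-real \<open>l\<close>, to
  which the independence of the chains of \<open>l\<close> applies. Conversely, vectors in the generalized eigenspace of \<open>cnj l\<close> are reached by
  multiplying those of \<open>l\<close> by \<open>\<j>\<close>, so eigenvalues in the closed upper half plane suffice.
\<close>

lemma jordan_chains_exist:
  fixes X :: "quat ^ 'n ^ 'n"
  shows "\<exists>(E :: complex set) (B :: complex \<Rightarrow> (quat ^ 'n) set) k u. finite E \<and> (\<forall>l\<in>E. finite (B l)) \<and>
    (\<forall>l\<in>E. 0 \<le> Im l) \<and>
    (\<forall>l\<in>E. \<forall>b\<in>B l. 0 < k l b \<and> shifted X l (u l b 0) = 0 \<and>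
      (\<forall>j. Suc j < k l b \<longrightarrow> shifted X l (u l b (Suc j)) = u l b j)) \<and>
    (\<forall>c. (\<Sum>l\<in>E. \<Sum>b\<in>B l. \<Sum>j<k l b. u l b j \<triangleleft> c l b j) = 0 \<longrightarrow>
      (\<forall>l\<in>E. \<forall>b\<in>B l. \<forall>j<k l b. c l b j = 0)) \<and>
    (\<forall>v. \<exists>c. v = (\<Sum>l\<in>E. \<Sum>b\<in>B l. \<Sum>j<k l b. u l b j \<triangleleft> c l b j))"
proof -
  define EE where "EE = {l. \<exists>v. v \<noteq> 0 \<and> shifted X l v = 0}"
  define E where "E = {l \<in> EE. 0 \<le> Im l}"
  have finEE: "finite EE"
    unfolding EE_def by (rule finite_eigenvalues)
  then have finE: "finite E"
    by (simp add: E_def)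
  have "\<forall>l. \<exists>B k u. chain_basis X l B k u"
    using generalized_eigenspace_chains by blast
  then obtain B k u where basis: "\<And>l. chain_basis X l (B l) (k l) (u l)"
    by metis
  have
    finB: "\<And>l. finite (B l)" and
    chain: "\<And>l b. b \<in> B l \<Longrightarrow> 0 < k l b \<and> shifted X l (u l b 0) = 0 \<and>
      (\<forall>j. Suc j < k l b \<longrightarrow> shifted X l (u l b (Suc j)) = u l b j)" and
    mem: "\<And>l b j. b \<in> B l \<Longrightarrow> j < k l b \<Longrightarrow> u l b j \<in> generalized_eigenspace X l" and
    ind: "\<And>l c. (\<forall>b j. c b j \<in> chain_scalars l) \<and> (\<Sum>b\<in>B l. \<Sum>j<k l b. u l b j \<triangleleft> c b j) = 0 \<Longrightarrow>
      (\<forall>b\<in>B l. \<forall>j<k l b. c b j = 0)" and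
    spn: "\<And>l w. w \<in> generalized_eigenspace X l \<Longrightarrow> \<exists>c. w = (\<Sum>b\<in>B l. \<Sum>j<k l b. u l b j \<triangleleft> c b j)"
    using basis unfolding chain_basis_def by blast+
  define comb where "comb l c = (\<Sum>b\<in>B l. \<Sum>j<k l b. u l b j \<triangleleft> c b j)" for l c
  have comb_rscale: "comb l c \<triangleleft> q = comb l (\<lambda>b j. c b j * q)" for l c q
    by (simp add: comb_def rscale_sum_left rscale_rscale)
  have comb_add: "comb l c + comb l d = comb l (\<lambda>b j. c b j + d b j)" for l c d
    by (simp add: comb_def rscale_add_right sum.distrib)
  have comb_mem: "comb l (\<lambda>b j. quat_of_complex (c b j)) \<in> generalized_eigenspace X l" for l c
    unfolding comb_def
    by (intro subspace_sum subspace_generalized_eigenspace generalized_eigenspace_rscale mem) auto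
  have comb_mem_real: "comb l c \<in> generalized_eigenspace X l" if "Im l = 0" for l c
  proof -
    have comm: "(shifted X l ^^ p) (v \<triangleleft> d) = (shifted X l ^^ p) v \<triangleleft> d" for p v d
      using chain_scalars_commute [of d l] that
      by (induction p) (simp_all add: shifted_def matrix_vector_rscale rscale_diff_left
          rscale_rscale chain_scalars_def)
    have "v \<triangleleft> d \<in> generalized_eigenspace X l" if v: "v \<in> generalized_eigenspace X l" for v d
    proof -
      obtain p where "(shifted X l ^^ p) v = 0"
        using v by (auto simp: generalized_eigenspace_def)
      then show ?thesis
        by (intro generalized_eigenspaceI [where m = p]) (simp add: comm)
    qed
    then show ?thesis
      unfolding comb_def using mem
      by (intro subspace_sum subspace_generalized_eigenspace) auto
  qed
  have indep: "\<forall>l\<in>E. \<forall>b\<in>B l. \<forall>j<k l b. c l b j = 0" if "(\<Sum>l\<in>E. comb l (c l)) = 0" for c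
  proof -
    define \<alpha> where "\<alpha> l b j = Complex (quat_re (c l b j)) (quat_i (c l b j))" for l b j
    define \<beta> where "\<beta> l b j = Complex (quat_j (c l b j)) (quat_k (c l b j))" for l b j
    define x where "x l = comb l (\<lambda>b j. quat_of_complex (\<alpha> l b j))" for l
    define w where "w l = comb l (\<lambda>b j. quat_of_complex (\<beta> l b j))" for l
    have split: "comb l (c l) = x l + w l \<triangleleft> quat_jj" for l
      unfolding x_def w_def comb_rscale comb_add \<alpha>_def \<beta>_def by (subst quat_split [symmetric]) simp
    \<comment> \<open>the component of the relation in the generalized eigenspace of \<open>l\<close>, for \<open>l\<close> in either half plane\<close>
    define y where "y l = (if Im l = 0 then comb l (c l) else if 0 < Im l then x l
      else w (cnj l) \<triangleleft> quat_jj)" for l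
    let ?P = "{l \<in> E. 0 < Im l}" and ?R = "{l \<in> E. Im l = 0}"
    have y_mem: "y l \<in> generalized_eigenspace X l" for l
    proof -
      have "v \<triangleleft> quat_jj \<in> generalized_eigenspace X l"
        if v: "v \<in> generalized_eigenspace X (cnj l)" for v
      proof -
        obtain p where "(shifted X (cnj l) ^^ p) v = 0"
          using v by (auto simp: generalized_eigenspace_def)
        then show ?thesis
          using shifted_pow_cnj [of p X "cnj l" v]
          by (intro generalized_eigenspaceI [where m = p]) simp
      qed
      then show ?thesis
        unfolding y_def x_def w_def by (simp add: comb_mem comb_mem_real)
    qed
    have "(\<Sum>l\<in>cnj ` ?P. y l) = (\<Sum>l\<in>?P. w l \<triangleleft> quat_jj)"
      by (subst sum.reindex) (auto simp: inj_on_def y_def intro!: sum.cong)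
    moreover have "(\<Sum>l\<in>E. y l) = (\<Sum>l\<in>?R. y l) + (\<Sum>l\<in>?P. y l)"
      using finEE by (subst sum.union_disjoint [symmetric]) (auto simp: E_def intro!: sum.cong)
    moreover have "(\<Sum>l\<in>E. comb l (c l)) = (\<Sum>l\<in>?R. comb l (c l)) + (\<Sum>l\<in>?P. comb l (c l))"
      using finEE by (subst sum.union_disjoint [symmetric]) (auto simp: E_def intro!: sum.cong)
    moreover have "(\<Sum>l\<in>?P. comb l (c l)) = (\<Sum>l\<in>?P. y l) + (\<Sum>l\<in>?P. w l \<triangleleft> quat_jj)"
      by (simp add: split y_def flip: sum.distrib)
    moreover have "(\<Sum>l\<in>?R. comb l (c l)) = (\<Sum>l\<in>?R. y l)"
      by (simp add: y_def)
    moreover have "(\<Sum>l\<in>E \<union> cnj ` ?P. y l) = (\<Sum>l\<in>E. y l) + (\<Sum>l\<in>cnj ` ?P. y l)"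
      using finEE by (intro sum.union_disjoint) (auto simp: E_def)
    ultimately have "(\<Sum>l\<in>E \<union> cnj ` ?P. y l) = 0"
      using that by (simp add: algebra_simps)
    from generalized_eigenspaces_independent [OF _ y_mem this]
    have y0: "y l = 0" if "l \<in> E \<union> cnj ` ?P" for l
      using that finE by simp
    show ?thesis
    proof
      fix l assume l: "l \<in> E"
      show "\<forall>b\<in>B l. \<forall>j<k l b. c l b j = 0"
      proof (cases "Im l = 0")
        case True
        have "y l = 0"
          using l by (simp add: y0)
        then have "comb l (c l) = 0"
          using True by (simp add: y_def)
        then show ?thesis
          unfolding comb_def by (intro ind) (simp add: chain_scalars_def True)
      next
        case False
        then have "0 < Im l"
          using l by (simp add: E_def)
        have "y l = 0" "y (cnj l) = 0"
          using l \<open>0 < Im l\<close> by (simp_all add: y0)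
        then have "x l = 0" "w l = 0"
          using \<open>0 < Im l\<close> by (simp_all add: y_def)
        then have "\<forall>b\<in>B l. \<forall>j<k l b. quat_of_complex (\<alpha> l b j) = 0"
          "\<forall>b\<in>B l. \<forall>j<k l b. quat_of_complex (\<beta> l b j) = 0"
          using False unfolding x_def w_def comb_def
          by (intro ind; simp add: chain_scalars_def)+
        then show ?thesis
          by (simp add: \<alpha>_def \<beta>_def quat_eq_iff complex_eq_iff)
      qed
    qed
  qed
  have span: "\<exists>c. v = (\<Sum>l\<in>E. comb l (c l))" for v
  proof -
    define S where "S = {v. \<exists>c. v = (\<Sum>l\<in>E. comb l (c l))}"
    have S_add: "v + w \<in> S" if v: "v \<in> S" and w: "w \<in> S" for v w
    proof -
      from v w obtain c d where "v = (\<Sum>l\<in>E. comb l (c l))" "w = (\<Sum>l\<in>E. comb l (d l))"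
        by (auto simp: S_def)
      then have "v + w = (\<Sum>l\<in>E. comb l (\<lambda>b j. c l b j + d l b j))"
        by (simp add: comb_add flip: sum.distrib)
      then show ?thesis
        unfolding S_def by (intro CollectI exI [of _ "\<lambda>l b j. c l b j + d l b j"])
    qed
    have S_rscale: "v \<triangleleft> q \<in> S" if v: "v \<in> S" for v q
    proof -
      from v obtain c where "v = (\<Sum>l\<in>E. comb l (c l))"
        by (auto simp: S_def)
      then have "v \<triangleleft> q = (\<Sum>l\<in>E. comb l (\<lambda>b j. c l b j * q))"
        by (simp add: rscale_sum_left comb_rscale)
      then show ?thesis
        unfolding S_def by (intro CollectI exI [of _ "\<lambda>l b j. c l b j * q"])
    qed
    have comb0: "comb l (\<lambda>b j. 0) = 0" for l
      by (simp add: comb_def)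
    have S_0: "0 \<in> S"
      unfolding S_def by (intro CollectI exI [of _ "\<lambda>l b j. 0"]) (simp add: comb0)
    have S_sum: "sum f F \<in> S" if "\<And>l. l \<in> F \<Longrightarrow> f l \<in> S" for f and F :: "complex set"
      using that by (induction F rule: infinite_finite_induct) (auto intro: S_0 S_add)
    have S_gen: "w \<in> S" if w: "w \<in> generalized_eigenspace X l" and l: "l \<in> E" for w l
    proof -
      obtain c where c: "w = comb l c"
        using spn [OF w] by (auto simp: comb_def)
      have "comb i (if i = l then c else (\<lambda>b j. 0)) = (if i = l then comb l c else 0)" for i
        by (simp add: comb0)
      then have "w = (\<Sum>i\<in>E. comb i (if i = l then c else (\<lambda>b j. 0)))"
        using finE l by (simp add: c)
      then show ?thesis
        unfolding S_def by (intro CollectI exI [of _ "\<lambda>i. if i = l then c else (\<lambda>b j. 0)"])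
    qed
    obtain f where f: "\<And>l. f l \<in> generalized_eigenspace X l" "v = (\<Sum>l\<in>EE. f l)"
      using generalized_eigenvector_decomposition [of X v] unfolding EE_def by blast
    have "f l \<in> S" if l: "l \<in> EE" for l
    proof (cases "0 \<le> Im l")
      case True
      then show ?thesis
        using S_gen [OF f(1) [of l]] l by (simp add: E_def)
    next
      case False
      obtain p where "(shifted X l ^^ p) (f l) = 0"
        using f(1) by (auto simp: generalized_eigenspace_def)
      then have mem: "f l \<triangleleft> quat_jj \<in> generalized_eigenspace X (cnj l)"
        by (intro generalized_eigenspaceI [where m = p]) (simp add: shifted_pow_cnj)
      from l obtain v where "v \<noteq> 0" "shifted X l v = 0"
        by (auto simp: EE_def)
      then have "cnj l \<in> EE"
        unfolding EE_def by (intro CollectI exI [of _ "v \<triangleleft> quat_jj"]) (simp add: shifted_cnj)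
      then have "f l \<triangleleft> quat_jj \<in> S"
        using False by (intro S_gen [OF mem]) (simp add: E_def)
      then have "(f l \<triangleleft> quat_jj) \<triangleleft> (- quat_jj) \<in> S"
        by (rule S_rscale)
      then show ?thesis
        by (simp add: rscale_rscale quat_units)
    qed
    then have "v \<in> S"
      unfolding f(2) by (rule S_sum)
    then show ?thesis
      by (simp add: S_def)
  qed
  show ?thesis
    using finE finB chain indep span unfolding comb_def
    by (intro exI [of _ E] exI [of _ B] exI [of _ k] exI [of _ u]) (auto simp: E_def)
qed

text \<open>
  A quaternion basis becomes a real one when each vector is multiplied by the four units, so real
  dimension counts its elements.
\<close>

lemma right_basis_card:
  fixes g :: "'i \<Rightarrow> quat ^ 'n"
  assumes fin: "finite I"
    and ind: "\<And>c. (\<Sum>i\<in>I. g i \<triangleleft> c i) = 0 \<Longrightarrow> \<forall>i\<in>I. c i = 0"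
    and spn: "\<And>v. \<exists>c. v = (\<Sum>i\<in>I. g i \<triangleleft> c i)"
  shows "card I = CARD('n)"
proof -
  define h where "h = (\<lambda>(i, q). g i \<triangleleft> q)"
  let ?J = "I \<times> (Basis :: quat set)"
  have comb: "(\<Sum>x\<in>?J. r x *\<^sub>R h x) = (\<Sum>i\<in>I. g i \<triangleleft> (\<Sum>q\<in>Basis. r (i, q) *\<^sub>R q))" for r
    unfolding rscale_sum_right rscale_scaleR_right sum.cartesian_product
    by (intro sum.cong) (auto simp: h_def)
  have r0: "r x = 0" if r: "(\<Sum>x\<in>?J. r x *\<^sub>R h x) = 0" and xJ: "x \<in> ?J" for r x
  proof -
    obtain i q where x: "x = (i, q)" "i \<in> I" "q \<in> Basis"
      using xJ by blast
    have "(\<Sum>q\<in>Basis. r (i, q) *\<^sub>R q) = 0"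
      using ind [of "\<lambda>i. \<Sum>q\<in>Basis. r (i, q) *\<^sub>R q"] r x(2) by (simp add: comb)
    then have "inner (\<Sum>q\<in>Basis. r (i, q) *\<^sub>R q) q = 0"
      by simp
    then show ?thesis
      using x by (simp add: inner_sum_left_Basis)
  qed
  have finJ: "finite ?J"
    using fin by simp
  have inj: "inj_on h ?J"
  proof (rule inj_onI, rule ccontr)
    fix x y assume xy: "x \<in> ?J" "y \<in> ?J" "h x = h y" "x \<noteq> y"
    \<comment> \<open>the relation \<open>h x - h y = 0\<close>\<close>
    define r where "r z = (if z = x then 1 else if z = y then - 1 else 0 :: real)" for z
    have "(\<Sum>z\<in>?J. r z *\<^sub>R h z) = (\<Sum>z\<in>{x, y}. r z *\<^sub>R h z)"
      using finJ xy by (intro sum.mono_neutral_right) (auto simp: r_def)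
    also have "\<dots> = 0"
      using xy by (simp add: r_def)
    finally have "r x = 0"
      using xy(1) by (rule r0)
    then show False
      by (simp add: r_def)
  qed
  have "independent (h ` ?J)"
  proof
    assume "dependent (h ` ?J)"
    then obtain r w where r: "w \<in> h ` ?J" "r w \<noteq> 0" "(\<Sum>w\<in>h ` ?J. r w *\<^sub>R w) = 0"
      using finJ by (auto simp only: dependent_finite finite_imageI)
    then have "(\<Sum>x\<in>?J. r (h x) *\<^sub>R h x) = 0"
      by (simp add: sum.reindex [OF inj])
    from r0 [OF this] r(1,2) show False
      by blast
  qed
  moreover have "v \<in> span (h ` ?J)" for v
  proof -
    obtain c where "v = (\<Sum>i\<in>I. g i \<triangleleft> c i)"
      using spn by blast
    also have "\<dots> = (\<Sum>x\<in>?J. inner (c (fst x)) (snd x) *\<^sub>R h x)"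
      by (simp add: comb euclidean_representation)
    also have "\<dots> \<in> span (h ` ?J)"
      by (intro span_sum span_scale span_base) auto
    finally show ?thesis .
  qed
  ultimately have "card (h ` ?J) = dim (UNIV :: (quat ^ 'n) set)"
    by (intro basis_card_eq_dim) auto
  then have "card I * DIM(quat) = CARD('n) * DIM(quat)"
    by (simp add: card_image [OF inj] card_cartesian_product)
  then show ?thesis
    by simp
qed

section \<open>Jordan matrices in block coordinates\<close>

text \<open>
  A row or column of a Jordan matrix is addressed by a pair \<open>(\<kappa>, j)\<close>: the name of its block and the
  place within the block. The list runs through these pairs in the order of the matrix.
\<close>

definition jordan_positions :: "('k \<Rightarrow> nat) \<Rightarrow> 'k list \<Rightarrow> ('k \<times> nat) list" where
  "jordan_positions k \<kappa>s = concat (map (\<lambda>\<kappa>. map (Pair \<kappa>) [0..<k \<kappa>]) \<kappa>s)"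

definition jordan_entry :: "('k \<Rightarrow> 'a::{zero,one}) \<Rightarrow> 'k \<times> nat \<Rightarrow> 'k \<times> nat \<Rightarrow> 'a" where
  "jordan_entry lam p q =
    (if p = q then lam (fst p) else if fst p = fst q \<and> Suc (snd p) = snd q then 1 else 0)"

lemma length_jordan_positions: "length (jordan_positions k \<kappa>s) = sum_list (map k \<kappa>s)"
  by (induction \<kappa>s) (simp_all add: jordan_positions_def)

lemma set_jordan_positions: "set (jordan_positions k \<kappa>s) = (SIGMA \<kappa>:set \<kappa>s. {..<k \<kappa>})"
  by (auto simp: jordan_positions_def)

lemma distinct_jordan_positions: "distinct \<kappa>s \<Longrightarrow> distinct (jordan_positions k \<kappa>s)"
proof (induction \<kappa>s)
  case (Cons \<kappa> \<kappa>s)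
  then show ?case
    using set_jordan_positions [of k \<kappa>s]
    by (auto simp: jordan_positions_def distinct_map inj_on_def)
qed (simp add: jordan_positions_def)

lemma jordan_matrix_index:
  assumes "distinct \<kappa>s" "i < sum_list (map k \<kappa>s)" "j < sum_list (map k \<kappa>s)"
  shows "jordan_matrix (map (\<lambda>\<kappa>. (k \<kappa>, lam \<kappa>)) \<kappa>s) $$ (i, j) =
    jordan_entry lam (jordan_positions k \<kappa>s ! i) (jordan_positions k \<kappa>s ! j)"
  using assms
proof (induction \<kappa>s arbitrary: i j)
  case (Cons \<kappa> \<kappa>s)
  let ?P = "jordan_positions k \<kappa>s"
  have P: "jordan_positions k (\<kappa> # \<kappa>s) = map (Pair \<kappa>) [0..<k \<kappa>] @ ?P"
    by (simp add: jordan_positions_def)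
  have ne: "fst (?P ! i) \<noteq> \<kappa>" if "i < sum_list (map k \<kappa>s)" for i
  proof -
    have "?P ! i \<in> set ?P"
      using that by (intro nth_mem) (simp add: length_jordan_positions)
    then show ?thesis
      using Cons.prems(1) by (auto simp: set_jordan_positions)
  qed
  have s: "sum_list (map fst (map (\<lambda>\<kappa>. (k \<kappa>, lam \<kappa>)) \<kappa>s)) = sum_list (map k \<kappa>s)"
    by (simp add: o_def)
  have IH: "jordan_matrix (map (\<lambda>\<kappa>. (k \<kappa>, lam \<kappa>)) \<kappa>s) $$ (i - k \<kappa>, j - k \<kappa>) =
      jordan_entry lam (?P ! (i - k \<kappa>)) (?P ! (j - k \<kappa>))" if "k \<kappa> \<le> i" "k \<kappa> \<le> j"
    using Cons.prems that by (intro Cons.IH) auto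
  have ij: "i < k \<kappa> + sum_list (map k \<kappa>s)" "j < k \<kappa> + sum_list (map k \<kappa>s)"
    using Cons.prems by auto
  have J: "jordan_matrix (map (\<lambda>\<kappa>. (k \<kappa>, lam \<kappa>)) (\<kappa> # \<kappa>s)) $$ (i, j) =
      (if i < k \<kappa> then
         if j < k \<kappa> then jordan_block (k \<kappa>) (lam \<kappa>) $$ (i, j) else 0
       else if j < k \<kappa> then 0
       else jordan_matrix (map (\<lambda>\<kappa>. (k \<kappa>, lam \<kappa>)) \<kappa>s) $$ (i - k \<kappa>, j - k \<kappa>))"
    using ij unfolding list.map jordan_matrix_Cons s
    by (subst index_mat_four_block(1)) (auto simp: o_def)
  consider "i < k \<kappa>" "j < k \<kappa>" | "i < k \<kappa>" "k \<kappa> \<le> j" | "k \<kappa> \<le> i" "j < k \<kappa>"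
    | "k \<kappa> \<le> i" "k \<kappa> \<le> j"
    by linarith
  then show ?case
  proof cases
    case 1
    then show ?thesis
      unfolding J by (simp add: P nth_append jordan_entry_def)
  next
    case 2
    then have "fst (?P ! (j - k \<kappa>)) \<noteq> \<kappa>"
      using ij by (intro ne) auto
    with 2 show ?thesis
      unfolding J by (cases "?P ! (j - k \<kappa>)") (simp add: P nth_append jordan_entry_def)
  next
    case 3
    then have "fst (?P ! (i - k \<kappa>)) \<noteq> \<kappa>"
      using ij by (intro ne) auto
    with 3 show ?thesis
      unfolding J by (cases "?P ! (i - k \<kappa>)") (simp add: P nth_append jordan_entry_def)
  next
    case 4
    then show ?thesis
      unfolding J using IH by (simp add: P nth_append)
  qed
qed simp

lemma jordan_matrix_coordinates:
  fixes J :: "'a::{zero,one} ^ 'n ^ 'n"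
  assumes "is_jordan_matrix J"
  shows "\<exists>(m :: nat) k lam \<phi>. bij_betw \<phi> UNIV (SIGMA b:{..<m}. {..<k b}) \<and>
    (\<forall>x y. J $ x $ y = jordan_entry lam (\<phi> x) (\<phi> y))"
proof -
  obtain e blocks where e: "bij_betw e {..<CARD('n)} UNIV"
    and card: "sum_list (map fst blocks) = CARD('n)"
    and J: "\<And>i j. i < CARD('n) \<Longrightarrow> j < CARD('n) \<Longrightarrow>
      J $ e i $ e j = jordan_matrix blocks $$ (i, j)"
    using assms unfolding is_jordan_matrix_def by blast
  define m where "m = length blocks"
  define k where "k b = fst (blocks ! b)" for b
  define lam where "lam b = snd (blocks ! b)" for b
  let ?P = "jordan_positions k [0..<m]"
  have blocks: "map (\<lambda>b. (k b, lam b)) [0..<m] = blocks"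
    by (rule nth_equalityI) (simp_all add: m_def k_def lam_def)
  then have "map fst (map (\<lambda>b. (k b, lam b)) [0..<m]) = map fst blocks"
    by simp
  then have "map k [0..<m] = map fst blocks"
    by (simp add: o_def)
  then have len: "sum_list (map k [0..<m]) = CARD('n)"
    by (simp add: card)
  have bP: "bij_betw ((!) ?P) {..<CARD('n)} (SIGMA b:{..<m}. {..<k b})"
    using bij_betw_nth [OF distinct_jordan_positions [of "[0..<m]" k]]
    by (simp add: length_jordan_positions len set_jordan_positions lessThan_atLeast0)
  define f where "f = inv_into {..<CARD('n)} e"
  have f: "bij_betw f UNIV {..<CARD('n)}"
    unfolding f_def by (rule bij_betw_inv_into [OF e])
  have ef: "e (f x) = x" for x
    unfolding f_def by (rule bij_betw_inv_into_right [OF e]) simp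
  have fl: "f x < CARD('n)" for x
    using bij_betwE [OF f] by simp
  have "bij_betw (\<lambda>x. ?P ! f x) UNIV (SIGMA b:{..<m}. {..<k b})"
    using bij_betw_trans [OF f bP] by (simp add: o_def)
  moreover have "J $ x $ y = jordan_entry lam (?P ! f x) (?P ! f y)" for x y
    using J [OF fl fl, of x y] jordan_matrix_index [of "[0..<m]" "f x" k "f y" lam] fl
    by (simp add: ef len blocks)
  ultimately show ?thesis by blast
qed

lemma is_jordan_matrixI:
  fixes J :: "'a::{zero,one} ^ 'n ^ 'n" and K :: "'k set"
  assumes K: "finite K" "\<And>\<kappa>. \<kappa> \<in> K \<Longrightarrow> 0 < k \<kappa>"
    and \<phi>: "bij_betw \<phi> UNIV (SIGMA \<kappa>:K. {..<k \<kappa>})"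
    and J: "\<And>x y. J $ x $ y = jordan_entry lam (\<phi> x) (\<phi> y)"
  shows "is_jordan_matrix J"
proof -
  obtain \<kappa>s where \<kappa>s: "set \<kappa>s = K" "distinct \<kappa>s"
    using finite_distinct_list [OF K(1)] by blast
  let ?P = "jordan_positions k \<kappa>s"
  have bP: "bij_betw ((!) ?P) {..<length ?P} (SIGMA \<kappa>:K. {..<k \<kappa>})"
    using bij_betw_nth [OF distinct_jordan_positions [OF \<kappa>s(2), of k]]
    by (simp add: set_jordan_positions \<kappa>s(1))
  have len: "length ?P = CARD('n)"
    using bij_betw_same_card [OF bP] bij_betw_same_card [OF \<phi>] by simp
  define e where "e = (\<lambda>i. inv_into UNIV \<phi> (?P ! i))"
  have e: "bij_betw e {..<CARD('n)} UNIV"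
    using bij_betw_trans [OF bP bij_betw_inv_into [OF \<phi>]] by (simp add: e_def o_def len)
  have \<phi>e: "\<phi> (e i) = ?P ! i" if "i < CARD('n)" for i
    unfolding e_def using bij_betwE [OF bP] that
    by (intro bij_betw_inv_into_right [OF \<phi>]) (auto simp: len)
  show ?thesis
    unfolding is_jordan_matrix_def
  proof (intro exI conjI allI impI)
    show "bij_betw e {..<CARD('n)} UNIV"
      by (rule e)
    show "0 \<notin> fst ` set (map (\<lambda>\<kappa>. (k \<kappa>, lam \<kappa>)) \<kappa>s)"
      using K(2) by (force simp: \<kappa>s(1))
    show "sum_list (map fst (map (\<lambda>\<kappa>. (k \<kappa>, lam \<kappa>)) \<kappa>s)) = CARD('n)"
      using len by (simp add: length_jordan_positions o_def)
    fix i j assume "i < CARD('n)" "j < CARD('n)"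
    then show "J $ e i $ e j = jordan_matrix (map (\<lambda>\<kappa>. (k \<kappa>, lam \<kappa>)) \<kappa>s) $$ (i, j)"
      using \<kappa>s(2) len
      by (simp add: J \<phi>e jordan_matrix_index length_jordan_positions)
  qed
qed

text \<open>
  As a real linear map of a finite-dimensional space, \<open>S\<close> is injective once it is surjective.
\<close>

lemma matrix_right_inverse_imp_invertible:
  fixes S :: "quat ^ 'n ^ 'n"
  assumes "S ** C = mat 1"
  shows "invertible S"
proof -
  have "surj (\<lambda>v. S *v v)"
    using assms by (intro surjI [of _ "\<lambda>v. C *v v"]) (simp add: matrix_vector_mul_assoc)
  then have inj: "inj (\<lambda>v. S *v v)"
    by (rule linear_surjective_imp_injective [OF linear_matrix_vector]) (rule refl)
  have "S *v (C *v (S *v v)) = S *v v" for v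
    using assms by (simp add: matrix_vector_mul_assoc matrix_mul_assoc)
  then have "C *v (S *v v) = v" for v
    using inj by (metis injD)
  then have "C ** S = mat 1"
    by (simp add: matrix_eq matrix_vector_mul_assoc)
  with assms show ?thesis
    by (auto simp: invertible_def)
qed

text \<open>
  The transforming matrix has the chain vectors as its columns: \<open>X\<close> sends the vector at place \<open>j\<close> of a
  chain for \<open>l\<close> to itself times \<open>l\<close> plus the vector at place \<open>j - 1\<close>, which is the column of a Jordan
  block.
\<close>

theorem jordan_form_exists:
  fixes X :: "quat ^ 'n ^ 'n"
  shows "\<exists>J. is_jordan_form X J"
proof -
  from jordan_chains_exist [of X]
  obtain E :: "complex set" and B :: "complex \<Rightarrow> (quat ^ 'n) set" and k u where
    finE: "finite E" and finB: "\<forall>l\<in>E. finite (B l)" and Im: "\<forall>l\<in>E. 0 \<le> Im l" and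
    chain: "\<forall>l\<in>E. \<forall>b\<in>B l. 0 < k l b \<and> shifted X l (u l b 0) = 0 \<and>
      (\<forall>j. Suc j < k l b \<longrightarrow> shifted X l (u l b (Suc j)) = u l b j)" and
    ind: "\<forall>c. (\<Sum>l\<in>E. \<Sum>b\<in>B l. \<Sum>j<k l b. u l b j \<triangleleft> c l b j) = 0 \<longrightarrow>
      (\<forall>l\<in>E. \<forall>b\<in>B l. \<forall>j<k l b. c l b j = 0)" and
    spn: "\<forall>v. \<exists>c. v = (\<Sum>l\<in>E. \<Sum>b\<in>B l. \<Sum>j<k l b. u l b j \<triangleleft> c l b j)"
    by (elim exE conjE) (rule that)
  have u0: "shifted X l (u l b 0) = 0"
    and uS: "Suc j < k l b \<Longrightarrow> shifted X l (u l b (Suc j)) = u l b j"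
    if "l \<in> E" "b \<in> B l" for l b j
    using chain that by auto
  define K where "K = (SIGMA l:E. B l)"
  define kk where "kk = (\<lambda>(l, b). k l b)"
  define g where "g = (\<lambda>((l, b), j). u l b j)"
  let ?I = "SIGMA \<kappa>:K. {..<kk \<kappa>}"
  have finK: "finite K"
    unfolding K_def using finE finB by (intro finite_SigmaI) auto
  have sum_I: "(\<Sum>i\<in>?I. g i \<triangleleft> c i) =
      (\<Sum>l\<in>E. \<Sum>b\<in>B l. \<Sum>j<k l b. u l b j \<triangleleft> c ((l, b), j))" for c
  proof -
    have "(\<Sum>i\<in>?I. g i \<triangleleft> c i) = (\<Sum>\<kappa>\<in>K. \<Sum>j<kk \<kappa>. g (\<kappa>, j) \<triangleleft> c (\<kappa>, j))"
      using finK by (subst sum.Sigma) auto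
    also have "\<dots> = (\<Sum>l\<in>E. \<Sum>b\<in>B l. \<Sum>j<kk (l, b). g ((l, b), j) \<triangleleft> c ((l, b), j))"
      unfolding K_def using finE finB by (subst sum.Sigma) auto
    finally show ?thesis
      by (simp add: g_def kk_def)
  qed
  have I_ind: "\<forall>i\<in>?I. c i = 0" if "(\<Sum>i\<in>?I. g i \<triangleleft> c i) = 0" for c
    using ind [rule_format, of "\<lambda>l b j. c ((l, b), j)"] that unfolding sum_I
    by (auto simp: K_def kk_def)
  have I_spn: "\<exists>c. v = (\<Sum>i\<in>?I. g i \<triangleleft> c i)" for v
  proof -
    obtain c where "v = (\<Sum>l\<in>E. \<Sum>b\<in>B l. \<Sum>j<k l b. u l b j \<triangleleft> c l b j)"
      using spn by blast
    then show ?thesis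
      by (intro exI [of _ "\<lambda>((l, b), j). c l b j"]) (simp add: sum_I)
  qed
  have finI: "finite ?I"
    using finK by simp
  have "card ?I = CARD('n)"
    by (rule right_basis_card [OF finI I_ind I_spn])
  then obtain \<phi> where \<phi>: "bij_betw \<phi> (UNIV :: 'n set) ?I"
    using finite_same_card_bij [OF finite finI] by metis
  define J :: "complex ^ 'n ^ 'n" where "J = (\<chi> x y. jordan_entry fst (\<phi> x) (\<phi> y))"
  have jm: "is_jordan_matrix J"
  proof (rule is_jordan_matrixI [OF finK _ \<phi>])
    show "0 < kk \<kappa>" if "\<kappa> \<in> K" for \<kappa>
      using chain that by (auto simp: K_def kk_def)
  qed (simp add: J_def)
  have \<phi>I: "\<phi> x \<in> ?I" for x
    using bij_betwE [OF \<phi>] by simp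
  have Im_J: "0 \<le> Im (J $ x $ x)" for x
    using \<phi>I [of x] Im by (auto simp: J_def jordan_entry_def K_def)
  define S :: "quat ^ 'n ^ 'n" where "S = (\<chi> r x. g (\<phi> x) $ r)"
  have col_S: "column x S = g (\<phi> x)" for x
    by (simp add: S_def column_def)
  have comb_S: "S *v y = (\<Sum>i\<in>?I. g i \<triangleleft> (y $ inv_into UNIV \<phi> i))" for y
  proof -
    have "S *v y = (\<Sum>x\<in>UNIV. g (\<phi> x) \<triangleleft> (y $ x))"
      by (simp add: matrix_vector_columns col_S)
    also have "\<dots> = (\<Sum>i\<in>?I. g i \<triangleleft> (y $ inv_into UNIV \<phi> i))"
      using sum.reindex_bij_betw [OF \<phi>, of "\<lambda>i. g i \<triangleleft> (y $ inv_into UNIV \<phi> i)"]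
        bij_betw_inv_into_left [OF \<phi>] by simp
    finally show ?thesis .
  qed
  have "\<exists>y. S *v y = v" for v
  proof -
    obtain c where c: "v = (\<Sum>i\<in>?I. g i \<triangleleft> c i)"
      using I_spn by blast
    have "S *v (\<chi> x. c (\<phi> x)) = v"
      unfolding comb_S c using bij_betw_inv_into_right [OF \<phi>] by (intro sum.cong) auto
    then show ?thesis by blast
  qed
  then obtain F where F: "\<And>v. S *v F v = v"
    by metis
  have "S ** (\<chi> r x. F (axis x 1) $ r) = mat 1"
    unfolding matrix_eq_columns column_matrix_mult
  proof
    fix x
    have "column x (\<chi> r x. F (axis x 1) $ r) = F (axis x 1)"
      by (simp add: column_def)
    then show "S *v column x (\<chi> r x. F (axis x 1) $ r) = column x (mat 1)"
      by (simp add: F column_eq_mult_axis)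
  qed
  then have inv: "invertible S"
    by (rule matrix_right_inverse_imp_invertible)
  let ?J = "(\<chi> x y. quat_of_complex (J $ x $ y)) :: quat ^ 'n ^ 'n"
  have "X ** S = S ** ?J"
    unfolding matrix_eq_columns column_matrix_mult
  proof
    fix y
    obtain l b j where y: "\<phi> y = ((l, b), j)" "l \<in> E" "b \<in> B l" "j < k l b"
      using \<phi>I [of y] by (auto simp: K_def kk_def)
    have X: "X *v u l b j = u l b j \<triangleleft> quat_of_complex l + (if j = 0 then 0 else u l b (j - 1))"
      using u0 [OF y(2,3)] uS [OF y(2,3), of "j - 1"] y(4)
      by (cases j) (auto simp: shifted_def algebra_simps)
    have "S *v column y ?J = (\<Sum>i\<in>?I. g i \<triangleleft> quat_of_complex (jordan_entry fst i (\<phi> y)))"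
      unfolding comb_S using bij_betw_inv_into_right [OF \<phi>]
      by (intro sum.cong refl) (simp add: column_def J_def)
    also have "\<dots> = (\<Sum>i\<in>?I. (if i = ((l, b), j) then u l b j \<triangleleft> quat_of_complex l else 0)
        + (if i = ((l, b), j - 1) \<and> j \<noteq> 0 then u l b (j - 1) else 0))"
      by (intro sum.cong refl) (auto simp: jordan_entry_def y(1) g_def)
    also have "\<dots> = u l b j \<triangleleft> quat_of_complex l + (if j = 0 then 0 else u l b (j - 1))"
      using finI y by (auto simp: sum.distrib sum.delta K_def kk_def)
    finally show "X *v column y S = S *v column y ?J"
      by (simp add: col_S y(1) g_def X)
  qed
  then have "matrix_inv S ** X ** S = ?J"
    using invertible_matrix_inv [OF inv] by (metis matrix_mul_assoc matrix_mul_lid)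
  with jm Im_J inv show ?thesis
    unfolding is_jordan_form_def by blast
qed

section \<open>Multiplicities of a standard eigenvalue\<close>

text \<open>
  All Jordan blocks of \<open>X\<close> for \<open>l\<close> have size one. Unlike the multiplicities, this form refers to no
  choice of a Jordan form.
\<close>

definition semisimple_at :: "quat ^ 'n ^ 'n \<Rightarrow> complex \<Rightarrow> bool" where
  "semisimple_at X l \<longleftrightarrow> (\<forall>w. shifted X l (shifted X l w) = 0 \<longrightarrow> shifted X l w = 0)"

lemma jordan_form_is_jordan_form: "is_jordan_form X (jordan_form X)"
  unfolding jordan_form_def using jordan_form_exists by (rule someI_ex)

lemma conjugate_eq_iff:
  fixes S X Y :: "'a::semiring_1 ^ 'n ^ 'n"
  assumes "invertible S"
  shows "matrix_inv S ** X ** S = Y \<longleftrightarrow> X ** S = S ** Y"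
  using invertible_matrix_inv [OF assms]
  by (metis matrix_mul_assoc matrix_mul_lid)

lemma jordan_row_sum:
  fixes lam :: "nat \<Rightarrow> 'a::semiring_1" and \<phi> :: "'n::finite \<Rightarrow> nat \<times> nat"
  assumes \<phi>: "bij_betw \<phi> UNIV (SIGMA b:{..<m}. {..<k b})" and x: "\<phi> x = (b, j)"
  shows "(\<Sum>x'\<in>UNIV. jordan_entry lam (\<phi> x) (\<phi> x') * y x') =
    lam b * y x + (if Suc j < k b then y (inv_into UNIV \<phi> (b, Suc j)) else 0)"
proof -
  have inj: "\<phi> x' = \<phi> x'' \<longleftrightarrow> x' = x''" for x' x''
    using \<phi> by (auto simp: bij_betw_def inj_eq)
  have bj: "b < m" "j < k b"
    using bij_betwE [OF \<phi>] x by (metis UNIV_I SigmaD1 SigmaD2 lessThan_iff)+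
  have suc: "\<phi> x' = (b, Suc j) \<longleftrightarrow> Suc j < k b \<and> x' = inv_into UNIV \<phi> (b, Suc j)" for x'
  proof
    assume *: "\<phi> x' = (b, Suc j)"
    then have "Suc j < k b"
      using bij_betwE [OF \<phi>] by (metis UNIV_I SigmaD2 lessThan_iff)
    moreover have "inv_into UNIV \<phi> (\<phi> x') = x'"
      using \<phi> by (simp add: bij_betw_def)
    ultimately show "Suc j < k b \<and> x' = inv_into UNIV \<phi> (b, Suc j)"
      using * by simp
  next
    assume "Suc j < k b \<and> x' = inv_into UNIV \<phi> (b, Suc j)"
    then show "\<phi> x' = (b, Suc j)"
      using bj bij_betw_inv_into_right [OF \<phi>, of "(b, Suc j)"] by simp
  qed
  have "jordan_entry lam (\<phi> x) (\<phi> x') * y x' =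
      (if x' = x then lam b * y x else 0) +
      (if x' = inv_into UNIV \<phi> (b, Suc j) then if Suc j < k b then y x' else 0 else 0)" for x'
  proof (cases "\<phi> x' = (b, Suc j)")
    case True
    then have "x' \<noteq> x"
      using x by auto
    then show ?thesis
      using True suc [of x'] x inj [of x x'] by (auto simp: jordan_entry_def)
  next
    case False
    then show ?thesis
      using suc [of x'] x inj [of x x'] by (cases "\<phi> x'") (auto simp: jordan_entry_def)
  qed
  then show ?thesis
    by (simp add: sum.distrib sum.delta)
qed

text \<open>
  Two complex numbers are conjugate in the quaternions only if they are equal or complex conjugates of
  each other; the latter is excluded for different numbers in the closed upper half plane.
\<close>

lemma complex_quat_commute_imp_0:
  assumes "quat_of_complex a * z = z * quat_of_complex l" "0 \<le> Im a" "0 \<le> Im l" "a \<noteq> l"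
  shows "z = 0"
proof -
  have key: "x = 0 \<and> y = 0"
    if xy: "d * x = g * y" "d * y = - (g * x)" and nz: "d \<noteq> 0 \<or> g \<noteq> 0" for d g x y :: real
  proof -
    have "(d\<^sup>2 + g\<^sup>2) * x = d * (d * x) + g * (g * x)"
      by (simp add: algebra_simps power2_eq_square)
    also have "\<dots> = g * (d * y + g * x)"
      unfolding xy(1) by (simp add: algebra_simps)
    finally have x: "(d\<^sup>2 + g\<^sup>2) * x = 0"
      by (simp add: xy(2))
    have "(d\<^sup>2 + g\<^sup>2) * y = d * (d * y) + g * (g * y)"
      by (simp add: algebra_simps power2_eq_square)
    also have "\<dots> = g * (d * x) - d * (g * x)"
      unfolding xy(2) xy(1) [symmetric] by (simp add: algebra_simps)
    finally have "(d\<^sup>2 + g\<^sup>2) * y = 0"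
      by simp
    with x nz show ?thesis
      by (auto simp: sum_power2_eq_zero_iff)
  qed
  have "quat_re z = 0 \<and> quat_i z = 0"
    using assms by (intro key [of "Re a - Re l" _ "Im a - Im l"])
      (auto simp: quat_eq_iff complex_eq_iff algebra_simps)
  moreover have "quat_j z = 0 \<and> quat_k z = 0"
    using assms by (intro key [of "Re a - Re l" _ "Im a + Im l"])
      (auto simp: quat_eq_iff complex_eq_iff algebra_simps)
  ultimately show ?thesis
    by (simp add: quat_eq_iff)
qed

text \<open>
  Commutators with \<open>l\<close> have only \<open>\<j>\<close>- and \<open>\<k>\<close>-components, and such a quaternion commutes with a non-real
  \<open>l\<close> only if it is zero. So a Jordan block of size one contributes nothing to the kernel of the square
  that is not in the kernel, although the commutator map itself need not vanish.
\<close>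

lemma complex_quat_commutator_square:
  assumes "w = quat_of_complex l * y - y * quat_of_complex l"
    "quat_of_complex l * w = w * quat_of_complex l"
  shows "w = 0"
  using assms by (cases "Im l = 0") (auto simp: quat_eq_iff algebra_simps)

text \<open>
  In the coordinates of a Jordan form everything can be read off block by block. The kernel of
  \<open>J - l\<close> is spanned by the first unit vectors of the blocks for \<open>l\<close>, so both multiplicities agree if and
  only if these blocks have size one (\<open>flat\<close> in the proof). In a longer block for \<open>l\<close> the second unit
  vector violates semisimplicity. If all blocks for \<open>l\<close> have size one, then semisimplicity holds on them
  by the preceding lemma, and on the other blocks the kernel is zero, as is seen from the last
  coordinate of the block upwards.
\<close>

lemma algebraic_eq_geometric_iff_semisimple:
  fixes X :: "quat ^ 'n ^ 'n"
  assumes l: "0 \<le> Im l"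
  shows "algebraic_multiplicity X l = geometric_multiplicity X l \<longleftrightarrow> semisimple_at X l"
proof -
  define J where "J = jordan_form X"
  let ?J = "(\<chi> x y. quat_of_complex (J $ x $ y)) :: quat ^ 'n ^ 'n"
  obtain S where S: "invertible S" "X ** S = S ** ?J"
    and ImJ: "\<And>x. 0 \<le> Im (J $ x $ x)" and "is_jordan_matrix J"
    using jordan_form_is_jordan_form [of X] unfolding is_jordan_form_def J_def
    by (metis conjugate_eq_iff)
  then obtain m :: nat and k lam \<phi> where \<phi>: "bij_betw \<phi> UNIV (SIGMA b:{..<m}. {..<k b})"
    and J: "\<And>x y. J $ x $ y = jordan_entry lam (\<phi> x) (\<phi> y)"
    using jordan_matrix_coordinates by metis
  define pos where "pos b j = inv_into UNIV \<phi> (b, j)" for b j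
  have \<phi>_pos: "\<phi> (pos b j) = (b, j)" if "b < m" "j < k b" for b j
    unfolding pos_def using that by (intro bij_betw_inv_into_right [OF \<phi>]) simp
  have pos_\<phi>: "pos b j = x" if "\<phi> x = (b, j)" for x b j
    unfolding pos_def that [symmetric] using \<phi> by (simp add: bij_betw_def)
  have rng: "b < m" "j < k b" if "\<phi> x = (b, j)" for x b j
    using bij_betwE [OF \<phi>] that by (metis UNIV_I SigmaD1 SigmaD2 lessThan_iff)+
  have diag: "J $ x $ x = lam (fst (\<phi> x))" for x
    by (simp add: J jordan_entry_def)
  have Im_lam: "0 \<le> Im (lam b)" if "\<phi> x = (b, j)" for x b j
    using ImJ [of x] by (simp add: diag that)
  define flat where "flat \<longleftrightarrow> (\<forall>x. lam (fst (\<phi> x)) = l \<longrightarrow> snd (\<phi> x) = 0)"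

  have row: "((J - mat l) *v y) $ x =
      (lam b - l) * y $ x + (if Suc j < k b then y $ pos b (Suc j) else 0)"
    if "\<phi> x = (b, j)" for x b j and y :: "complex ^ 'n"
  proof -
    have "((J - mat l) *v y) $ x = (J *v y) $ x - l * y $ x"
      by (simp add: matrix_vector_mult_def mat_def left_diff_distrib sum_subtractf
          if_distrib [of "\<lambda>a. a * _"] cong: if_cong)
    also have "(J *v y) $ x = (\<Sum>x'\<in>UNIV. jordan_entry lam (\<phi> x) (\<phi> x') * y $ x')"
      by (simp add: matrix_vector_mult_def J)
    finally show ?thesis
      unfolding jordan_row_sum [OF \<phi> that] by (simp add: pos_def algebra_simps)
  qed
  let ?d = "{x. lam (fst (\<phi> x)) = l \<and> snd (\<phi> x) = 0}"
  have "{y. (J - mat l) *v y = 0} = {y. \<forall>x. x \<notin> ?d \<longrightarrow> y $ x = 0}"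
  proof (intro equalityI subsetI CollectI allI impI)
    fix y :: "complex ^ 'n" and x
    assume "y \<in> {y. (J - mat l) *v y = 0}" and x: "x \<notin> ?d"
    then have y: "(J - mat l) *v y = 0"
      by blast
    obtain b j where bj: "\<phi> x = (b, j)"
      by (cases "\<phi> x")
    note r = rng [OF bj]
    have row0: "(lam b - l) * y $ pos b i + (if Suc i < k b then y $ pos b (Suc i) else 0) = 0"
      if "i < k b" for i
      using row [OF \<phi>_pos [OF r(1) that], of y] y by simp
    show "y $ x = 0"
    proof (cases "lam b = l")
      case True
      then obtain i where "j = Suc i"
        using x bj by (cases j) auto
      then show ?thesis
        using row0 [of i] True r pos_\<phi> [OF bj] by simp
    next
      case False
      have "y $ pos b (k b - Suc i) = 0" if "i < k b" for i
        using that
      proof (induction i)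
        case 0
        then show ?case
          using row0 [of "k b - 1"] False by simp
      next
        case (Suc i)
        then show ?case
          using row0 [of "k b - Suc (Suc i)"] False by (simp add: Suc_diff_Suc)
      qed
      from this [of "k b - Suc j"] show ?thesis
        using r pos_\<phi> [OF bj] by simp
    qed
  next
    fix y :: "complex ^ 'n"
    assume "y \<in> {y. \<forall>x. x \<notin> ?d \<longrightarrow> y $ x = 0}"
    then have y: "\<forall>x. x \<notin> ?d \<longrightarrow> y $ x = 0"
      by blast
    show "(J - mat l) *v y = 0"
    proof (rule vec_eq_iff [THEN iffD2], rule)
      fix x
      obtain b j where bj: "\<phi> x = (b, j)"
        by (cases "\<phi> x")
      have "y $ pos b (Suc j) = 0" if "Suc j < k b"
        using y \<phi>_pos [OF rng(1) [OF bj] that] by auto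
      moreover have "(lam b - l) * y $ x = 0"
        using y bj by (cases "lam b = l") auto
      ultimately show "((J - mat l) *v y) $ x = 0 $ x"
        by (simp add: row [OF bj])
    qed
  qed
  then have geo: "geometric_multiplicity X l = card ?d"
    unfolding geometric_multiplicity_def J_def [symmetric] by (simp only: dim_substandard_cart)
  have alg: "algebraic_multiplicity X l = card {x. lam (fst (\<phi> x)) = l}"
    unfolding algebraic_multiplicity_def J_def [symmetric] by (simp add: diag)
  have 1: "algebraic_multiplicity X l = geometric_multiplicity X l \<longleftrightarrow> flat"
  proof
    assume "algebraic_multiplicity X l = geometric_multiplicity X l"
    then have "?d = {x. lam (fst (\<phi> x)) = l}"
      unfolding alg geo by (intro card_subset_eq) auto
    then show flat
      by (auto simp: flat_def)
  next
    assume flat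
    then have "?d = {x. lam (fst (\<phi> x)) = l}"
      by (auto simp: flat_def)
    then show "algebraic_multiplicity X l = geometric_multiplicity X l"
      by (simp add: alg geo)
  qed

  have shifted_S: "shifted X l (S *v y) = S *v shifted ?J l y" for y
    using S(2) by (simp add: shifted_def matrix_vector_mul_assoc matrix_vector_rscale
        matrix_vector_mult_diff_distrib)
  have S_0: "S *v y = 0 \<longleftrightarrow> y = 0" for y
    using invertible_matrix_inv(2) [OF S(1)]
    by (metis matrix_vector_mul_assoc matrix_vector_mul_lid matrix_vector_mult_0_right)
  have S_surj: "\<exists>y. w = S *v y" for w
    using invertible_matrix_inv(1) [OF S(1)]
    by (metis matrix_vector_mul_assoc matrix_vector_mul_lid)
  have 2: "semisimple_at X l \<longleftrightarrow> semisimple_at ?J l"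
    unfolding semisimple_at_def using S_surj by (metis shifted_S S_0)

  have qrow: "shifted ?J l y $ x =
      quat_of_complex (lam b) * y $ x - y $ x * quat_of_complex l
        + (if Suc j < k b then y $ pos b (Suc j) else 0)"
    if "\<phi> x = (b, j)" for x b j and y :: "quat ^ 'n"
  proof -
    have "(?J *v y) $ x =
        (\<Sum>x'\<in>UNIV. jordan_entry (\<lambda>b. quat_of_complex (lam b)) (\<phi> x) (\<phi> x') * y $ x')"
      unfolding matrix_vector_mult_def by (auto simp: J jordan_entry_def intro!: sum.cong)
    then show ?thesis
      unfolding jordan_row_sum [OF \<phi> that] by (simp add: shifted_def pos_def)
  qed
  have 3: "semisimple_at ?J l \<longleftrightarrow> flat"
  proof
    assume ss: "semisimple_at ?J l"
    show flat
      unfolding flat_def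
    proof (intro allI impI, rule ccontr)
      fix x assume x: "lam (fst (\<phi> x)) = l" "snd (\<phi> x) \<noteq> 0"
      obtain b j where bj: "\<phi> x = (b, j)"
        by (cases "\<phi> x")
      then have b: "b < m" "1 < k b" "lam b = l"
        using x rng [OF bj] by auto
      \<comment> \<open>the unit vectors of the block of \<open>x\<close>\<close>
      define y :: "nat \<Rightarrow> quat ^ 'n" where "y i = (\<chi> x. if \<phi> x = (b, i) then 1 else 0)" for i
      have y1: "shifted ?J l (y (Suc 0)) = y 0"
      proof (rule vec_eq_iff [THEN iffD2], rule)
        fix x'
        obtain b' j' where bj': "\<phi> x' = (b', j')"
          by (cases "\<phi> x'")
        show "shifted ?J l (y (Suc 0)) $ x' = y 0 $ x'"
          unfolding qrow [OF bj'] using bj' b \<phi>_pos [OF rng(1) [OF bj'], of "Suc j'"]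
          by (auto simp: y_def)
      qed
      have y0: "shifted ?J l (y 0) = 0"
      proof (rule vec_eq_iff [THEN iffD2], rule)
        fix x'
        obtain b' j' where bj': "\<phi> x' = (b', j')"
          by (cases "\<phi> x'")
        show "shifted ?J l (y 0) $ x' = 0 $ x'"
          unfolding qrow [OF bj'] using bj' b \<phi>_pos [OF rng(1) [OF bj'], of "Suc j'"]
          by (auto simp: y_def)
      qed
      have "y 0 = 0"
        using ss y0 y1 unfolding semisimple_at_def by metis
      then have "y 0 $ pos b 0 = 0"
        by simp
      then show False
        using \<phi>_pos [of b 0] b by (simp add: y_def)
    qed
  next
    assume flat
    show "semisimple_at ?J l"
      unfolding semisimple_at_def
    proof (intro allI impI)
      fix y :: "quat ^ 'n"
      define w where "w = shifted ?J l y"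
      assume "shifted ?J l (shifted ?J l y) = 0"
      then have w: "shifted ?J l w = 0"
        by (simp add: w_def)
      have "w $ x = 0" for x
      proof -
        obtain b j where bj: "\<phi> x = (b, j)"
          by (cases "\<phi> x")
        note r = rng [OF bj]
        have row0: "quat_of_complex (lam b) * w $ pos b i - w $ pos b i * quat_of_complex l
            + (if Suc i < k b then w $ pos b (Suc i) else 0) = 0" if "i < k b" for i
          using qrow [OF \<phi>_pos [OF r(1) that], of w] w by simp
        show "w $ x = 0"
        proof (cases "lam b = l")
          case True
          have no: "\<not> Suc 0 < k b"
          proof
            assume "Suc 0 < k b"
            from \<phi>_pos [OF r(1) this] show False
              using \<open>flat\<close> True by (metis flat_def fst_conv snd_conv nat.distinct(1))
          qed
          have j: "j = 0"
            using no r(2) by simp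
          have "w $ x = quat_of_complex l * y $ x - y $ x * quat_of_complex l"
            unfolding w_def qrow [OF bj] using True no j by simp
          moreover have "quat_of_complex l * w $ x = w $ x * quat_of_complex l"
            using row0 [OF r(2)] pos_\<phi> [OF bj] True no j by simp
          ultimately show ?thesis
            by (rule complex_quat_commutator_square)
        next
          case False
          have scalar: "w $ pos b i = 0"
            if "quat_of_complex (lam b) * w $ pos b i - w $ pos b i * quat_of_complex l = 0" for i
            using that by (intro complex_quat_commute_imp_0 [OF _ Im_lam [OF bj] l False]) simp
          have "w $ pos b (k b - Suc i) = 0" if "i < k b" for i
            using that
          proof (induction i)
            case 0
            then show ?case
              using row0 [of "k b - 1"] by (intro scalar) simp
          next
            case (Suc i)
            then show ?case
              using row0 [of "k b - Suc (Suc i)"] by (intro scalar) (simp add: Suc_diff_Suc)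
          qed
          from this [of "k b - Suc j"] show ?thesis
            using r pos_\<phi> [OF bj] by simp
        qed
      qed
      then show "shifted ?J l y = 0"
        by (simp add: vec_eq_iff w_def)
    qed
  qed
  show ?thesis
    using 1 2 3 by simp
qed

lemma shifted_similar:
  assumes "C ** K = K ** C'"
  shows "shifted C l (K *v v) = K *v shifted C' l v"
  using assms by (simp add: shifted_def matrix_vector_mul_assoc matrix_vector_rscale
      matrix_vector_mult_diff_distrib)

lemma invertible_mult_0:
  assumes "invertible K"
  shows "K *v v = 0 \<longleftrightarrow> v = 0"
  using invertible_matrix_inv(2) [OF assms]
  by (metis matrix_vector_mul_assoc matrix_vector_mul_lid matrix_vector_mult_0_right)

lemma similar_swap:
  fixes C K C' :: "'a::semiring_1 ^ 'n ^ 'n"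
  assumes "invertible K" "C ** K = K ** C'"
  shows "C' ** matrix_inv K = matrix_inv K ** C"
  using assms(2) invertible_matrix_inv [OF assms(1)]
  by (metis matrix_mul_assoc matrix_mul_lid matrix_mul_rid)

lemma invertible_matrix_inv_invertible:
  fixes K :: "'a::semiring_1 ^ 'n ^ 'n"
  assumes "invertible K"
  shows "invertible (matrix_inv K)"
  using invertible_matrix_inv [OF assms] unfolding invertible_def by blast

lemma invertible_mult_matrix:
  fixes K L :: "'a::semiring_1 ^ 'n ^ 'n"
  assumes "invertible K" "invertible L"
  shows "invertible (K ** L)"
  unfolding invertible_def
proof (intro exI conjI)
  have "K ** L ** (matrix_inv L ** matrix_inv K) = K ** (L ** matrix_inv L) ** matrix_inv K"
    by (simp only: matrix_mul_assoc)
  then show "K ** L ** (matrix_inv L ** matrix_inv K) = mat 1"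
    by (simp add: invertible_matrix_inv assms)
  have "matrix_inv L ** matrix_inv K ** (K ** L) = matrix_inv L ** (matrix_inv K ** K) ** L"
    by (simp only: matrix_mul_assoc)
  then show "matrix_inv L ** matrix_inv K ** (K ** L) = mat 1"
    by (simp add: invertible_matrix_inv assms)
qed

lemma is_jordan_form_similar:
  assumes K: "invertible K" "C ** K = K ** C'" and J: "is_jordan_form C' J"
  shows "is_jordan_form C J"
proof -
  let ?J = "\<chi> i j. quat_of_complex (J $ i $ j)"
  obtain S where S: "invertible S" "matrix_inv S ** C' ** S = ?J"
    using J by (auto simp: is_jordan_form_def)
  have KS: "invertible (K ** S)"
    by (rule invertible_mult_matrix [OF K(1) S(1)])
  have "C' ** S = S ** ?J"
    using S by (simp add: conjugate_eq_iff)
  then have "C ** (K ** S) = K ** S ** ?J"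
    using K(2) by (metis matrix_mul_assoc)
  then have "matrix_inv (K ** S) ** C ** (K ** S) = ?J"
    by (simp add: conjugate_eq_iff [OF KS])
  with KS J show ?thesis
    unfolding is_jordan_form_def by blast
qed

text \<open>
  Similar matrices have the same Jordan forms, hence the same one is chosen for both.
\<close>

lemma jordan_form_similar:
  assumes "invertible K" "C ** K = K ** C'"
  shows "jordan_form C = jordan_form C'"
proof -
  have "is_jordan_form C J \<longleftrightarrow> is_jordan_form C' J" for J
    using is_jordan_form_similar [OF assms] is_jordan_form_similar
      [OF invertible_matrix_inv_invertible [OF assms(1)] similar_swap [OF assms]] by blast
  then show ?thesis
    by (simp add: jordan_form_def)
qed

lemma standard_eigenvalues_similar:
  fixes C K C' :: "quat ^ 'n ^ 'n"
  assumes "invertible K" "C ** K = K ** C'"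
  shows "standard_eigenvalues C = standard_eigenvalues C'"
proof -
  have sub: "standard_eigenvalues Y \<subseteq> standard_eigenvalues X"
    if "invertible K" "X ** K = K ** Y" for X Y K :: "quat ^ 'n ^ 'n"
    unfolding standard_eigenvalues_def right_eigenvalue_shifted
    using that shifted_similar [OF that(2)] invertible_mult_0 [OF that(1)]
    by (auto simp: matrix_vector_mult_0_right) metis
  show ?thesis
    using sub [OF assms] sub [OF invertible_matrix_inv_invertible [OF assms(1)] similar_swap [OF assms]]
    by blast
qed

lemma eigenvector_cnj:
  "(\<exists>v. v \<noteq> 0 \<and> shifted X (cnj l) v = 0) \<longleftrightarrow> (\<exists>v. v \<noteq> 0 \<and> shifted X l v = 0)"
proof -
  have "\<exists>v. v \<noteq> 0 \<and> shifted X (cnj l) v = 0" if "v \<noteq> 0" "shifted X l v = 0" for v l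
    using that by (intro exI [of _ "v \<triangleleft> quat_jj"]) (simp add: shifted_cnj)
  from this [where l = l] this [where l = "cnj l"] show ?thesis
    by auto
qed

lemma semisimple_at_cnj: "semisimple_at X (cnj l) \<longleftrightarrow> semisimple_at X l"
proof -
  have "semisimple_at X l" if ss: "semisimple_at X (cnj l)" for l
    unfolding semisimple_at_def
  proof (intro allI impI)
    fix w assume "shifted X l (shifted X l w) = 0"
    then have "shifted X (cnj l) (shifted X (cnj l) (w \<triangleleft> quat_jj)) = 0"
      by (simp add: shifted_cnj)
    then have "shifted X (cnj l) (w \<triangleleft> quat_jj) = 0"
      using ss unfolding semisimple_at_def by blast
    then show "shifted X l w = 0"
      by (simp add: shifted_cnj)
  qed
  from this [of l] this [of "cnj l"] show ?thesis
    by auto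
qed

text \<open>Up to conjugation every complex right eigenvalue is a standard eigenvalue.\<close>

lemma standard_eigenvalue_of_eigenvector:
  assumes "v \<noteq> 0" "shifted X l v = 0"
  shows "\<exists>l'\<in>standard_eigenvalues X. Re l' = Re l \<and> cmod l' = cmod l \<and>
    (semisimple_at X l' \<longleftrightarrow> semisimple_at X l)"
proof (cases "0 \<le> Im l")
  case True
  then show ?thesis
    using assms by (auto simp: standard_eigenvalues_def right_eigenvalue_shifted)
next
  case False
  then have "cnj l \<in> standard_eigenvalues X"
    using assms eigenvector_cnj [of X l]
    by (auto simp: standard_eigenvalues_def right_eigenvalue_shifted)
  then show ?thesis
    by (intro bexI [of _ "cnj l"]) (simp_all add: semisimple_at_cnj)
qed

section \<open>Solutions of the periodic system\<close>

lemma fundamental_matrix_solution: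
  assumes "fundamental_matrix A M"
  shows "is_solution A (\<lambda>t. M t *v c)"
  unfolding is_solution_def
proof
  fix t
  have "(M has_vector_derivative A t ** M t) (at t)"
    using assms by (simp add: fundamental_matrix_def)
  from has_vector_derivative_matrix_vector [OF this has_vector_derivative_const [of c]]
  show "((\<lambda>t. M t *v c) has_vector_derivative A t *v (M t *v c)) (at t)"
    by (simp add: matrix_vector_mul_assoc)
qed

lemma fundamental_matrix_invertible: "fundamental_matrix A M \<Longrightarrow> invertible (M t)"
  by (simp add: fundamental_matrix_def)

lemma matrix_inv_cancel:
  fixes X :: "quat ^ 'n ^ 'n"
  assumes "invertible X"
  shows "X *v (matrix_inv X *v v) = v" "matrix_inv X *v (X *v v) = v"
  by (simp_all add: matrix_vector_mul_assoc invertible_matrix_inv [OF assms])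

lemma solution_by_fundamental_matrix:
  assumes "continuous_on UNIV A" "fundamental_matrix A M" "is_solution A \<psi>"
  shows "\<psi> t = M t *v (matrix_inv (M t0) *v \<psi> t0)"
  by (rule linear_ode_unique [OF assms(1,3) fundamental_matrix_solution [OF assms(2)], of t0])
    (simp add: matrix_inv_cancel fundamental_matrix_invertible [OF assms(2)])

lemma monodromy_similar:
  fixes A M M' :: "real \<Rightarrow> quat ^ 'n ^ 'n"
  assumes A: "continuous_on UNIV A" and M: "fundamental_matrix A M" and M': "fundamental_matrix A M'"
  defines "K \<equiv> matrix_inv (M 0) ** M' 0"
  shows "invertible K"
    "(matrix_inv (M 0) ** M T) ** K = K ** (matrix_inv (M' 0) ** M' T)"
proof -
  note inv = fundamental_matrix_invertible [OF M] fundamental_matrix_invertible [OF M']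
  show "invertible K"
    unfolding K_def by (intro invertible_mult_matrix invertible_matrix_inv_invertible inv)
  have "M' T *v c = M T *v (K *v c)" for c
    using solution_by_fundamental_matrix [OF A M fundamental_matrix_solution [OF M'], where ?t0.0 = 0]
    by (simp add: K_def matrix_vector_mul_assoc)
  then have "M' T = M T ** K"
    by (simp add: matrix_eq matrix_vector_mul_assoc)
  moreover have "K ** (matrix_inv (M' 0) ** M' T)
      = matrix_inv (M 0) ** (M' 0 ** matrix_inv (M' 0)) ** M' T"
    by (simp only: K_def matrix_mul_assoc)
  ultimately show "(matrix_inv (M 0) ** M T) ** K = K ** (matrix_inv (M' 0) ** M' T)"
    by (simp add: invertible_matrix_inv inv matrix_mul_assoc)
qed

text \<open>
  Any fundamental matrix is \<open>M(t) K\<close> with a constant \<open>K\<close>, so its monodromy matrix is \<open>K\<^sup>-\<^sup>1 C K\<close>.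
\<close>

lemma characteristic_multipliers_eq:
  fixes A M :: "real \<Rightarrow> quat ^ 'n ^ 'n" and T :: real
  assumes A: "continuous_on UNIV A" and M: "fundamental_matrix A M"
  defines "C \<equiv> matrix_inv (M 0) ** M T"
  shows "characteristic_multipliers A T = standard_eigenvalues C"
    "multiplier_algebraic_multiplicity A T \<mu> = algebraic_multiplicity C \<mu>"
    "multiplier_geometric_multiplicity A T \<mu> = geometric_multiplicity C \<mu>"
proof -
  have C: "monodromy_matrix A T C"
    using M by (auto simp: monodromy_matrix_def C_def)
  have eq: "standard_eigenvalues C' = standard_eigenvalues C \<and> jordan_form C' = jordan_form C"
    if C': "monodromy_matrix A T C'" for C'
  proof -
    obtain M' where M': "fundamental_matrix A M'" "C' = matrix_inv (M' 0) ** M' T"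
      using C' by (auto simp: monodromy_matrix_def)
    note sim = monodromy_similar [OF A M M'(1)]
    show ?thesis
      unfolding M'(2) C_def
      using standard_eigenvalues_similar [OF sim] jordan_form_similar [OF sim] by simp
  qed
  show "characteristic_multipliers A T = standard_eigenvalues C"
  proof (intro equalityI subsetI)
    fix \<mu> assume "\<mu> \<in> characteristic_multipliers A T"
    then obtain C' where "monodromy_matrix A T C'" "\<mu> \<in> standard_eigenvalues C'"
      by (auto simp: characteristic_multipliers_def)
    then show "\<mu> \<in> standard_eigenvalues C"
      by (simp only: eq)
  next
    fix \<mu> assume "\<mu> \<in> standard_eigenvalues C"
    then show "\<mu> \<in> characteristic_multipliers A T"
      unfolding characteristic_multipliers_def using C by (intro CollectI exI conjI)
  qed
  have common: "(THE m. \<forall>C'. monodromy_matrix A T C' \<longrightarrow> f C' = m) = f C"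
    if "\<And>C'. monodromy_matrix A T C' \<Longrightarrow> f C' = f C" for f :: "quat ^ 'n ^ 'n \<Rightarrow> nat"
    by (rule the_equality) (use that C in blast)+
  show "multiplier_algebraic_multiplicity A T \<mu> = algebraic_multiplicity C \<mu>"
    unfolding multiplier_algebraic_multiplicity_def
    by (rule common) (simp add: algebraic_multiplicity_def eq)
  show "multiplier_geometric_multiplicity A T \<mu> = geometric_multiplicity C \<mu>"
    unfolding multiplier_geometric_multiplicity_def
    by (rule common) (simp add: geometric_multiplicity_def eq)
qed

text \<open>
  By periodicity of \<open>A\<close> the shifted fundamental matrix \<open>M(t + T)\<close> is again a solution, so it equals
  \<open>M(t) C\<close>.
\<close>

lemma fundamental_matrix_periods:
  fixes A M :: "real \<Rightarrow> quat ^ 'n ^ 'n" and T :: real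
  assumes A: "continuous_on UNIV A" and per: "\<And>t. A (t + T) = A t" and M: "fundamental_matrix A M"
  defines "C \<equiv> matrix_inv (M 0) ** M T"
  shows "M (real k * T) *v c = M 0 *v (((\<lambda>v. C *v v) ^^ k) c)"
proof -
  have step: "M (t + T) *v c = M t *v (C *v c)" for t c
  proof (rule linear_ode_unique [OF A _ fundamental_matrix_solution [OF M], of _ 0])
    show "is_solution A (\<lambda>t. M (t + T) *v c)"
      using is_solution_shift [OF fundamental_matrix_solution [OF M], of T c] by (simp add: per)
    show "M (0 + T) *v c = M 0 *v (C *v c)"
      using matrix_inv_cancel(1) [OF fundamental_matrix_invertible [OF M], of 0 "M T *v c"]
      by (simp add: C_def matrix_vector_mul_assoc)
  qed
  show ?thesis
  proof (induction k arbitrary: c)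
    case (Suc k)
    have "M (real (Suc k) * T) *v c = M (real k * T) *v (C *v c)"
      using step [of "real k * T" c] by (simp add: algebra_simps)
    then show ?case
      by (simp only: Suc.IH) (simp add: funpow_Suc_right del: funpow.simps)
  qed simp
qed

section \<open>Necessary conditions on the multipliers\<close>

text \<open>
  Stability constrains only solutions with small initial values, but by linearity every solution is
  a multiple of such a one.
\<close>

lemma norm_sum_small_multiple:
  fixes v :: "quat ^ 'n"
  assumes "\<delta> > 0"
  shows "\<exists>r>0. norm_sum (r *\<^sub>R v) < \<delta>"
proof -
  define n where "n = real CARD('n) * norm v + 1"
  have "n > 0"
    by (simp add: n_def add_nonneg_pos)
  define r where "r = \<delta> / (2 * n)"
  have "r > 0"
    using assms \<open>n > 0\<close> by (simp add: r_def)
  have "norm_sum (r *\<^sub>R v) \<le> r * (real CARD('n) * norm v)"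
    using norm_sum_le_norm [of "r *\<^sub>R v"] \<open>r > 0\<close> by (simp add: mult_ac)
  also have "\<dots> \<le> r * n"
    using \<open>r > 0\<close> by (intro mult_left_mono) (simp_all add: n_def)
  also have "\<dots> < \<delta>"
    using assms \<open>n > 0\<close> by (simp add: r_def)
  finally show ?thesis
    using \<open>r > 0\<close> by blast
qed

lemma stable_orbits_bounded:
  fixes A M :: "real \<Rightarrow> quat ^ 'n ^ 'n"
  assumes "stable_system A t0" and M: "fundamental_matrix A M"
  shows "\<exists>b. \<forall>t\<ge>t0. norm (M t *v c) \<le> b"
proof -
  have "\<forall>\<epsilon>>0. \<exists>\<delta>>0. \<forall>\<psi>. is_solution A \<psi> \<and> norm_sum (\<psi> t0) < \<delta> \<longrightarrow>
      (\<forall>t\<ge>t0. norm_sum (\<psi> t) < \<epsilon>)"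
    using assms(1) by (simp add: stable_system_def stable_solution_def)
  from this [rule_format, of 1] obtain \<delta> where \<delta>: "\<delta> > 0"
    "\<And>\<psi> t. is_solution A \<psi> \<Longrightarrow> norm_sum (\<psi> t0) < \<delta> \<Longrightarrow> t0 \<le> t \<Longrightarrow> norm_sum (\<psi> t) < 1"
    by auto
  obtain r where "r > 0" and small: "norm_sum (M t0 *v (r *\<^sub>R c)) < \<delta>"
    using norm_sum_small_multiple [OF \<delta>(1), of "M t0 *v c"] by (auto simp: matrix_vector_scaleR)
  have "norm (M t *v c) \<le> 1 / r" if "t0 \<le> t" for t
  proof -
    have "norm (M t *v (r *\<^sub>R c)) \<le> norm_sum (M t *v (r *\<^sub>R c))"
      by (rule norm_le_norm_sum)
    also have "\<dots> < 1"
      using \<delta>(2) [OF fundamental_matrix_solution [OF M] small that] .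
    finally show ?thesis
      using \<open>r > 0\<close> by (simp add: matrix_vector_scaleR field_simps)
  qed
  then show ?thesis by blast
qed

lemma asymptotically_stable_orbits_tendsto:
  fixes A M :: "real \<Rightarrow> quat ^ 'n ^ 'n"
  assumes "asymptotically_stable_system A t0" and M: "fundamental_matrix A M"
  shows "((\<lambda>t. M t *v c) \<longlongrightarrow> 0) at_top"
proof -
  obtain \<delta> where \<delta>: "\<delta> > 0" "\<And>\<psi>. is_solution A \<psi> \<Longrightarrow> norm_sum (\<psi> t0) < \<delta> \<Longrightarrow>
      ((\<lambda>t. norm_sum (\<psi> t)) \<longlongrightarrow> 0) at_top"
    using assms(1)
    by (auto simp: asymptotically_stable_system_def asymptotically_stable_solution_def)
  obtain r where "r > 0" and small: "norm_sum (M t0 *v (r *\<^sub>R c)) < \<delta>"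
    using norm_sum_small_multiple [OF \<delta>(1), of "M t0 *v c"] by (auto simp: matrix_vector_scaleR)
  have "((\<lambda>t. norm_sum (M t *v (r *\<^sub>R c))) \<longlongrightarrow> 0) at_top"
    using \<delta>(2) [OF fundamental_matrix_solution [OF M] small] .
  then have "((\<lambda>t. M t *v (r *\<^sub>R c)) \<longlongrightarrow> 0) at_top"
    by (rule Lim_null_comparison [OF always_eventually, rotated]) (simp add: norm_le_norm_sum)
  then have "((\<lambda>t. inverse r *\<^sub>R (M t *v (r *\<^sub>R c))) \<longlongrightarrow> inverse r *\<^sub>R 0) at_top"
    by (intro tendsto_intros)
  then show ?thesis
    using \<open>r > 0\<close> by (simp add: matrix_vector_scaleR)
qed

lemma iterate_eigenvector:
  assumes "shifted C l v = 0"
  shows "((\<lambda>v. C *v v) ^^ k) v = v \<triangleleft> quat_of_complex (l ^ k)"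
  using assms
  by (induction k) (simp_all add: shifted_eq_0 matrix_vector_rscale rscale_rscale
      quat_of_complex_mult)

text \<open>
  An eigenvector \<open>v\<close> has the orbit \<open>v l\<^sup>k\<close>. If \<open>C w = w l + v\<close> and \<open>C v = v l\<close> with \<open>\<bar>l\<bar> = 1\<close>, then
  \<open>C\<^sup>k w = (w + k z) l\<^sup>k\<close> with \<open>z = v l\<^sup>-\<^sup>1\<close>, which is bounded only if \<open>v = 0\<close>.
\<close>

lemma eventually_bounded_multipliers:
  fixes C :: "quat ^ 'n ^ 'n"
  assumes bdd: "\<And>c. \<exists>b. \<forall>\<^sub>F k in sequentially. norm (((\<lambda>v. C *v v) ^^ k) c) \<le> b"
    and v: "v \<noteq> 0" "shifted C l v = 0"
  shows "cmod l \<le> 1" "cmod l = 1 \<Longrightarrow> semisimple_at C l"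
proof -
  show "cmod l \<le> 1"
  proof (rule ccontr)
    assume "\<not> cmod l \<le> 1"
    then have gt: "1 < cmod l" by simp
    obtain b N where b: "\<And>k. N \<le> k \<Longrightarrow> norm (((\<lambda>v. C *v v) ^^ k) v) \<le> b"
      using bdd [of v] by (auto simp: eventually_sequentially)
    obtain p where p: "b / norm v < cmod l ^ p"
      using real_arch_pow [OF gt] by blast
    also have "\<dots> \<le> cmod l ^ max p N"
      using gt by (intro power_increasing) auto
    finally have "b < norm v * cmod l ^ max p N"
      using v(1) by (simp add: field_simps)
    moreover have "norm v * cmod l ^ max p N \<le> b"
      using b [of "max p N"] by (simp add: iterate_eigenvector [OF v(2)] norm_rscale norm_power)
    ultimately show False by simp
  qed
  show "semisimple_at C l" if l: "cmod l = 1"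
    unfolding semisimple_at_def
  proof (intro allI impI)
    fix w assume w: "shifted C l (shifted C l w) = 0"
    define z where "z = shifted C l w \<triangleleft> quat_of_complex (inverse l)"
    have "l \<noteq> 0"
      using l by auto
    then have zl: "z \<triangleleft> quat_of_complex l = shifted C l w"
      by (simp add: z_def rscale_rscale quat_of_complex_mult [symmetric])
    have z0: "shifted C l z = 0"
      by (simp add: z_def shifted_rscale w)
    have it: "((\<lambda>v. C *v v) ^^ k) w = (w + real k *\<^sub>R z) \<triangleleft> quat_of_complex (l ^ k)" for k
    proof (induction k)
      case (Suc k)
      have "C *v (w + real k *\<^sub>R z) = (w + real (Suc k) *\<^sub>R z) \<triangleleft> quat_of_complex l"
      proof -
        have "C *v z = z \<triangleleft> quat_of_complex l"
          using z0 by (simp add: shifted_eq_0)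
        moreover have "C *v w = w \<triangleleft> quat_of_complex l + z \<triangleleft> quat_of_complex l"
          unfolding zl by (simp add: shifted_def)
        ultimately show ?thesis
          by (simp add: matrix_vector_right_distrib matrix_vector_scaleR rscale_add_left
              rscale_scaleR_left algebra_simps)
      qed
      then show ?case
        by (simp add: Suc matrix_vector_rscale rscale_rscale quat_of_complex_mult)
    qed simp
    obtain b N where b: "\<And>k. N \<le> k \<Longrightarrow> norm (((\<lambda>v. C *v v) ^^ k) w) \<le> b"
      using bdd [of w] by (auto simp: eventually_sequentially)
    have "z = 0"
    proof (rule ccontr)
      assume "z \<noteq> 0"
      obtain p where p: "(b + norm w) / norm z < real p"
        using reals_Archimedean2 by blast
      have "real (max p N) * norm z = norm ((w + real (max p N) *\<^sub>R z) - w)"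
        by simp
      also have "\<dots> \<le> norm (w + real (max p N) *\<^sub>R z) + norm w"
        by (rule norm_triangle_ineq4)
      also have "\<dots> \<le> b + norm w"
        using b [of "max p N"] by (simp add: it norm_rscale norm_power l)
      finally have "real (max p N) \<le> (b + norm w) / norm z"
        using \<open>z \<noteq> 0\<close> by (simp add: field_simps)
      with p show False by simp
    qed
    then show "shifted C l w = 0"
      using zl by simp
  qed
qed

lemma null_orbits_multipliers:
  fixes C :: "quat ^ 'n ^ 'n"
  assumes lim: "\<And>c. (\<lambda>k. ((\<lambda>v. C *v v) ^^ k) c) \<longlonglongrightarrow> 0"
    and v: "v \<noteq> 0" "shifted C l v = 0"
  shows "cmod l < 1"
proof (rule ccontr)
  assume "\<not> cmod l < 1"
  then have "norm v \<le> norm v * cmod l ^ k" for k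
    by (simp add: one_le_power mult_le_cancel_left1)
  moreover have "(\<lambda>k. norm v * cmod l ^ k) \<longlonglongrightarrow> 0"
    using tendsto_norm_zero [OF lim [of v]]
    by (simp add: iterate_eigenvector [OF v(2)] norm_rscale norm_power)
  ultimately have "norm v \<le> 0"
    by (intro LIMSEQ_le_const) auto
  with v(1) show False by simp
qed

section \<open>Sufficient conditions on the exponents\<close>

lemma exponential_polynomial_tendsto_0:
  assumes "a < 0"
  shows "((\<lambda>t :: real. t ^ k / fact k * exp (a * t)) \<longlongrightarrow> 0) at_top"
proof -
  have "filterlim (\<lambda>t :: real. - a * t) at_top at_top"
    using assms by (intro filterlim_tendsto_pos_mult_at_top [OF tendsto_const]) (auto simp: filterlim_ident)
  from filterlim_compose [OF tendsto_power_div_exp_0 this, of k]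
  have "((\<lambda>t. inverse ((- a) ^ k * fact k) * ((- a * t) ^ k / exp (- a * t))) \<longlongrightarrow>
      inverse ((- a) ^ k * fact k) * 0) at_top"
    by (intro tendsto_intros)
  moreover have "inverse ((- a) ^ k * fact k) * ((- a * t) ^ k / exp (- a * t))
      = t ^ k / fact k * exp (a * t)" for t
  proof -
    have "exp (a * t) * exp (- a * t) = 1"
      by (simp flip: exp_add)
    then have "exp (a * t) = inverse (exp (- a * t))"
      by (simp add: inverse_unique [symmetric] mult.commute)
    then show ?thesis
      using assms by (simp only: power_mult_distrib) (simp add: field_simps)
  qed
  ultimately show ?thesis by simp
qed

lemma matrix_exp_generalized_eigenvector_tendsto_0:
  assumes "v \<in> generalized_eigenspace X l" "Re l < 0"
  shows "((\<lambda>t. matrix_exp (t *\<^sub>R X) *v v) \<longlongrightarrow> 0) at_top"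
proof -
  obtain m where m: "(shifted X l ^^ m) v = 0"
    using assms(1) by (auto simp: generalized_eigenspace_def)
  have "((\<lambda>t. w \<triangleleft> quat_of_complex (of_real (t ^ k / fact k) * exp (of_real t * l)))
      \<longlongrightarrow> 0) at_top" for k and w :: "quat ^ 'a"
  proof (rule tendsto_norm_zero_cancel)
    have "((\<lambda>t. norm w * \<bar>t ^ k / fact k * exp (Re l * t)\<bar>) \<longlongrightarrow> norm w * \<bar>0\<bar>) at_top"
      by (intro tendsto_intros exponential_polynomial_tendsto_0 assms(2))
    then show "((\<lambda>t. norm (w \<triangleleft> quat_of_complex (of_real (t ^ k / fact k) * exp (of_real t * l))))
        \<longlongrightarrow> 0) at_top"
      by (simp add: norm_rscale norm_mult norm_power norm_divide abs_mult power_abs mult.commute)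
  qed
  then show ?thesis
    unfolding matrix_exp_generalized_eigenvector [OF m] by (intro tendsto_null_sum)
qed

lemma semisimple_generalized_eigenvector:
  assumes "semisimple_at X l" "v \<in> generalized_eigenspace X l"
  shows "shifted X l v = 0"
proof -
  obtain m where "(shifted X l ^^ m) v = 0"
    using assms(2) by (auto simp: generalized_eigenspace_def)
  then show ?thesis
  proof (induction m arbitrary: v)
    case 0
    then show ?case by (simp add: linear_0 [OF linear_shifted])
  next
    case (Suc m)
    then have "shifted X l (shifted X l v) = 0"
      by (simp add: funpow_Suc_right del: funpow.simps)
    then show ?case
      using assms(1) by (simp add: semisimple_at_def)
  qed
qed

lemma matrix_exp_eigenvector:
  assumes "shifted X l v = 0"
  shows "matrix_exp (t *\<^sub>R X) *v v = v \<triangleleft> quat_of_complex (exp (of_real t * l))"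
  using matrix_exp_generalized_eigenvector [of 1 X l v t] assms by simp

lemma matrix_exp_tendsto_0:
  fixes X :: "quat ^ 'n ^ 'n"
  assumes "\<And>l v. v \<noteq> 0 \<Longrightarrow> shifted X l v = 0 \<Longrightarrow> Re l < 0"
  shows "((\<lambda>t. matrix_exp (t *\<^sub>R X) *v v) \<longlongrightarrow> 0) at_top"
proof -
  let ?E = "{l. \<exists>v. v \<noteq> 0 \<and> shifted X l v = 0}"
  obtain f where f: "\<And>l. f l \<in> generalized_eigenspace X l" "v = (\<Sum>l\<in>?E. f l)"
    using generalized_eigenvector_decomposition [of X v] by blast
  have "((\<lambda>t. matrix_exp (t *\<^sub>R X) *v f l) \<longlongrightarrow> 0) at_top" if "l \<in> ?E" for l
    using assms that by (intro matrix_exp_generalized_eigenvector_tendsto_0 [OF f(1)]) auto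
  then show ?thesis
    unfolding f(2) matrix_vector_sum by (intro tendsto_null_sum)
qed

lemma matrix_exp_eventually_bounded:
  fixes X :: "quat ^ 'n ^ 'n"
  assumes Re: "\<And>l v. v \<noteq> 0 \<Longrightarrow> shifted X l v = 0 \<Longrightarrow> Re l \<le> 0"
    and ss: "\<And>l v. v \<noteq> 0 \<Longrightarrow> shifted X l v = 0 \<Longrightarrow> Re l = 0 \<Longrightarrow> semisimple_at X l"
  shows "\<exists>b. \<forall>\<^sub>F t in at_top. norm (matrix_exp (t *\<^sub>R X) *v v) \<le> b"
proof -
  let ?E = "{l. \<exists>v. v \<noteq> 0 \<and> shifted X l v = 0}"
  obtain f where f: "\<And>l. f l \<in> generalized_eigenspace X l" "v = (\<Sum>l\<in>?E. f l)"
    using generalized_eigenvector_decomposition [of X v] by blast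
  have "\<exists>b. \<forall>\<^sub>F t in at_top. norm (matrix_exp (t *\<^sub>R X) *v f l) \<le> b" if l: "l \<in> ?E" for l
  proof (cases "Re l < 0")
    case True
    from tendsto_norm_zero [OF matrix_exp_generalized_eigenvector_tendsto_0 [OF f(1) this]]
    have "\<forall>\<^sub>F t in at_top. norm (matrix_exp (t *\<^sub>R X) *v f l) < 1"
      by (rule order_tendstoD) simp
    then have "\<forall>\<^sub>F t in at_top. norm (matrix_exp (t *\<^sub>R X) *v f l) \<le> 1"
      by (rule eventually_mono) simp
    then show ?thesis ..
  next
    case False
    with Re l have "Re l = 0"
      by force
    with ss l have "semisimple_at X l"
      by blast
    then have "shifted X l (f l) = 0"
      using f(1) by (rule semisimple_generalized_eigenvector)
    then have "norm (matrix_exp (t *\<^sub>R X) *v f l) \<le> norm (f l)" for t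
      by (simp add: matrix_exp_eigenvector norm_rscale \<open>Re l = 0\<close>)
    then show ?thesis
      by (intro exI [of _ "norm (f l)"]) simp
  qed
  then have "\<forall>l\<in>?E. \<exists>b. \<forall>\<^sub>F t in at_top. norm (matrix_exp (t *\<^sub>R X) *v f l) \<le> b"
    by (intro ballI)
  from bchoice [OF this] obtain b where
    b: "\<forall>l\<in>?E. \<forall>\<^sub>F t in at_top. norm (matrix_exp (t *\<^sub>R X) *v f l) \<le> b l"
    by (elim exE)
  have "\<forall>\<^sub>F t in at_top. \<forall>l\<in>?E. norm (matrix_exp (t *\<^sub>R X) *v f l) \<le> b l"
    by (rule eventually_ball_finite [OF finite_eigenvalues b])
  then have "\<forall>\<^sub>F t in at_top. norm (matrix_exp (t *\<^sub>R X) *v v) \<le> (\<Sum>l\<in>?E. b l)"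
  proof (rule eventually_mono)
    fix t assume "\<forall>l\<in>?E. norm (matrix_exp (t *\<^sub>R X) *v f l) \<le> b l"
    then show "norm (matrix_exp (t *\<^sub>R X) *v v) \<le> (\<Sum>l\<in>?E. b l)"
      unfolding f(2) matrix_vector_sum by (intro sum_norm_le) auto
  qed
  then show ?thesis ..
qed

section \<open>From the exponential to the system\<close>

lemma fundamental_matrix_continuous:
  assumes "fundamental_matrix A M"
  shows "continuous_on UNIV M"
  using assms unfolding fundamental_matrix_def
  by (auto intro!: continuous_at_imp_continuous_on has_vector_derivative_continuous)

text \<open>
  \<open>P(t) = M(t) e\<^sup>-\<^sup>t\<^sup>B\<close> is continuous, hence bounded over one period.
\<close>

lemma periodic_factor_bounded:
  fixes A M P :: "real \<Rightarrow> quat ^ 'n ^ 'n"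
  assumes T: "T > 0" and M: "fundamental_matrix A M" and F: "floquet_normal_form T M P B"
  shows "\<exists>p. \<forall>t. norm (P t) \<le> p"
proof -
  let ?Q = "\<lambda>t. M t ** matrix_exp ((- t) *\<^sub>R B)"
  have P: "P t = ?Q t" for t
  proof -
    have "?Q t = P t ** (matrix_exp (t *\<^sub>R B) ** matrix_exp ((- t) *\<^sub>R B))"
      using F unfolding floquet_normal_form_def matrix_mul_assoc by (elim conjE) simp
    also have "\<dots> = P t"
      by (simp add: matrix_exp_add [symmetric] del: scaleR_minus_left)
    finally show ?thesis ..
  qed
  have "continuous_on UNIV (\<lambda>t. matrix_exp (t *\<^sub>R B))"
    by (auto intro!: continuous_at_imp_continuous_on
        has_vector_derivative_continuous [OF has_vector_derivative_matrix_exp])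
  then have "continuous_on UNIV (\<lambda>t. matrix_exp ((- t) *\<^sub>R B))"
    by (rule continuous_on_compose2) (auto intro!: continuous_intros)
  then have "continuous_on UNIV ?Q"
    by (intro bounded_bilinear.continuous_on [OF bounded_bilinear_matrix_matrix]
        fundamental_matrix_continuous [OF M])
  then have "continuous_on {0..T} P"
    unfolding P by (rule continuous_on_subset) simp
  then have "bounded (P ` {0..T})"
    by (intro compact_imp_bounded compact_continuous_image) auto
  then obtain p where p: "\<forall>v\<in>P ` {0..T}. norm v \<le> p"
    unfolding bounded_iff by (elim exE)
  have nat: "P (t + real k * T) = P t" for t k
  proof (induction k)
    case (Suc k)
    have "P (t + real (Suc k) * T) = P ((t + real k * T) + T)"
      by (simp add: algebra_simps)
    also have "\<dots> = P (t + real k * T)"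
      using F unfolding floquet_normal_form_def by blast
    finally show ?case
      using Suc by simp
  qed simp
  have "norm (P t) \<le> p" for t
  proof -
    define j where "j = \<lfloor>t / T\<rfloor>"
    define s where "s = t - of_int j * T"
    have "of_int j \<le> t / T" "t / T < of_int j + 1"
      unfolding j_def by linarith+
    then have "s \<in> {0..T}"
      using T by (simp add: s_def field_simps)
    moreover have "P t = P s"
    proof (cases "0 \<le> j")
      case True
      then show ?thesis
        using nat [of s "nat j"] by (simp add: s_def)
    next
      case False
      then show ?thesis
        using nat [of t "nat (- j)"] by (simp add: s_def)
    qed
    ultimately show ?thesis
      using p by simp
  qed
  then show ?thesis by blast
qed

text \<open>
  A solution bounded for large times is bounded on \<open>[t0, \<infinity>)\<close> by continuity. Applied to the columns of
  \<open>M\<close>, this gives an estimate \<open>\<parallel>\<psi>(t)\<parallel> \<le> R \<parallel>\<psi>(t0)\<parallel>\<close> for all solutions at once.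
\<close>

lemma eventually_bounded_imp_stable:
  fixes A M :: "real \<Rightarrow> quat ^ 'n ^ 'n"
  assumes A: "continuous_on UNIV A" and M: "fundamental_matrix A M"
    and bdd: "\<And>c. \<exists>b. \<forall>\<^sub>F t in at_top. norm (M t *v c) \<le> b"
  shows "stable_system A t0"
proof -
  have "\<exists>b. \<forall>t\<ge>t0. norm (M t *v c) \<le> b" for c
  proof -
    obtain b s where b: "\<And>t. s \<le> t \<Longrightarrow> norm (M t *v c) \<le> b"
      using bdd [of c] by (auto simp: eventually_at_top_linorder)
    have "continuous_on {t0..s} (\<lambda>t. M t *v c)"
      by (intro bounded_bilinear.continuous_on [OF bounded_bilinear_matrix_vector]
          continuous_on_subset [OF fundamental_matrix_continuous [OF M]] continuous_on_const) simp
    then have "bounded ((\<lambda>t. M t *v c) ` {t0..s})"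
      by (intro compact_imp_bounded compact_continuous_image) auto
    then obtain d where d: "\<forall>v\<in>(\<lambda>t. M t *v c) ` {t0..s}. norm v \<le> d"
      unfolding bounded_iff by (elim exE)
    have "norm (M t *v c) \<le> max b d" if "t0 \<le> t" for t
      using b [of t] d that by (cases "s \<le> t") (auto simp: le_max_iff_disj)
    then show ?thesis by blast
  qed
  then obtain b where b: "\<And>c t. t0 \<le> t \<Longrightarrow> norm (M t *v c) \<le> b c"
    by metis
  define N where "N = (\<Sum>i\<in>UNIV. b (axis i 1 :: quat ^ 'n))"
  have bound: "norm (M t *v c) \<le> N * norm c" if "t0 \<le> t" for t c
  proof -
    have "norm (M t *v c) \<le> (\<Sum>i\<in>UNIV. norm (column i (M t) \<triangleleft> (c $ i)))"
      unfolding matrix_vector_columns by (rule norm_sum)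
    also have "\<dots> \<le> (\<Sum>i\<in>UNIV. b (axis i 1) * norm c)"
    proof (rule sum_mono)
      fix i :: 'n
      have "0 \<le> b (axis i 1)"
        using b [OF that, of "axis i 1"] norm_ge_zero order_trans by blast
      then show "norm (column i (M t) \<triangleleft> (c $ i)) \<le> b (axis i 1) * norm c"
        unfolding norm_rscale column_eq_mult_axis
        by (intro mult_mono b that Finite_Cartesian_Product.norm_nth_le) auto
    qed
    finally show ?thesis
      by (simp add: N_def sum_distrib_right)
  qed
  obtain K where K: "K > 0" "\<And>v. norm (matrix_inv (M t0) *v v) \<le> norm v * K"
    using bounded_linear.pos_bounded
      [OF bounded_bilinear.bounded_linear_right [OF bounded_bilinear_matrix_vector]] by blast
  define R where "R = real CARD('n) * (\<bar>N\<bar> * K) + 1"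
  have "R > 0"
    using K(1) by (simp add: R_def add_nonneg_pos)
  have est: "norm_sum (\<psi> t) \<le> R * norm_sum (\<psi> t0)" if \<psi>: "is_solution A \<psi>" and t: "t0 \<le> t" for \<psi> t
  proof -
    let ?c = "matrix_inv (M t0) *v \<psi> t0"
    have "norm (\<psi> t) \<le> N * norm ?c"
      using bound [OF t] solution_by_fundamental_matrix [OF A M \<psi>] by metis
    also have "\<dots> \<le> \<bar>N\<bar> * (norm (\<psi> t0) * K)"
      using K by (intro mult_mono) auto
    also have "\<dots> \<le> \<bar>N\<bar> * (norm_sum (\<psi> t0) * K)"
      using K(1) by (intro mult_left_mono mult_right_mono norm_le_norm_sum) auto
    finally have "norm_sum (\<psi> t) \<le> real CARD('n) * (\<bar>N\<bar> * (norm_sum (\<psi> t0) * K))"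
      using norm_sum_le_norm [of "\<psi> t"] by (meson mult_left_mono of_nat_0_le_iff order_trans)
    moreover have "0 \<le> norm_sum (\<psi> t0)"
      using norm_le_norm_sum norm_ge_zero order_trans by blast
    ultimately show ?thesis
      by (simp add: R_def algebra_simps)
  qed
  show ?thesis
    unfolding stable_system_def stable_solution_def
  proof (intro allI impI)
    fix \<epsilon> :: real assume "\<epsilon> > 0"
    have "norm_sum (\<psi> t) < \<epsilon>"
      if "is_solution A \<psi>" "norm_sum (\<psi> t0) < \<epsilon> / R" "t0 \<le> t" for \<psi> t
      using est [OF that(1,3)] that(2) \<open>R > 0\<close> by (simp add: field_simps)
    then show "\<exists>\<delta>>0. \<forall>\<psi>. is_solution A \<psi> \<and> norm_sum (\<psi> t0 - 0) < \<delta> \<longrightarrow>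
        (\<forall>t\<ge>t0. norm_sum (\<psi> t - 0) < \<epsilon>)"
      using \<open>\<epsilon> > 0\<close> \<open>R > 0\<close> by (intro exI [of _ "\<epsilon> / R"]) simp
  qed
qed

lemma tendsto_0_imp_asymptotically_stable:
  fixes A M :: "real \<Rightarrow> quat ^ 'n ^ 'n"
  assumes A: "continuous_on UNIV A" and M: "fundamental_matrix A M"
    and lim: "\<And>c. ((\<lambda>t. M t *v c) \<longlongrightarrow> 0) at_top"
  shows "asymptotically_stable_system A t0"
proof -
  have "((\<lambda>t. norm_sum (\<psi> t)) \<longlongrightarrow> 0) at_top" if \<psi>: "is_solution A \<psi>" for \<psi>
  proof -
    have "((\<lambda>t. M t *v (matrix_inv (M t0) *v \<psi> t0)) \<longlongrightarrow> 0) at_top"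
      by (rule lim)
    then have "(\<psi> \<longlongrightarrow> 0) at_top"
      by (simp flip: solution_by_fundamental_matrix [OF A M \<psi>])
    then have "((\<lambda>t. \<Sum>k\<in>UNIV. norm (\<psi> t $ k)) \<longlongrightarrow> (\<Sum>k\<in>(UNIV :: 'n set). norm ((0 :: quat ^ 'n) $ k))) at_top"
      by (intro tendsto_intros)
    then show ?thesis
      by (simp add: norm_sum_def)
  qed
  then show ?thesis
    unfolding asymptotically_stable_system_def asymptotically_stable_solution_def
    by (intro exI [of _ 1]) simp
qed

section \<open>Stability of periodic systems\<close>

theorem theorem4p7:
  fixes T t0 :: real
    and A M P :: "real \<Rightarrow> quat ^ 'n ^ 'n"
    and B :: "quat ^ 'n ^ 'n"
  assumes "T > 0"
    and "continuous_on UNIV A"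
    and "\<And>t. A (t + T) = A t"
    and "fundamental_matrix A M"
    and "floquet_normal_form T M P B"
  shows
    "(stable_system A t0 \<longleftrightarrow>
        (\<forall>l\<in>standard_eigenvalues B. Re l \<le> 0) \<and>
        (\<forall>l\<in>standard_eigenvalues B. Re l = 0 \<longrightarrow>
           algebraic_multiplicity B l = geometric_multiplicity B l)) \<and>
     (stable_system A t0 \<longleftrightarrow>
        (\<forall>\<mu>\<in>characteristic_multipliers A T. cmod \<mu> \<le> 1) \<and>
        (\<forall>\<mu>\<in>characteristic_multipliers A T. cmod \<mu> = 1 \<longrightarrow>
           multiplier_algebraic_multiplicity A T \<mu> = multiplier_geometric_multiplicity A T \<mu>)) \<and>
     (asymptotically_stable_system A t0 \<longleftrightarrow> (\<forall>l\<in>standard_eigenvalues B. Re l < 0)) \<and>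
     (asymptotically_stable_system A t0 \<longleftrightarrow> (\<forall>\<mu>\<in>characteristic_multipliers A T. cmod \<mu> < 1))"
proof -
  note A = assms(2) and per = assms(3) and M = assms(4) and F = assms(5)
  define C where "C = matrix_inv (M 0) ** M T"
  note multipliers = characteristic_multipliers_eq [OF A M, of T, folded C_def]
  have expC: "matrix_exp (T *\<^sub>R B) = C"
    using F unfolding floquet_normal_form_def C_def by (elim conjE)
  have MP: "M t *v c = P t *v (matrix_exp (t *\<^sub>R B) *v c)" for t c
    using F unfolding floquet_normal_form_def matrix_vector_mul_assoc by (elim conjE) simp
  have alg_geo: "algebraic_multiplicity X l = geometric_multiplicity X l \<longleftrightarrow> semisimple_at X l"
    if "l \<in> standard_eigenvalues X" for X :: "quat ^ 'n ^ 'n" and l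
    using that by (intro algebraic_eq_geometric_iff_semisimple) (simp add: standard_eigenvalues_def)
  have eigenvector: "\<exists>v. v \<noteq> 0 \<and> shifted X l v = 0" if "l \<in> standard_eigenvalues X"
    for X :: "quat ^ 'n ^ 'n" and l
    using that by (simp add: standard_eigenvalues_def right_eigenvalue_shifted)

  \<comment> \<open>the conditions on \<open>B\<close> and on \<open>C\<close>, without multiplicities\<close>
  let ?B = "(\<forall>l\<in>standard_eigenvalues B. Re l \<le> 0) \<and>
    (\<forall>l\<in>standard_eigenvalues B. Re l = 0 \<longrightarrow> semisimple_at B l)"
  let ?C = "(\<forall>\<mu>\<in>standard_eigenvalues C. cmod \<mu> \<le> 1) \<and>
    (\<forall>\<mu>\<in>standard_eigenvalues C. cmod \<mu> = 1 \<longrightarrow> semisimple_at C \<mu>)"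

  have period_inverse: "((\<lambda>v. C *v v) ^^ k) c = matrix_inv (M 0) *v (M (real k * T) *v c)" for k c
    unfolding fundamental_matrix_periods [OF A per M] C_def
    by (simp add: matrix_inv_cancel fundamental_matrix_invertible [OF M])
  have multiples: "filterlim (\<lambda>k. real k * T) at_top sequentially"
    using assms(1) by (intro filterlim_at_top_mult_tendsto_pos [OF tendsto_const]
        filterlim_real_sequentially)
  obtain K where K: "K > 0" "\<And>v. norm (matrix_inv (M 0) *v v) \<le> norm v * K"
    using bounded_linear.pos_bounded
      [OF bounded_bilinear.bounded_linear_right [OF bounded_bilinear_matrix_vector]] by blast

  have stable_C: ?C if stable: "stable_system A t0"
  proof -
    have bdd: "\<exists>b. \<forall>\<^sub>F k in sequentially. norm (((\<lambda>v. C *v v) ^^ k) c) \<le> b" for c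
    proof -
      obtain b where b: "\<And>t. t0 \<le> t \<Longrightarrow> norm (M t *v c) \<le> b"
        using stable_orbits_bounded [OF stable M] by blast
      have "\<forall>\<^sub>F k in sequentially. t0 \<le> real k * T"
        using multiples by (auto simp: filterlim_at_top)
      then have "\<forall>\<^sub>F k in sequentially. norm (((\<lambda>v. C *v v) ^^ k) c) \<le> b * K"
      proof (rule eventually_mono)
        fix k assume "t0 \<le> real k * T"
        then have "norm (M (real k * T) *v c) * K \<le> b * K"
          using b K(1) by (intro mult_right_mono) auto
        then show "norm (((\<lambda>v. C *v v) ^^ k) c) \<le> b * K"
          unfolding period_inverse using K(2) order_trans by blast
      qed
      then show ?thesis ..
    qed
    show ?thesis
      using eventually_bounded_multipliers [OF bdd] eigenvector by blast
  qed
  have asymptotic_C: "\<forall>\<mu>\<in>standard_eigenvalues C. cmod \<mu> < 1"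
    if stable: "asymptotically_stable_system A t0"
  proof -
    have "(\<lambda>k. ((\<lambda>v. C *v v) ^^ k) c) \<longlonglongrightarrow> 0" for c
    proof -
      have "(\<lambda>k. M (real k * T) *v c) \<longlonglongrightarrow> 0"
        by (rule filterlim_compose [OF asymptotically_stable_orbits_tendsto [OF stable M] multiples])
      then show ?thesis
        unfolding period_inverse
        by (rule bounded_linear.tendsto_zero
            [OF bounded_bilinear.bounded_linear_right [OF bounded_bilinear_matrix_vector]])
    qed
    then show ?thesis
      using null_orbits_multipliers eigenvector by blast
  qed

  have exp_eigenvector: "shifted C (exp (of_real T * l)) v = 0" if "shifted B l v = 0" for l v
    using matrix_exp_eigenvector [OF that, of T] by (simp add: expC shifted_eq_0)
  \<comment> \<open>if \<open>B w = w l + v\<close> and \<open>B v = v l\<close>, then \<open>C w = w \<mu> + v T \<mu>\<close> with \<open>\<mu> = e\<^sup>T\<^sup>l\<close>, again a chain of length two\<close>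
  have exp_semisimple: "semisimple_at B l" if ss: "semisimple_at C (exp (of_real T * l))" for l
    unfolding semisimple_at_def
  proof (intro allI impI)
    fix w assume w: "shifted B l (shifted B l w) = 0"
    let ?\<mu> = "exp (of_real T * l)" and ?v = "shifted B l w"
    have "C *v w = w \<triangleleft> quat_of_complex ?\<mu> + ?v \<triangleleft> quat_of_complex (of_real T * ?\<mu>)"
      using matrix_exp_generalized_eigenvector [of "Suc (Suc 0)" B l w T] w by (simp add: expC)
    then have e: "shifted C ?\<mu> w = ?v \<triangleleft> quat_of_complex (of_real T * ?\<mu>)"
      by (simp add: shifted_def)
    then have "shifted C ?\<mu> (shifted C ?\<mu> w) = 0"
      by (simp add: shifted_rscale exp_eigenvector [OF w])
    then have "shifted C ?\<mu> w = 0"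
      using ss unfolding semisimple_at_def by blast
    then show "?v = 0"
      using e assms(1) by (simp add: rscale_cancel)
  qed
  have exp_norm: "cmod (exp (of_real T * l)) = exp (T * Re l)" for l
    by simp

  \<comment> \<open>\<open>e\<^sup>T\<^sup>l\<close> may lie in the lower half plane even if \<open>l\<close> does not; its conjugate is then the multiplier\<close>
  have C_B: "Re l \<le> 0" "Re l = 0 \<Longrightarrow> semisimple_at B l"
    if C: ?C and v: "v \<noteq> 0" "shifted B l v = 0" for l v
  proof -
    obtain \<mu> where \<mu>: "\<mu> \<in> standard_eigenvalues C" "cmod \<mu> = exp (T * Re l)"
      "semisimple_at C \<mu> \<longleftrightarrow> semisimple_at C (exp (of_real T * l))"
      using standard_eigenvalue_of_eigenvector [OF v(1) exp_eigenvector [OF v(2)]]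
      by (auto simp: exp_norm)
    then have "exp (T * Re l) \<le> 1"
      using C by metis
    then show "Re l \<le> 0"
      using assms(1) by (simp add: mult_le_0_iff)
    show "semisimple_at B l" if "Re l = 0"
      using C \<mu> that by (intro exp_semisimple) simp
  qed
  have C_B_strict: "Re l < 0"
    if C: "\<forall>\<mu>\<in>standard_eigenvalues C. cmod \<mu> < 1" and v: "v \<noteq> 0" "shifted B l v = 0" for l v
  proof -
    obtain \<mu> where \<mu>: "\<mu> \<in> standard_eigenvalues C" "cmod \<mu> = exp (T * Re l)"
      using standard_eigenvalue_of_eigenvector [OF v(1) exp_eigenvector [OF v(2)]]
      by (auto simp: exp_norm)
    then have "exp (T * Re l) < 1"
      using C by metis
    then show "Re l < 0"
      using assms(1) by (simp add: mult_less_0_iff)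
  qed

  have B_stable: "stable_system A t0" if B: ?B
  proof (rule eventually_bounded_imp_stable [OF A M])
    fix c
    obtain p where p: "\<And>t. norm (P t) \<le> p"
      using periodic_factor_bounded [OF assms(1) M F] by blast
    obtain L where L: "L > 0" "\<And>(X :: quat ^ 'n ^ 'n) v. norm (X *v v) \<le> norm X * norm v * L"
      using bounded_bilinear.pos_bounded [OF bounded_bilinear_matrix_vector] by metis
    have "Re l \<le> 0" "Re l = 0 \<Longrightarrow> semisimple_at B l" if "v \<noteq> 0" "shifted B l v = 0" for l v
      using standard_eigenvalue_of_eigenvector [OF that] B by auto
    then obtain b where "\<forall>\<^sub>F t in at_top. norm (matrix_exp (t *\<^sub>R B) *v c) \<le> b"
      using matrix_exp_eventually_bounded [of B c] by blast
    then have "\<forall>\<^sub>F t in at_top. norm (M t *v c) \<le> p * b * L"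
    proof (rule eventually_mono)
      fix t assume b: "norm (matrix_exp (t *\<^sub>R B) *v c) \<le> b"
      note MP [of t c]
      also have "norm (P t *v (matrix_exp (t *\<^sub>R B) *v c)) \<le> norm (P t) * norm (matrix_exp (t *\<^sub>R B) *v c) * L"
        by (rule L)
      also have "\<dots> \<le> p * b * L"
        using L(1) b order_trans [OF norm_ge_zero p]
        by (intro mult_right_mono mult_mono p) auto
      finally show "norm (M t *v c) \<le> p * b * L" .
    qed
    then show "\<exists>b. \<forall>\<^sub>F t in at_top. norm (M t *v c) \<le> b" ..
  qed
  have B_asymptotic: "asymptotically_stable_system A t0"
    if B: "\<forall>l\<in>standard_eigenvalues B. Re l < 0"
  proof (rule tendsto_0_imp_asymptotically_stable [OF A M])
    fix c
    obtain p where p: "\<And>t. norm (P t) \<le> p"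
      using periodic_factor_bounded [OF assms(1) M F] by blast
    obtain L where L: "L > 0" "\<And>(X :: quat ^ 'n ^ 'n) v. norm (X *v v) \<le> norm X * norm v * L"
      using bounded_bilinear.pos_bounded [OF bounded_bilinear_matrix_vector] by metis
    have "Re l < 0" if "v \<noteq> 0" "shifted B l v = 0" for l v
      using standard_eigenvalue_of_eigenvector [OF that] B by auto
    then have "((\<lambda>t. matrix_exp (t *\<^sub>R B) *v c) \<longlongrightarrow> 0) at_top"
      by (rule matrix_exp_tendsto_0)
    then have "((\<lambda>t. p * norm (matrix_exp (t *\<^sub>R B) *v c) * L) \<longlongrightarrow> p * norm (0 :: quat ^ 'n) * L) at_top"
      by (intro tendsto_intros)
    then have lim: "((\<lambda>t. p * norm (matrix_exp (t *\<^sub>R B) *v c) * L) \<longlongrightarrow> 0) at_top"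
      by simp
    have "norm (M t *v c) \<le> p * norm (matrix_exp (t *\<^sub>R B) *v c) * L" for t
    proof -
      note MP [of t c]
      also have "norm (P t *v (matrix_exp (t *\<^sub>R B) *v c)) \<le> norm (P t) * norm (matrix_exp (t *\<^sub>R B) *v c) * L"
        by (rule L)
      also have "\<dots> \<le> p * norm (matrix_exp (t *\<^sub>R B) *v c) * L"
        using L(1) by (intro mult_right_mono p) auto
      finally show ?thesis .
    qed
    then show "((\<lambda>t. M t *v c) \<longlongrightarrow> 0) at_top"
      by (intro Lim_null_comparison [OF always_eventually [OF allI] lim])
  qed

  have C_imp_B: ?B if C: ?C
  proof (intro conjI ballI impI)
    fix l assume "l \<in> standard_eigenvalues B"
    then obtain v where v: "v \<noteq> 0" "shifted B l v = 0"
      using eigenvector by blast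
    show "Re l \<le> 0"
      by (rule C_B(1) [OF C v])
    show "semisimple_at B l" if "Re l = 0"
      by (rule C_B(2) [OF C v that])
  qed
  have C_imp_B_strict: "\<forall>l\<in>standard_eigenvalues B. Re l < 0"
    if C: "\<forall>\<mu>\<in>standard_eigenvalues C. cmod \<mu> < 1"
  proof
    fix l assume "l \<in> standard_eigenvalues B"
    then obtain v where v: "v \<noteq> 0" "shifted B l v = 0"
      using eigenvector by blast
    show "Re l < 0"
      by (rule C_B_strict [OF C v])
  qed

  have "stable_system A t0 \<longleftrightarrow> ?B"
    by (rule iffI [OF C_imp_B [OF stable_C] B_stable])
  moreover have "stable_system A t0 \<longleftrightarrow> ?C"
    by (rule iffI [OF stable_C B_stable [OF C_imp_B]])
  moreover have "asymptotically_stable_system A t0 \<longleftrightarrow> (\<forall>l\<in>standard_eigenvalues B. Re l < 0)"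
    by (rule iffI [OF C_imp_B_strict [OF asymptotic_C] B_asymptotic])
  moreover have "asymptotically_stable_system A t0 \<longleftrightarrow>
      (\<forall>\<mu>\<in>standard_eigenvalues C. cmod \<mu> < 1)"
    by (rule iffI [OF asymptotic_C B_asymptotic [OF C_imp_B_strict]])
  moreover have "(\<forall>l\<in>standard_eigenvalues B. Re l = 0 \<longrightarrow>
      algebraic_multiplicity B l = geometric_multiplicity B l) \<longleftrightarrow>
      (\<forall>l\<in>standard_eigenvalues B. Re l = 0 \<longrightarrow> semisimple_at B l)"
    "(\<forall>\<mu>\<in>standard_eigenvalues C. cmod \<mu> = 1 \<longrightarrow>
      algebraic_multiplicity C \<mu> = geometric_multiplicity C \<mu>) \<longleftrightarrow>
      (\<forall>\<mu>\<in>standard_eigenvalues C. cmod \<mu> = 1 \<longrightarrow> semisimple_at C \<mu>)"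
    by (simp_all add: alg_geo)
  ultimately show ?thesis
    unfolding multipliers by (intro conjI) simp_all
qed

end
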